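(* Let $n\ge 1$ and let $V$ be any energy-conserving unitary on $n$ qubits, i.e. $[V,\sum_{j=1}^n Z_j]=0$. Then $V$ can be realized exactly, up to a possible global phase, using $\mathcal{O}(4^n n^{3/2})$ gates from any one of the following gate sets: 1. $\sqrt{\mathrm{iSWAP}}=\exp(i\frac{\pi}{4}R)$ and $\exp(i\phi Z)$, $\phi\in(-\pi,\pi]$, with one ancilla qubit; 2. $\exp(i\alpha H_{\mathrm{int}})$, $\alpha\in\mathbb{R}$, and $S=e^{i\pi/4}\exp(-i\pi Z/4)$, with one ancilla qubit, where $H_{\mathrm{int}}$ is any fixed energy-conserving two-qubit Hamiltonian that is not diagonal in the computational basis, i.e. $[H_{\mathrm{int}},Z\otimes\mathbb{I}]=-[H_{\mathrm{int}},\mathbb{I}\otimes Z]\neq 0$; 3. $\exp(i\alpha R)$, $\alpha\in(-\pi,\pi]$, with two ancilla qubits.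
   Context: $X,Y,Z$ are the Pauli matrices, $Z_j$ is $Z$ acting on qubit $j$ tensored with the identity on the other qubits, and $R=\frac12(X\otimes X+Y\otimes Y)$. Single-qubit gates may be applied to any qubit and two-qubit gates to any ordered pair of qubits (system or ancilla). "$V$ is realized up to a global phase with $a$ ancilla qubits" means: there is a circuit (finite product of gates from the set) on $n+a$ qubits whose overall unitary $\widetilde V$ satisfies, for some phase $e^{i\phi}$, $\widetilde V(|\psi\rangle\otimes|0\rangle^{\otimes a})=e^{i\phi}(V|\psi\rangle)\otimes|0\rangle^{\otimes a}$ for all $|\psi\rangle\in(\mathbb{C}^2)^{\otimes n}$. The implied constant in $\mathcal{O}$ does not depend on $n$ or $V$ (in case 2 it may depend on $H_{\mathrm{int}}$). *)

theory Defs
  imports Complex_Main "Jordan_Normal_Form.Schur_Decomposition"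
begin

section \<open>Linear algebra\<close>

definition kron :: "complex mat \<Rightarrow> complex mat \<Rightarrow> complex mat" (infixr \<open>\<otimes>\<^sub>m\<close> 72) where
  "A \<otimes>\<^sub>m B = mat (dim_row A * dim_row B) (dim_col A * dim_col B)
     (\<lambda>(i, j). A $$ (i div dim_row B, j div dim_col B) * B $$ (i mod dim_row B, j mod dim_col B))"

definition kron_vec :: "complex vec \<Rightarrow> complex vec \<Rightarrow> complex vec" (infixr \<open>\<otimes>\<^sub>v\<close> 72) where
  "u \<otimes>\<^sub>v v = vec (dim_vec u * dim_vec v) (\<lambda>i. u $ (i div dim_vec v) * v $ (i mod dim_vec v))"

definition commutator :: "complex mat \<Rightarrow> complex mat \<Rightarrow> complex mat" where
  "commutator A B = A * B - B * A"

definition hermitian_mat :: "complex mat \<Rightarrow> bool" where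
  "hermitian_mat A \<longleftrightarrow> square_mat A \<and> mat_adjoint A = A"

definition unitary_mat :: "complex mat \<Rightarrow> bool" where
  "unitary_mat U \<longleftrightarrow> square_mat U \<and>
     U * mat_adjoint U = 1\<^sub>m (dim_row U) \<and> mat_adjoint U * U = 1\<^sub>m (dim_row U)"

text \<open>The exponential power series, summed entry by entry. For a square matrix every
  entry series converges absolutely, so \<^const>\<open>suminf\<close> is never applied to a divergent series.\<close>

definition mat_exp :: "complex mat \<Rightarrow> complex mat" where
  "mat_exp A = mat (dim_row A) (dim_row A) (\<lambda>(i, j). \<Sum>k. (A ^\<^sub>m k) $$ (i, j) / fact k)"

section \<open>Qubits and gates\<close>

definition pauli_X :: "complex mat" where
  "pauli_X = mat_of_rows_list 2 [[0, 1], [1, 0]]"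

definition pauli_Y :: "complex mat" where
  "pauli_Y = mat_of_rows_list 2 [[0, - \<i>], [\<i>, 0]]"

definition pauli_Z :: "complex mat" where
  "pauli_Z = mat_of_rows_list 2 [[1, 0], [0, - 1]]"

definition R_mat :: "complex mat" where
  "R_mat = (1 / 2) \<cdot>\<^sub>m (pauli_X \<otimes>\<^sub>m pauli_X + pauli_Y \<otimes>\<^sub>m pauli_Y)"

definition sqrt_iSWAP :: "complex mat" where
  "sqrt_iSWAP = mat_exp ((\<i> * pi / 4) \<cdot>\<^sub>m R_mat)"

definition S_gate :: "complex mat" where
  "S_gate = exp (\<i> * pi / 4) \<cdot>\<^sub>m mat_exp ((- \<i> * pi / 4) \<cdot>\<^sub>m pauli_Z)"

text \<open>Qubits are numbered from 0 and, in agreement with \<^const>\<open>kron\<close> and \<^const>\<open>kron_vec\<close>,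
  qubit 0 is the leftmost tensor factor: the basis state with index \<open>i\<close> of \<open>N\<close> qubits is
  the tensor product of the states given by the binary digits of \<open>i\<close>, most significant first.\<close>

definition qubit_bit :: "nat \<Rightarrow> nat \<Rightarrow> nat \<Rightarrow> nat" where
  "qubit_bit N i j = (i div 2 ^ (N - 1 - j)) mod 2"

definition sub_index :: "nat \<Rightarrow> nat list \<Rightarrow> nat \<Rightarrow> nat" where
  "sub_index N qs i = foldl (\<lambda>acc j. 2 * acc + qubit_bit N i j) 0 qs"

text \<open>\<open>on_qubits N qs G\<close> is the operator on \<open>N\<close> qubits that applies \<open>G\<close> to the qubits in \<open>qs\<close>
  (the \<open>k\<close>-th entry of the list being the \<open>k\<close>-th tensor factor of \<open>G\<close>) and is the identity on
  the other qubits.\<close>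

definition on_qubits :: "nat \<Rightarrow> nat list \<Rightarrow> complex mat \<Rightarrow> complex mat" where
  "on_qubits N qs G = mat (2 ^ N) (2 ^ N) (\<lambda>(r, c).
     if \<forall>l < N. l \<notin> set qs \<longrightarrow> qubit_bit N r l = qubit_bit N c l
     then G $$ (sub_index N qs r, sub_index N qs c) else 0)"

lemma less_4_cases: "(i::nat) < 4 \<longleftrightarrow> i = 0 \<or> i = 1 \<or> i = 2 \<or> i = 3"
  by auto

lemma on_qubits_0_of_2:
  assumes "A \<in> carrier_mat 2 2"
  shows "on_qubits 2 [0] A = A \<otimes>\<^sub>m 1\<^sub>m 2"
  using assms
  by (intro eq_matI)
    (auto simp: on_qubits_def kron_def sub_index_def qubit_bit_def less_4_cases less_2_cases_iff)

lemma on_qubits_1_of_2: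
  assumes "A \<in> carrier_mat 2 2"
  shows "on_qubits 2 [1] A = 1\<^sub>m 2 \<otimes>\<^sub>m A"
  using assms
  by (intro eq_matI)
    (auto simp: on_qubits_def kron_def sub_index_def qubit_bit_def less_4_cases less_2_cases_iff)

lemma on_qubits_01_of_2:
  assumes "A \<in> carrier_mat 4 4"
  shows "on_qubits 2 [0, 1] A = A"
  using assms
  by (intro eq_matI)
    (auto simp: on_qubits_def sub_index_def qubit_bit_def less_4_cases less_2_cases_iff)

definition total_Z :: "nat \<Rightarrow> complex mat" where
  "total_Z n = foldr (+) (map (\<lambda>j. on_qubits n [j] pauli_Z) [0..<n]) (0\<^sub>m (2 ^ n) (2 ^ n))"

definition energy_conserving :: "nat \<Rightarrow> complex mat \<Rightarrow> bool" where
  "energy_conserving n V \<longleftrightarrow> commutator V (total_Z n) = 0\<^sub>m (2 ^ n) (2 ^ n)"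

section \<open>Circuits\<close>

text \<open>All operators on \<open>N\<close> qubits obtained by applying a single-qubit gate from \<open>G1\<close> to some
  qubit or a two-qubit gate from \<open>G2\<close> to some ordered pair of distinct qubits.\<close>

definition gate_ops :: "nat \<Rightarrow> complex mat set \<Rightarrow> complex mat set \<Rightarrow> complex mat set" where
  "gate_ops N G1 G2 =
     {on_qubits N [j] g | j g. j < N \<and> g \<in> G1} \<union>
     {on_qubits N [j, k] g | j k g. j < N \<and> k < N \<and> j \<noteq> k \<and> g \<in> G2}"

definition circuit_mat :: "nat \<Rightarrow> complex mat list \<Rightarrow> complex mat" where
  "circuit_mat N gs = foldr (*) gs (1\<^sub>m (2 ^ N))"

text \<open>\<open>W\<close> acts on \<open>n\<close> system qubits followed by \<open>a\<close> ancilla qubits; \<open>unit_vec (2 ^ a) 0\<close> is the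
  state with every ancilla in \<open>|0\<rangle>\<close>.\<close>

definition implements :: "nat \<Rightarrow> nat \<Rightarrow> complex mat \<Rightarrow> complex mat \<Rightarrow> bool" where
  "implements n a W V \<longleftrightarrow> (\<exists>\<phi>::real. \<forall>\<psi> \<in> carrier_vec (2 ^ n).
     W *\<^sub>v (\<psi> \<otimes>\<^sub>v unit_vec (2 ^ a) 0) =
       exp (\<i> * \<phi>) \<cdot>\<^sub>v ((V *\<^sub>v \<psi>) \<otimes>\<^sub>v unit_vec (2 ^ a) 0))"

text \<open>\<open>V\<close> is realized up to a global phase with \<open>a\<close> ancilla qubits by a circuit of exactly \<open>m\<close>
  gates.\<close>

definition realizable_with ::
    "nat \<Rightarrow> nat \<Rightarrow> complex mat set \<Rightarrow> complex mat set \<Rightarrow> complex mat \<Rightarrow> nat \<Rightarrow> bool" where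
  "realizable_with n a G1 G2 V m \<longleftrightarrow> (\<exists>gs. set gs \<subseteq> gate_ops (n + a) G1 G2 \<and> length gs = m \<and>
     implements n a (circuit_mat (n + a) gs) V)"

end

(*
Identify the block of a two-qubit gate on span {|01>, |10>} with an element of SU(2) ("exchange
gate"). Three observations give the theorem.

Each gate set produces every exchange gate with a bounded number of gates: rotations about two
non-parallel axes generate SU(2) in boundedly many steps, and the unwanted phases of exp(i alpha H)
on |00>, |11> and the exchange block cancel in commutators, while every element of SU(2) is a
product of three commutators. For XY interactions alone only one axis is available; conjugating with
an iSWAP that involves a helper qubit in state |0> gives the second one.

An exchange gate acting only if m other qubits are in prescribed states costs O(m^2) exchange gates
and no ancilla: split the controls into two halves and use that diag(e^{it}, e^{-it}) is the
commutator of diag(e^{it/2}, e^{-it/2}) and a rotation, so that T(2m) = 4 T(m) + 4. Conjugation by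
singly-controlled swaps yields all SU(2) rotations of two basis states of equal weight for O(n^2).

Gaussian elimination with such rotations makes V diagonal; it needs at most one rotation for each
pair of basis states of equal weight, i.e. at most (2n choose n) = O(4^n n^{-1/2}). The phase of a
basis state x is corrected by rotating |x,0> against a state |x',1> of equal weight, and the phase
of |0...0> is the global phase.
*)

theory Submission
  imports Defs
begin

section \<open>Words and SU(2)\<close>

text \<open>Exactness rules out approximation arguments, so each gate set is shown to reach all of
  SU(2) in a number of steps fixed by the gate set alone, independent of the target rotation and of
  the number of qubits. The ancilla answers a determinant obstruction: a two-level rotation has
  determinant 1 on every weight sector, so products of such rotations cannot adjust the sector
  determinants of V. The exponent 3/2 is 2 - 1/2, quadratic cost per rotation against the n^(-1/2)
  of the central binomial coefficient. Operators act on amplitude functions over all natural numbers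
  and fix the indices beyond the dimension; composition then needs no dimension bookkeeping, and
  words of operators are counted before any matrix enters.\<close>

definition words :: "('a \<Rightarrow> 'a) set \<Rightarrow> nat \<Rightarrow> ('a \<Rightarrow> 'a) set" where
  "words G m = {foldr (\<circ>) gs id | gs. set gs \<subseteq> G \<and> length gs \<le> m}"

lemma foldr_comp_append: "foldr (\<circ>) (xs @ ys) id = foldr (\<circ>) xs id \<circ> foldr (\<circ>) ys id"
  by (induction xs) (auto simp: comp_assoc)

lemma words_id: "id \<in> words G m"
  unfolding words_def by (auto intro!: exI[of _ "[]"])

lemma words_gen: "g \<in> G \<Longrightarrow> 0 < m \<Longrightarrow> g \<in> words G m"
  unfolding words_def by (auto intro!: exI[of _ "[g]"])

lemma words_mono: "F \<in> words G m \<Longrightarrow> m \<le> m' \<Longrightarrow> F \<in> words G m'"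
  unfolding words_def by fastforce

lemma words_comp:
  assumes "F \<in> words G m" "F' \<in> words G m'"
  shows "F \<circ> F' \<in> words G (m + m')"
proof -
  obtain gs gs' where "set gs \<subseteq> G" "length gs \<le> m" "F = foldr (\<circ>) gs id"
    "set gs' \<subseteq> G" "length gs' \<le> m'" "F' = foldr (\<circ>) gs' id"
    using assms unfolding words_def by blast
  then show ?thesis
    unfolding words_def mem_Collect_eq
    by (intro exI[of _ "gs @ gs'"]) (simp add: foldr_comp_append del: foldr_append)
qed

text \<open>Cost is multiplicative under replacing generators. The final bound is such a chain:
  gates per exchange, exchanges per two-level rotation, two-level rotations per unitary.\<close>

lemma words_subst:
  assumes "F \<in> words G m" "\<And>g. g \<in> G \<Longrightarrow> g \<in> words G' k"
  shows "F \<in> words G' (k * m)"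
proof -
  obtain gs where gs: "set gs \<subseteq> G" "length gs \<le> m" "F = foldr (\<circ>) gs id"
    using assms(1) unfolding words_def by blast
  have "foldr (\<circ>) gs id \<in> words G' (k * length gs)"
    using gs(1)
  proof (induction gs)
    case Nil
    then show ?case using words_id by (simp add: id_def)
  next
    case (Cons g gs)
    from Cons.prems have g: "g \<in> G" "set gs \<subseteq> G" by auto
    have "foldr (\<circ>) (g # gs) id = g \<circ> foldr (\<circ>) gs id" "k * length (g # gs) = k + k * length gs"
      by simp_all
    with words_comp[OF assms(2)[OF g(1)] Cons.IH[OF g(2)]] show ?case by argo
  qed
  then show ?thesis using gs words_mono by (metis mult_le_mono2)
qed

text \<open>The pair \<open>(a, b)\<close> stands for the matrix \<open>[[a, b], [- cnj b, cnj a]]\<close>.\<close>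

definition su2_mult :: "complex \<times> complex \<Rightarrow> complex \<times> complex \<Rightarrow> complex \<times> complex" (infixl \<open>\<odot>\<close> 70)
  where "v \<odot> w = (fst v * fst w - snd v * cnj (snd w), fst v * snd w + snd v * cnj (fst w))"

definition su2_inv :: "complex \<times> complex \<Rightarrow> complex \<times> complex" where
  "su2_inv w = (cnj (fst w), - snd w)"

definition SU2 :: "(complex \<times> complex) set" where
  "SU2 = {w. fst w * cnj (fst w) + snd w * cnj (snd w) = 1}"

text \<open>Together with \<open>yrot\<close>: the rotations exp(i t Z) and exp(i t Y) of the block.
  On the Bloch sphere the angle is 2 t.\<close>

definition zrot :: "real \<Rightarrow> complex \<times> complex" where
  "zrot t = (cis t, 0)"

definition yrot :: "real \<Rightarrow> complex \<times> complex" where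
  "yrot t = (complex_of_real (cos t), complex_of_real (sin t))"

lemma su2_mult_assoc: "u \<odot> v \<odot> w = u \<odot> (v \<odot> w)"
  by (simp add: su2_mult_def algebra_simps)

lemma su2_mult_1_left [simp]: "(1, 0) \<odot> w = w"
  by (simp add: su2_mult_def)

lemma su2_mult_1_right [simp]: "w \<odot> (1, 0) = w"
  by (simp add: su2_mult_def)

lemma su2_inv_su2_mult: "w \<in> SU2 \<Longrightarrow> su2_inv w \<odot> w = (1, 0)"
  by (simp add: SU2_def su2_mult_def su2_inv_def algebra_simps)

lemma su2_mult_su2_inv: "w \<in> SU2 \<Longrightarrow> w \<odot> su2_inv w = (1, 0)"
  by (simp add: SU2_def su2_mult_def su2_inv_def algebra_simps)

lemma su2_inv_su2_inv [simp]: "su2_inv (su2_inv w) = w"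
  by (simp add: su2_inv_def)

lemma su2_inv_mult: "su2_inv (v \<odot> w) = su2_inv w \<odot> su2_inv v"
  by (simp add: su2_mult_def su2_inv_def algebra_simps)

lemma SU2_su2_mult: assumes "v \<in> SU2" "w \<in> SU2" shows "v \<odot> w \<in> SU2"
proof -
  obtain a b c d where vw: "v = (a, b)" "w = (c, d)" by (metis surj_pair)
  have 1: "a * cnj a = 1 - b * cnj b" "c * cnj c = 1 - d * cnj d"
    using assms by (auto simp: vw SU2_def eq_diff_eq)
  have "(a * c - b * cnj d) * cnj (a * c - b * cnj d) + (a * d + b * cnj c) * cnj (a * d + b * cnj c)
    = (a * cnj a + b * cnj b) * (c * cnj c + d * cnj d)" by (simp add: algebra_simps)
  also have "\<dots> = 1" using 1 by simp
  finally show ?thesis by (simp add: vw SU2_def su2_mult_def)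
qed

lemma SU2_su2_inv: "w \<in> SU2 \<Longrightarrow> su2_inv w \<in> SU2"
  by (simp add: SU2_def su2_inv_def mult.commute)

lemma zrot_SU2: "zrot t \<in> SU2"
  by (simp add: SU2_def zrot_def cis_cnj cis_mult)

lemma yrot_SU2: "yrot t \<in> SU2"
proof -
  have "complex_of_real (cos t * cos t + sin t * sin t) = 1"
    by (metis sin_cos_squared_add3 add.commute of_real_1)
  then show ?thesis by (simp only: SU2_def yrot_def mem_Collect_eq fst_conv snd_conv complex_cnj_complex_of_real of_real_add of_real_mult)
qed

lemma zrot_mult: "zrot s \<odot> zrot t = zrot (s + t)"
  by (simp add: su2_mult_def zrot_def cis_mult)

lemma yrot_mult: "yrot s \<odot> yrot t = yrot (s + t)"
  by (simp add: su2_mult_def yrot_def cos_add sin_add)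

lemma zrot_0 [simp]: "zrot 0 = (1, 0)"
  by (simp add: zrot_def)

lemma yrot_0 [simp]: "yrot 0 = (1, 0)"
  by (simp add: yrot_def)

lemma su2_inv_zrot: "su2_inv (zrot t) = zrot (- t)"
  by (simp add: su2_inv_def zrot_def cis_cnj)

lemma su2_inv_yrot: "su2_inv (yrot t) = yrot (- t)"
  by (simp add: su2_inv_def yrot_def)

lemma SU2_norm: "w \<in> SU2 \<longleftrightarrow> cmod (fst w) ^ 2 + cmod (snd w) ^ 2 = 1"
proof -
  have "fst w * cnj (fst w) + snd w * cnj (snd w)
    = complex_of_real (cmod (fst w) ^ 2 + cmod (snd w) ^ 2)"
    unfolding of_real_add complex_norm_square ..
  then show ?thesis by (simp only: SU2_def mem_Collect_eq of_real_eq_1_iff)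
qed

text \<open>z rotations by \<open>u\<close> on the left and \<open>v\<close> on the right multiply
  the two entries by \<open>cis (u + v)\<close> and \<open>cis (u - v)\<close>. Sum and difference
  are independent, so both phases can be prescribed.\<close>

lemma euler_moduli:
  "\<exists>u v. w = zrot u \<odot> (complex_of_real (cmod (fst w)), complex_of_real (cmod (snd w))) \<odot> zrot v"
proof -
  define \<alpha> \<beta> where "\<alpha> = Arg (fst w)" and "\<beta> = Arg (snd w)"
  have a: "fst w = complex_of_real (cmod (fst w)) * cis \<alpha>"
    and b: "snd w = complex_of_real (cmod (snd w)) * cis \<beta>"
    unfolding \<alpha>_def \<beta>_def by (metis rcis_cmod_Arg rcis_def)+
  let ?u = "(\<alpha> + \<beta>) / 2" and ?v = "(\<alpha> - \<beta>) / 2"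
  have c: "cis ?u * cis ?v = cis \<alpha>" "cis ?u * cis (- ?v) = cis \<beta>"
    by (simp_all add: cis_mult field_simps)
  have "zrot ?u \<odot> (complex_of_real (cmod (fst w)), complex_of_real (cmod (snd w))) \<odot> zrot ?v
    = (complex_of_real (cmod (fst w)) * (cis ?u * cis ?v), complex_of_real (cmod (snd w)) * (cis ?u * cis (- ?v)))"
    by (simp add: su2_mult_def zrot_def cis_cnj algebra_simps)
  then have "w = zrot ?u \<odot> (complex_of_real (cmod (fst w)), complex_of_real (cmod (snd w))) \<odot> zrot ?v"
    unfolding c a[symmetric] b[symmetric] by simp
  then show ?thesis by blast
qed

lemma moduli_euler:
  "\<exists>u v. (complex_of_real (cmod (fst w)), complex_of_real (cmod (snd w))) = zrot u \<odot> w \<odot> zrot v"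
proof -
  let ?r = "(complex_of_real (cmod (fst w)), complex_of_real (cmod (snd w)))"
  obtain u v where w: "w = zrot u \<odot> ?r \<odot> zrot v" using euler_moduli by blast
  have "zrot (- u) \<odot> (zrot u \<odot> ?r \<odot> zrot v) \<odot> zrot (- v)
    = (zrot (- u) \<odot> zrot u) \<odot> ?r \<odot> (zrot v \<odot> zrot (- v))"
    by (simp only: su2_mult_assoc)
  then have "?r = zrot (- u) \<odot> w \<odot> zrot (- v)" unfolding w[symmetric] by (simp add: zrot_mult)
  then show ?thesis by blast
qed

lemma euler:
  assumes "w \<in> SU2"
  obtains u t v where "w = zrot u \<odot> yrot t \<odot> zrot v" "0 \<le> t" "t \<le> pi / 2"
proof -
  obtain u v where w: "w = zrot u \<odot> (complex_of_real (cmod (fst w)), complex_of_real (cmod (snd w))) \<odot> zrot v"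
    using euler_moduli by blast
  define t where "t = arcsin (cmod (snd w))"
  have n: "cmod (fst w) ^ 2 + cmod (snd w) ^ 2 = 1" using assms SU2_norm by blast
  then have le: "cmod (snd w) \<le> 1" by (metis norm_ge_zero abs_square_le_1 abs_of_nonneg le_add_same_cancel2 zero_le_power2)
  have t: "0 \<le> t" "t \<le> pi / 2"
    using le arcsin_le_arcsin[of 0 "cmod (snd w)"] arcsin_bounded[of "cmod (snd w)"]
    by (auto simp: t_def order_trans[of "-1" 0])
  have s: "sin t = cmod (snd w)" using le by (simp add: t_def sin_arcsin order_trans[of "-1" 0])
  have "cos t = sqrt (1 - cmod (snd w) ^ 2)" using le by (simp add: t_def cos_arcsin order_trans[of "-1" 0])
  also have "1 - cmod (snd w) ^ 2 = cmod (fst w) ^ 2" using n by simp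
  finally have c: "cos t = cmod (fst w)" by simp
  show ?thesis by (rule that[of u t v]) (use w t s c in \<open>auto simp: yrot_def\<close>)
qed

text \<open>\<open>B k\<close> stands for whatever is reachable at cost \<open>k\<close>; leaving it
  abstract serves plain words, words up to phases, and words that are correct only with a helper
  qubit in |0>. In the frame \<open>U\<close> the available rotations are about the z axis and about
  its image under \<open>Q\<close>. A rotation about the tilted axis between two z rotations gives
  all small y rotations, doubling makes them large, and the Euler decomposition finishes.\<close>

theorem su2_bounded_generation:
  fixes B :: "nat \<Rightarrow> (complex \<times> complex) set"
  assumes mul: "\<And>k k' w w'. w \<in> B k \<Longrightarrow> w' \<in> B k' \<Longrightarrow> w \<odot> w' \<in> B (k + k')"
    and U: "U \<in> SU2" and Q: "Q \<in> SU2" "fst Q \<noteq> 0" "snd Q \<noteq> 0"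
    and r1: "\<And>t. U \<odot> zrot t \<odot> su2_inv U \<in> B m"
    and r2: "\<And>t. U \<odot> (Q \<odot> zrot t \<odot> su2_inv Q) \<odot> su2_inv U \<in> B m"
  shows "\<exists>M. SU2 \<subseteq> B M"
proof -
  define B' where "B' k = {w. U \<odot> w \<odot> su2_inv U \<in> B k}" for k
  have mul': "w \<odot> w' \<in> B' (k + k')" if "w \<in> B' k" "w' \<in> B' k'" for w w' k k'
  proof -
    have "(U \<odot> w \<odot> su2_inv U) \<odot> (U \<odot> w' \<odot> su2_inv U) \<in> B (k + k')"
      using that by (intro mul) (auto simp: B'_def)
    also have "(U \<odot> w \<odot> su2_inv U) \<odot> (U \<odot> w' \<odot> su2_inv U) = U \<odot> w \<odot> (su2_inv U \<odot> U) \<odot> w' \<odot> su2_inv U"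
      by (simp only: su2_mult_assoc)
    also have "\<dots> = U \<odot> (w \<odot> w') \<odot> su2_inv U"
      using U by (simp add: su2_inv_su2_mult) (simp add: su2_mult_assoc)
    finally show ?thesis by (simp add: B'_def)
  qed
  have z: "zrot t \<in> B' m" for t using r1 by (simp add: B'_def)
  have q: "Q \<odot> zrot t \<odot> su2_inv Q \<in> B' m" for t using r2 by (simp add: B'_def)
  \<comment> \<open>The off-diagonal entry of \<open>Q \<odot> zrot x \<odot> su2_inv Q\<close> has
    modulus \<open>s0\<close> times |sin x|. Hence one such conjugate reaches every y rotation with
    angle up to arcsin \<open>s0\<close>.\<close>
  define s0 where "s0 = 2 * cmod (fst Q) * cmod (snd Q)"
  have s0: "0 < s0" using Q by (simp add: s0_def)
  have s01: "s0 \<le> 1"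
  proof -
    have "0 \<le> (cmod (fst Q) - cmod (snd Q)) ^ 2" by simp
    then show ?thesis using Q(1) unfolding SU2_norm s0_def by (simp add: power2_diff)
  qed
  define T where "T = arcsin s0"
  have T: "0 < T" "T \<le> pi / 2" "sin T = s0"
    using s0 s01 arcsin_less_arcsin[of 0 s0] arcsin_bounded[of s0] by (auto simp: T_def)
  have start: "yrot t \<in> B' (3 * m)" if "0 \<le> t" "t \<le> T" for t
  proof -
    define x where "x = arcsin (sin t / s0)"
    have "sin t \<le> s0" using that T sin_monotone_2pi_le[of t T] pi_ge_zero by auto
    moreover have "0 \<le> sin t" using that T by (intro sin_ge_zero) auto
    ultimately have "0 \<le> sin t / s0" "sin t / s0 \<le> 1" using s0 by auto
    then have x: "sin x = sin t / s0" unfolding x_def by (intro sin_arcsin) auto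
    define w where "w = Q \<odot> zrot x \<odot> su2_inv Q"
    have w: "w \<in> SU2" unfolding w_def using Q by (intro SU2_su2_mult SU2_su2_inv zrot_SU2)
    have "snd w = fst Q * snd Q * (cis (- x) - cis x)"
      by (simp add: w_def su2_mult_def su2_inv_def zrot_def cis_cnj algebra_simps)
    also have "cis (- x) - cis x = - 2 * \<i> * sin x" by (auto simp: complex_eq_iff)
    finally have "cmod (snd w) = s0 * \<bar>sin x\<bar>" by (simp add: norm_mult s0_def)
    then have sw: "cmod (snd w) = sin t" using x \<open>0 \<le> sin t\<close> s0 by simp
    have "0 \<le> cos t" using that T by (intro cos_ge_zero) auto
    moreover have "cmod (fst w) ^ 2 = cos t ^ 2"
      using w sw unfolding SU2_norm by (simp add: cos_squared_eq)
    ultimately have fw: "cmod (fst w) = cos t" by (simp add: power2_eq_iff_nonneg)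
    obtain u v where "(complex_of_real (cmod (fst w)), complex_of_real (cmod (snd w))) = zrot u \<odot> w \<odot> zrot v"
      using moduli_euler by blast
    then have "yrot t = zrot u \<odot> w \<odot> zrot v" by (simp add: fw sw yrot_def)
    moreover have "zrot u \<odot> w \<odot> zrot v \<in> B' (m + m + m)"
      using z q by (intro mul') (auto simp: w_def)
    moreover have "m + m + m = 3 * m" by simp
    ultimately show ?thesis by simp
  qed
  \<comment> \<open>The Euler decomposition asks only for angles up to pi / 2, so a fixed number of
    doublings is enough.\<close>
  have grow: "\<forall>t. 0 \<le> t \<and> t \<le> 2 ^ k * T \<longrightarrow> yrot t \<in> B' (2 ^ k * (3 * m))" for k
  proof (induction k)
    case 0
    then show ?case using start by simp
  next
    case (Suc k)
    show ?case
    proof (intro allI impI)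
      fix t assume "0 \<le> t \<and> t \<le> 2 ^ Suc k * T"
      then have "yrot (t / 2) \<in> B' (2 ^ k * (3 * m))" using Suc by auto
      then have "yrot (t / 2) \<odot> yrot (t / 2) \<in> B' (2 ^ k * (3 * m) + 2 ^ k * (3 * m))"
        by (intro mul')
      then show "yrot t \<in> B' (2 ^ Suc k * (3 * m))" by (simp add: yrot_mult algebra_simps)
    qed
  qed
  obtain k where "pi / 2 / T < 2 ^ k" using real_arch_pow[of 2 "pi / 2 / T"] by auto
  then have k: "pi / 2 \<le> 2 ^ k * T" using T by (simp add: field_simps)
  define M where "M = m + 2 ^ k * (3 * m) + m"
  have all: "w \<in> B' M" if w: "w \<in> SU2" for w
  proof -
    obtain u t v where w: "w = zrot u \<odot> yrot t \<odot> zrot v" "0 \<le> t" "t \<le> pi / 2"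
      using euler[OF w] by blast
    then have "yrot t \<in> B' (2 ^ k * (3 * m))" using grow k by auto
    then show ?thesis unfolding w(1) M_def by (intro mul' z)
  qed
  have "SU2 \<subseteq> B M"
  proof
    fix w assume w: "w \<in> SU2"
    have "su2_inv U \<odot> w \<odot> U \<in> B' M" using U w by (intro all SU2_su2_mult SU2_su2_inv)
    moreover have "U \<odot> (su2_inv U \<odot> w \<odot> U) \<odot> su2_inv U = (U \<odot> su2_inv U) \<odot> w \<odot> (U \<odot> su2_inv U)"
      by (simp only: su2_mult_assoc)
    ultimately show "w \<in> B M" using U by (simp add: B'_def su2_mult_su2_inv)
  qed
  then show ?thesis by blast
qed

section \<open>Two-level gates from exchange gates\<close>

definition flip_bits :: "nat \<Rightarrow> nat \<Rightarrow> nat \<Rightarrow> nat" where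
  "flip_bits p q r = flip_bit p (flip_bit q r)"

lemma bit_flip_bits: "p \<noteq> q \<Longrightarrow> bit (flip_bits p q r) i = (if i = p \<or> i = q then \<not> bit r i else bit r i)"
  by (auto simp: flip_bits_def bit_flip_bit_iff)

lemma flip_bits_flip_bits [simp]: "flip_bits p q (flip_bits p q r) = r"
  by (rule bit_eqI) (auto simp: flip_bits_def bit_flip_bit_iff)

lemma flip_bits_neq [simp]: "p \<noteq> q \<Longrightarrow> flip_bits p q r \<noteq> r"
  using bit_flip_bits by metis

lemma less_exp_bit: "(r::nat) < 2 ^ N \<longleftrightarrow> (\<forall>i\<ge>N. \<not> bit r i)"
proof
  assume "r < 2 ^ N"
  then have "take_bit N r = r" by (simp add: take_bit_nat_eq_self_iff)
  then show "\<forall>i\<ge>N. \<not> bit r i" by (metis bit_take_bit_iff not_le)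
next
  assume *: "\<forall>i\<ge>N. \<not> bit r i"
  have "take_bit N r = r" by (rule bit_eqI) (use * in \<open>auto simp: bit_take_bit_iff not_le\<close>)
  then show "r < 2 ^ N" by (simp add: take_bit_nat_eq_self_iff)
qed

lemma flip_bits_less: "p < N \<Longrightarrow> q < N \<Longrightarrow> flip_bits p q r < 2 ^ N \<longleftrightarrow> r < 2 ^ N"
  by (auto simp: less_exp_bit flip_bits_def bit_flip_bit_iff)

text \<open>States are amplitude functions of the basis index, and operators act on such functions. Qubits are
  addressed by bit positions of the index: position \<open>p\<close> is qubit \<open>N - 1 - p\<close>. The pair \<open>w\<close> acts in
  the ordered basis \<open>|01\<rangle>\<close>, \<open>|10\<rangle>\<close> of the qubits at \<open>p\<close> and \<open>q\<close>, on indices satisfying \<open>P\<close>.\<close>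

definition exchange :: "nat \<Rightarrow> nat \<Rightarrow> (nat \<Rightarrow> bool) \<Rightarrow> complex \<times> complex \<Rightarrow> (nat \<Rightarrow> complex) \<Rightarrow> nat \<Rightarrow> complex" where
  "exchange p q P w f r =
    (if P r \<and> bit r p \<noteq> bit r q
     then if bit r q then fst w * f r + snd w * f (flip_bits p q r)
          else cnj (fst w) * f r - cnj (snd w) * f (flip_bits p q r)
     else f r)"

lemma exchange_one [simp]: "exchange p q P (1, 0) = id"
  by (intro ext) (simp add: exchange_def)

lemma exchange_mult:
  assumes "p \<noteq> q" "\<And>r. P (flip_bits p q r) = P r"
  shows "exchange p q P v (exchange p q P w f) r = exchange p q P (v \<odot> w) f r"
  using assms by (auto simp: exchange_def bit_flip_bits su2_mult_def algebra_simps)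

text \<open>An exchange at \<open>r\<close> reads only \<open>r\<close> and its flip, and a control
  predicate is constant on this pair. Comparing on the pair replaces every controlled exchange by a
  plain one or by the identity, which reduces identities of controlled gates to identities in
  SU(2).\<close>

definition orbit_eq :: "nat \<Rightarrow> nat \<Rightarrow> nat \<Rightarrow> (nat \<Rightarrow> complex) \<Rightarrow> (nat \<Rightarrow> complex) \<Rightarrow> bool" where
  "orbit_eq p q r g h \<longleftrightarrow> g r = h r \<and> g (flip_bits p q r) = h (flip_bits p q r)"

lemma orbit_eq_exchange:
  assumes "p \<noteq> q" "\<And>r. P (flip_bits p q r) = P r" "orbit_eq p q r g h"
  shows "orbit_eq p q r (exchange p q P v g) (if P r then exchange p q (\<lambda>_. True) v h else h)"
  using assms by (auto simp: exchange_def bit_flip_bits orbit_eq_def)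

text \<open>Where only one of the two controls holds, the word collapses to a gate times its
  inverse, so the commutator acts exactly on the conjunction.\<close>

lemma exchange_commutator:
  assumes pq: "p \<noteq> q" and P: "\<And>r. P (flip_bits p q r) = P r" and Q: "\<And>r. Q (flip_bits p q r) = Q r"
    and vw: "v \<in> SU2" "w \<in> SU2"
  shows "exchange p q P v \<circ> exchange p q Q w \<circ> exchange p q P (su2_inv v) \<circ> exchange p q Q (su2_inv w)
    = exchange p q (\<lambda>r. P r \<and> Q r) (v \<odot> w \<odot> su2_inv v \<odot> su2_inv w)"
proof (intro ext)
  fix f r
  let ?X = "\<lambda>u. exchange p q (\<lambda>_. True) u"
  let ?h1 = "if Q r then ?X (su2_inv w) f else f"
  let ?h2 = "if P r then ?X (su2_inv v) ?h1 else ?h1"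
  let ?h3 = "if Q r then ?X w ?h2 else ?h2"
  let ?h4 = "if P r then ?X v ?h3 else ?h3"
  have m: "?X u (?X u' g) = ?X (u \<odot> u') g" for u u' g
    by (intro ext exchange_mult[OF pq]) simp
  have 0: "orbit_eq p q r f f" by (simp add: orbit_eq_def)
  have "orbit_eq p q r (exchange p q P v (exchange p q Q w (exchange p q P (su2_inv v) (exchange p q Q (su2_inv w) f)))) ?h4"
    by (intro orbit_eq_exchange pq P Q 0)
  then have "(exchange p q P v \<circ> exchange p q Q w \<circ> exchange p q P (su2_inv v) \<circ> exchange p q Q (su2_inv w)) f r = ?h4 r"
    by (simp add: orbit_eq_def)
  also have "\<dots> = (if P r \<and> Q r then ?X (v \<odot> w \<odot> su2_inv v \<odot> su2_inv w) f else f) r"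
    using vw by (simp add: m su2_mult_su2_inv su2_mult_assoc)
  also have "\<dots> = exchange p q (\<lambda>r. P r \<and> Q r) (v \<odot> w \<odot> su2_inv v \<odot> su2_inv w) f r"
    by (simp add: exchange_def)
  finally show "(exchange p q P v \<circ> exchange p q Q w \<circ> exchange p q P (su2_inv v) \<circ> exchange p q Q (su2_inv w)) f r
    = exchange p q (\<lambda>r. P r \<and> Q r) (v \<odot> w \<odot> su2_inv v \<odot> su2_inv w) f r" .
qed

text \<open>The conjugating gates may carry fewer controls than the conjugated one: where
  \<open>P\<close> fails they cancel each other. This keeps changes of axis uncontrolled and
  cheap.\<close>

lemma exchange_conj:
  assumes pq: "p \<noteq> q" and P: "\<And>r. P (flip_bits p q r) = P r" and A: "\<And>r. A (flip_bits p q r) = A r"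
    and PA: "\<And>r. P r \<Longrightarrow> A r" and u: "u \<in> SU2"
  shows "exchange p q A u \<circ> exchange p q P w \<circ> exchange p q A (su2_inv u) = exchange p q P (u \<odot> w \<odot> su2_inv u)"
proof (intro ext)
  fix f r
  let ?X = "\<lambda>u. exchange p q (\<lambda>_. True) u"
  let ?h1 = "if A r then ?X (su2_inv u) f else f"
  let ?h2 = "if P r then ?X w ?h1 else ?h1"
  let ?h3 = "if A r then ?X u ?h2 else ?h2"
  have m: "?X u (?X u' g) = ?X (u \<odot> u') g" for u u' g
    by (intro ext exchange_mult[OF pq]) simp
  have 0: "orbit_eq p q r f f" by (simp add: orbit_eq_def)
  have "orbit_eq p q r (exchange p q A u (exchange p q P w (exchange p q A (su2_inv u) f))) ?h3"
    by (intro orbit_eq_exchange pq P A 0)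
  then have "(exchange p q A u \<circ> exchange p q P w \<circ> exchange p q A (su2_inv u)) f r = ?h3 r"
    by (simp add: orbit_eq_def)
  also have "\<dots> = (if P r then ?X (u \<odot> w \<odot> su2_inv u) f else f) r"
    using u PA[of r] by (simp add: m su2_mult_su2_inv su2_mult_assoc)
  also have "\<dots> = exchange p q P (u \<odot> w \<odot> su2_inv u) f r"
    by (simp add: exchange_def)
  finally show "(exchange p q A u \<circ> exchange p q P w \<circ> exchange p q A (su2_inv u)) f r = exchange p q P (u \<odot> w \<odot> su2_inv u) f r" .
qed

text \<open>With \<open>\<beta> = 1\<close> this is an exchange on \<open>p\<close>, \<open>q\<close> whose sense depends on the bit \<open>c\<close>; multiplying by a
  plain exchange cancels it for one value of \<open>c\<close> and so makes it controlled.\<close>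

lemma exchange_gadget:
  assumes d: "distinct [c, p, q]" and less: "c < N" "p < N" "q < N" and \<beta>: "\<beta> * cnj \<beta> = 1"
  shows "(exchange c p (\<lambda>r. r < 2 ^ N) (0, \<beta>) \<circ> exchange c q (\<lambda>r. r < 2 ^ N) (a, b) \<circ> exchange c p (\<lambda>r. r < 2 ^ N) (0, - \<beta>)) f r
    = (if bit r c then exchange p q (\<lambda>r. r < 2 ^ N) (a, - cnj \<beta> * b) f r
       else exchange p q (\<lambda>r. r < 2 ^ N) (a, cnj \<beta> * b) f r)"
proof -
  have flps: "flip_bits c p (flip_bits c q x) = flip_bits p q x" "flip_bits c q (flip_bits c p x) = flip_bits p q x"
    "flip_bits c p (flip_bits p q x) = flip_bits c q x" "flip_bits c q (flip_bits p q x) = flip_bits c p x"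
    "flip_bits p q (flip_bits c p x) = flip_bits c q x" "flip_bits p q (flip_bits c q x) = flip_bits c p x" for x
    by (rule bit_eqI, use d in \<open>auto simp: bit_flip_bits\<close>)+
  have \<beta>': "\<beta> * (cnj \<beta> * z) = z" "cnj \<beta> * (\<beta> * z) = z" "z * (\<beta> * cnj \<beta>) = z" for z
    using \<beta> by (metis mult.assoc mult.commute mult_1)+
  show ?thesis
  proof (cases "r < 2 ^ N")
    case True
    \<comment> \<open>The outer gates swap \<open>c\<close> and \<open>p\<close> up to phases, so
      the middle one ends up between \<open>p\<close> and \<open>q\<close>, with a phase on the
      off-diagonal entry whose sign depends on bit \<open>c\<close>. Three bits leave eight
      cases.\<close>
    then show ?thesis
      using d less
      by (cases "bit r c"; cases "bit r p"; cases "bit r q")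
        (simp_all add: exchange_def flip_bits_less bit_flip_bits flps algebra_simps \<beta>')
  qed (simp add: exchange_def)
qed

section \<open>Controlled rotations at quadratic cost\<close>

definition su2_gates :: "nat \<Rightarrow> ((nat \<Rightarrow> complex) \<Rightarrow> nat \<Rightarrow> complex) set" where
  "su2_gates N = {exchange p q (\<lambda>r. r < 2 ^ N) w | p q w. p < N \<and> q < N \<and> p \<noteq> q \<and> w \<in> SU2}"

lemma su2_gate_words:
  "p < N \<Longrightarrow> q < N \<Longrightarrow> p \<noteq> q \<Longrightarrow> w \<in> SU2 \<Longrightarrow> exchange p q (\<lambda>r. r < 2 ^ N) w \<in> words (su2_gates N) 1"
  unfolding su2_gates_def by (rule words_gen) blast+

lemma one_control_yrot:
  assumes d: "distinct [c, p, q]" and less: "c < N" "p < N" "q < N"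
  shows "exchange p q (\<lambda>r. r < 2 ^ N \<and> bit r c = v) (yrot t) \<in> words (su2_gates N) 4"
proof -
  let ?A = "\<lambda>r. r < 2 ^ N"
  \<comment> \<open>The sign makes the two half rotations add when bit \<open>c\<close> equals
    \<open>v\<close> and cancel otherwise.\<close>
  let ?s = "if v then - t / 2 else t / 2"
  let ?G = "exchange c p ?A (0, 1) \<circ> exchange c q ?A (yrot ?s) \<circ> exchange c p ?A (0, - 1) \<circ> exchange p q ?A (yrot (t / 2))"
  have G: "?G f r = (if bit r c then exchange p q ?A (yrot (- ?s) \<odot> yrot (t / 2)) f r
      else exchange p q ?A (yrot ?s \<odot> yrot (t / 2)) f r)" for f r
    using exchange_gadget[OF d less, of 1 "fst (yrot ?s)" "snd (yrot ?s)"] d less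
    by (simp add: exchange_mult flip_bits_less yrot_def)
  have "?G = exchange p q (\<lambda>r. r < 2 ^ N \<and> bit r c = v) (yrot t)"
    by (intro ext, subst G) (auto simp: yrot_mult exchange_def)
  moreover have "(0, 1) \<in> SU2" "(0, -1) \<in> SU2" by (auto simp: SU2_def)
  then have "?G \<in> words (su2_gates N) (1 + 1 + 1 + 1)"
    using d less by (intro words_comp su2_gate_words yrot_SU2) auto
  moreover have "1 + 1 + 1 + 1 = (4::nat)" by simp
  ultimately show ?thesis by argo
qed

definition controls_match :: "nat \<Rightarrow> nat set \<Rightarrow> nat \<Rightarrow> nat \<Rightarrow> bool" where
  "controls_match N C x r \<longleftrightarrow> r < 2 ^ N \<and> (\<forall>i\<in>C. bit r i = bit x i)"

lemma controls_match_flip_bits: "p < N \<Longrightarrow> q < N \<Longrightarrow> p \<noteq> q \<Longrightarrow> p \<notin> C \<Longrightarrow> q \<notin> C \<Longrightarrow> controls_match N C x (flip_bits p q r) = controls_match N C x r"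
  by (auto simp: controls_match_def flip_bits_less bit_flip_bits)

text \<open>The block of sqrt(iSWAP), exp(i pi X / 4): a quarter turn about the x axis, which
  carries y rotations into z rotations.\<close>

definition y_to_z :: "complex \<times> complex" where
  "y_to_z = (complex_of_real (1 / sqrt 2), \<i> * complex_of_real (1 / sqrt 2))"

lemma sqrt_half_sq: "complex_of_real (1 / sqrt 2) * complex_of_real (1 / sqrt 2) = 1 / 2"
  by (simp flip: of_real_mult)

lemma y_to_z_SU2: "y_to_z \<in> SU2"
proof -
  have "complex_of_real (1 / sqrt 2) * complex_of_real (1 / sqrt 2)
    + \<i> * complex_of_real (1 / sqrt 2) * cnj (\<i> * complex_of_real (1 / sqrt 2)) = 2 * (1 / 2)"
    unfolding sqrt_half_sq[symmetric] by (simp add: algebra_simps del: of_real_divide)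
  then show ?thesis by (simp add: y_to_z_def SU2_def del: of_real_divide)
qed

lemma y_to_z_conj: "y_to_z \<odot> yrot t \<odot> su2_inv y_to_z = zrot (- t)"
proof -
  define h where "h = complex_of_real (1 / sqrt 2)"
  have h: "h * (h * z) = z / 2" "cnj h = h" for z
    using sqrt_half_sq by (simp_all add: h_def mult.assoc[symmetric] del: of_real_divide)
  have "cis (- t) = complex_of_real (cos t) - \<i> * complex_of_real (sin t)"
    by (simp add: complex_eq_iff)
  then show ?thesis
    by (simp add: y_to_z_def zrot_def yrot_def su2_mult_def su2_inv_def h h_def[symmetric] algebra_simps del: of_real_divide)
qed

lemma y_to_z_conj': "su2_inv y_to_z \<odot> zrot (- t) \<odot> y_to_z = yrot t"
  unfolding y_to_z_conj[symmetric]
  using y_to_z_SU2 by (simp add: su2_mult_assoc su2_inv_su2_mult) (simp add: su2_mult_assoc[symmetric] su2_inv_su2_mult)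

text \<open>\<open>k\<close> counts the halvings of the control set. The bound T = 8 * 4^k - 2
  starts at 6 = 1 + 4 + 1 for a single control, and 4 T + 4 stays below the next value because the
  -2 absorbs the additive 4. As 4^k is the square of 2^k, the cost is quadratic in the number of
  controls.\<close>

lemma controlled_zrot:
  assumes pq: "p \<noteq> q" "p < N" "q < N"
  shows "finite C \<Longrightarrow> C \<subseteq> {..<N} - {p, q} \<Longrightarrow> card C \<le> 2 ^ k \<Longrightarrow>
    exchange p q (controls_match N C x) (zrot t) \<in> words (su2_gates N) (8 * 4 ^ k - 2)"
proof (induction k arbitrary: C t)
  case 0
  let ?A = "\<lambda>r. r < 2 ^ N"
  consider "C = {}" | c where "C = {c}" using 0 by (metis card_0_eq card_1_singletonE le_SucE power_0 One_nat_def le_zero_eq)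
  then show ?case
  proof cases
    case 1
    then have "controls_match N C x = ?A" by (auto simp: controls_match_def)
    then show ?thesis using su2_gate_words[OF pq(2,3,1) zrot_SU2, THEN words_mono, of 6] by simp
  next
    case 2
    let ?P = "\<lambda>r. r < 2 ^ N \<and> bit r c = bit x c"
    have P: "controls_match N C x = ?P" using 2 by (auto simp: controls_match_def)
    have c: "distinct [c, p, q]" "c < N" using 2 0 pq by auto
    have "exchange p q ?A y_to_z \<circ> exchange p q ?P (yrot (- t)) \<circ> exchange p q ?A (su2_inv y_to_z) = exchange p q ?P (y_to_z \<odot> yrot (- t) \<odot> su2_inv y_to_z)"
      using c pq by (intro exchange_conj y_to_z_SU2) (auto simp: bit_flip_bits flip_bits_less)
    moreover have "exchange p q ?A y_to_z \<circ> exchange p q ?P (yrot (- t)) \<circ> exchange p q ?A (su2_inv y_to_z) \<in> words (su2_gates N) (1 + 4 + 1)"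
      using c pq by (intro words_comp su2_gate_words one_control_yrot y_to_z_SU2 SU2_su2_inv) auto
    ultimately show ?thesis by (simp add: P y_to_z_conj)
  qed
next
  case (Suc k)
  let ?A = "\<lambda>r. r < 2 ^ N"
  obtain C1 where C1: "C1 \<subseteq> C" "card C1 = min (card C) (2 ^ k)"
    by (metis obtain_subset_with_card_n min.cobounded1)
  define C2 where "C2 = C - C1"
  have f: "finite C1" "finite C2" "C1 \<subseteq> {..<N} - {p, q}" "C2 \<subseteq> {..<N} - {p, q}"
    using Suc.prems C1 by (auto simp: C2_def finite_subset)
  have card: "card C1 \<le> 2 ^ k" "card C2 \<le> 2 ^ k"
    using Suc.prems C1 f by (auto simp: C2_def card_Diff_subset)
  let ?T = "8 * 4 ^ k - 2 :: nat"
  have inv: "controls_match N C' x (flip_bits p q r) = controls_match N C' x r" if "C' \<subseteq> {..<N} - {p, q}" for C' r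
    using that pq by (intro controls_match_flip_bits) auto
  have Y: "exchange p q (controls_match N C2 x) (yrot s) \<in> words (su2_gates N) (1 + ?T + 1)" for s
  proof -
    have "exchange p q ?A (su2_inv y_to_z) \<circ> exchange p q (controls_match N C2 x) (zrot (- s)) \<circ> exchange p q ?A (su2_inv (su2_inv y_to_z))
      = exchange p q (controls_match N C2 x) (su2_inv y_to_z \<odot> zrot (- s) \<odot> su2_inv (su2_inv y_to_z))"
      using pq f inv by (intro exchange_conj y_to_z_SU2 SU2_su2_inv) (auto simp: controls_match_def flip_bits_less)
    then have "exchange p q (controls_match N C2 x) (yrot s)
      = exchange p q ?A (su2_inv y_to_z) \<circ> exchange p q (controls_match N C2 x) (zrot (- s)) \<circ> exchange p q ?A y_to_z"
      by (simp add: y_to_z_conj')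
    moreover have "\<dots> \<in> words (su2_gates N) (1 + ?T + 1)"
      using pq f card by (intro words_comp su2_gate_words Suc.IH y_to_z_SU2 SU2_su2_inv)
    ultimately show ?thesis by simp
  qed
  \<comment> \<open>\<open>yrot (pi / 2)\<close> is the swap up to a sign and inverts z rotations,
    so the commutator doubles the angle t / 2.\<close>
  have "zrot (t / 2) \<odot> yrot (pi / 2) \<odot> su2_inv (zrot (t / 2)) \<odot> su2_inv (yrot (pi / 2)) = zrot t"
    by (simp add: zrot_def yrot_def su2_mult_def su2_inv_def cis_cnj cis_mult)
  moreover have "(\<lambda>r. controls_match N C1 x r \<and> controls_match N C2 x r) = controls_match N C x"
    unfolding controls_match_def C2_def using C1(1) by (intro ext) blast
  ultimately have eq: "exchange p q (controls_match N C1 x) (zrot (t / 2)) \<circ> exchange p q (controls_match N C2 x) (yrot (pi / 2))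
      \<circ> exchange p q (controls_match N C1 x) (zrot (- (t / 2))) \<circ> exchange p q (controls_match N C2 x) (yrot (- (pi / 2)))
    = exchange p q (controls_match N C x) (zrot t)"
    using exchange_commutator[OF pq(1), of "controls_match N C1 x" "controls_match N C2 x" "zrot (t / 2)" "yrot (pi / 2)"]
      f inv zrot_SU2 yrot_SU2 by (simp add: su2_inv_zrot su2_inv_yrot)
  have "exchange p q (controls_match N C1 x) (zrot (t / 2)) \<circ> exchange p q (controls_match N C2 x) (yrot (pi / 2))
      \<circ> exchange p q (controls_match N C1 x) (zrot (- (t / 2))) \<circ> exchange p q (controls_match N C2 x) (yrot (- (pi / 2)))
    \<in> words (su2_gates N) (?T + (1 + ?T + 1) + ?T + (1 + ?T + 1))"
    using f card by (intro words_comp Y Suc.IH)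
  then have word: "exchange p q (controls_match N C x) (zrot t) \<in> words (su2_gates N) (?T + (1 + ?T + 1) + ?T + (1 + ?T + 1))"
    unfolding eq .
  have "?T + (1 + ?T + 1) + ?T + (1 + ?T + 1) \<le> 8 * 4 ^ Suc k - 2"
  proof -
    have *: "8 * e - 2 + (1 + (8 * e - 2) + 1) + (8 * e - 2) + (1 + (8 * e - 2) + 1) \<le> 8 * (4 * e) - 2"
      if "1 \<le> e" for e :: nat using that by arith
    show ?thesis unfolding power_Suc by (rule *) (rule one_le_power, simp)
  qed
  then show ?case by (rule words_mono[OF word])
qed

lemma controlled_su2:
  assumes pq: "p \<noteq> q" "p < N" "q < N" and C: "C \<subseteq> {..<N} - {p, q}" and w: "w \<in> SU2"
  shows "exchange p q (controls_match N C x) w \<in> words (su2_gates N) (96 * N ^ 2)"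
proof -
  let ?A = "\<lambda>r. r < 2 ^ N"
  \<comment> \<open>Rounding up to a power of two at most doubles \<open>N\<close>, so 4^k is at
    most 4 N^2. The three Euler factors cost at most 24 * 4^k, whence 96 N^2.\<close>
  define k where "k = (LEAST k. N \<le> 2 ^ k)"
  have k: "N \<le> 2 ^ k" unfolding k_def by (rule LeastI[of _ N]) (simp add: less_imp_le)
  have k2: "2 ^ k \<le> 2 * N"
  proof (cases k)
    case 0
    then show ?thesis using pq by simp
  next
    case (Suc j)
    then have "\<not> N \<le> 2 ^ j" using not_less_Least[of j "\<lambda>k. N \<le> 2 ^ k"] by (simp add: k_def)
    then show ?thesis using Suc by simp
  qed
  have fin: "finite C" using C finite_subset by blast
  have "card C \<le> card {..<N}" using C by (intro card_mono) auto
  then have card: "card C \<le> 2 ^ k" using k by simp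
  let ?T = "8 * 4 ^ k - 2 :: nat"
  have inv: "controls_match N C x (flip_bits p q r) = controls_match N C x r" for r
    using C pq by (intro controls_match_flip_bits) auto
  have Y: "exchange p q (controls_match N C x) (yrot s) \<in> words (su2_gates N) (1 + ?T + 1)" for s
  proof -
    have "exchange p q ?A (su2_inv y_to_z) \<circ> exchange p q (controls_match N C x) (zrot (- s)) \<circ> exchange p q ?A (su2_inv (su2_inv y_to_z))
      = exchange p q (controls_match N C x) (su2_inv y_to_z \<odot> zrot (- s) \<odot> su2_inv (su2_inv y_to_z))"
      using pq inv by (intro exchange_conj y_to_z_SU2 SU2_su2_inv) (auto simp: controls_match_def flip_bits_less)
    then have "exchange p q (controls_match N C x) (yrot s)
      = exchange p q ?A (su2_inv y_to_z) \<circ> exchange p q (controls_match N C x) (zrot (- s)) \<circ> exchange p q ?A y_to_z"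
      by (simp add: y_to_z_conj')
    moreover have "\<dots> \<in> words (su2_gates N) (1 + ?T + 1)"
      using pq C fin card by (intro words_comp su2_gate_words controlled_zrot y_to_z_SU2 SU2_su2_inv)
    ultimately show ?thesis by simp
  qed
  obtain u t v where w: "w = zrot u \<odot> yrot t \<odot> zrot v" using euler[OF w] by blast
  have "exchange p q (controls_match N C x) w = exchange p q (controls_match N C x) (zrot u) \<circ> exchange p q (controls_match N C x) (yrot t) \<circ> exchange p q (controls_match N C x) (zrot v)"
    unfolding w by (intro ext) (simp add: exchange_mult[symmetric] pq inv)
  also have "\<dots> \<in> words (su2_gates N) (?T + (1 + ?T + 1) + ?T)"
    using pq C fin card by (intro words_comp Y controlled_zrot)
  finally show ?thesis
  proof (rule words_mono)
    have "(4::nat) ^ k = (2 ^ k) ^ 2" by (simp add: power2_eq_square flip: power_mult_distrib)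
    also have "\<dots> \<le> (2 * N) ^ 2" using k2 by (intro power_mono) auto
    finally have "4 ^ k \<le> 4 * N ^ 2" by (simp add: power_mult_distrib)
    then have "24 * 4 ^ k \<le> 96 * N ^ 2" by simp
    moreover have *: "8 * e - 2 + (1 + (8 * e - 2) + 1) + (8 * e - 2) \<le> 24 * e" if "1 \<le> e" for e :: nat
      using that by arith
    ultimately show "?T + (1 + ?T + 1) + ?T \<le> 96 * N ^ 2"
      using *[OF one_le_power[of 4 k]] by (meson le_trans one_le_numeral)
  qed
qed

section \<open>Rotations of two basis states of equal weight\<close>

definition two_level_op :: "nat \<Rightarrow> nat \<Rightarrow> complex \<times> complex \<Rightarrow> (nat \<Rightarrow> complex) \<Rightarrow> nat \<Rightarrow> complex" where
  "two_level_op x y w f r =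
    (if r = x then fst w * f x + snd w * f y
     else if r = y then cnj (fst w) * f y - cnj (snd w) * f x else f r)"

text \<open>With all remaining qubits as controls, only the two given states satisfy the control and
  differ at \<open>p\<close> and \<open>q\<close>. The set bit \<open>q\<close> of \<open>x\<close>
  matches the order |01>, |10> in which \<open>exchange\<close> reads its pair.\<close>

lemma two_level_op_adjacent:
  assumes "p \<noteq> q" "p < N" "q < N" "x < 2 ^ N" "\<not> bit x p" "bit x q"
  shows "two_level_op x (flip_bits p q x) w = exchange p q (controls_match N ({..<N} - {p, q}) x) w"
proof (intro ext)
  fix f r
  have *: "controls_match N ({..<N} - {p, q}) x r \<and> bit r p \<noteq> bit r q \<longleftrightarrow> r = x \<or> r = flip_bits p q x"
  proof (intro iffI)
    assume a: "controls_match N ({..<N} - {p, q}) x r \<and> bit r p \<noteq> bit r q"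
    have i: "bit r i = bit x i" if "i \<noteq> p" "i \<noteq> q" for i
      using that a assms(4) by (cases "i < N") (auto simp: controls_match_def less_exp_bit not_less)
    show "r = x \<or> r = flip_bits p q x"
    proof (cases "bit r q")
      case True
      then have "r = x" using a assms i by (intro bit_eqI) metis
      then show ?thesis ..
    next
      case False
      then have "r = flip_bits p q x" using a assms i by (intro bit_eqI) (auto simp: bit_flip_bits)
      then show ?thesis ..
    qed
  next
    assume "r = x \<or> r = flip_bits p q x"
    then show "controls_match N ({..<N} - {p, q}) x r \<and> bit r p \<noteq> bit r q"
      using assms by (auto simp: controls_match_def flip_bits_less bit_flip_bits)
  qed
  show "two_level_op x (flip_bits p q x) w f r = exchange p q (controls_match N ({..<N} - {p, q}) x) w f r"
    unfolding exchange_def * using assms by (auto simp: two_level_op_def bit_flip_bits)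
qed

definition hamming_weight :: "nat \<Rightarrow> nat" where
  "hamming_weight x = card {i. bit x i}"

lemma finite_bits: "finite {i. bit (x::nat) i}"
proof -
  obtain N where "x < 2 ^ N" using less_exp by blast
  then have "{i. bit x i} \<subseteq> {..<N}" by (auto simp: less_exp_bit) (meson not_less)
  then show ?thesis using finite_subset by blast
qed

text \<open>Each conjugation by a controlled signed swap decreases the Hamming distance of \<open>x\<close> and \<open>y\<close> by 2.\<close>

lemma two_level_op_general:
  "x < 2 ^ N \<Longrightarrow> y < 2 ^ N \<Longrightarrow> card {i. bit x i \<and> \<not> bit y i} = Suc d \<Longrightarrow> card {i. bit y i \<and> \<not> bit x i} = Suc d
   \<Longrightarrow> w \<in> SU2 \<Longrightarrow> two_level_op x y w \<in> words (su2_gates N) (96 * N ^ 2 + 8 * d)"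
proof (induction d arbitrary: x)
  case 0
  obtain q where q: "{i. bit x i \<and> \<not> bit y i} = {q}" using 0 card_1_singletonE by (metis One_nat_def)
  obtain p where p: "{i. bit y i \<and> \<not> bit x i} = {p}" using 0 card_1_singletonE by (metis One_nat_def)
  have pq: "bit x q" "\<not> bit y q" "bit y p" "\<not> bit x p" using p q by auto
  then have l: "p < N" "q < N" "p \<noteq> q" using 0 by (auto simp: less_exp_bit not_less intro: ccontr)
  have "y = flip_bits p q x"
  proof (rule bit_eqI)
    fix i
    show "bit y i = bit (flip_bits p q x) i" using p q pq l by (auto simp: bit_flip_bits)
  qed
  then show ?case using two_level_op_adjacent[OF l(3,1,2) 0(1) pq(4,1)] controlled_su2[OF l(3,1,2) subset_refl 0(5)]
    by simp
next
  case (Suc d)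
  let ?D = "{i. bit x i \<and> \<not> bit y i}" and ?E = "{i. bit y i \<and> \<not> bit x i}"
  obtain s B where s: "?E = insert s B" "s \<notin> B" "card B = Suc d" using Suc.prems(4) card_Suc_eq by metis
  then obtain p where p: "p \<in> B" by fastforce
  obtain r B' where r: "?D = insert r B'" "r \<notin> B'" "card B' = Suc d" using Suc.prems(3) card_Suc_eq by metis
  have b: "bit y s" "\<not> bit x s" "bit y p" "\<not> bit x p" "p \<noteq> s" "bit x r" "\<not> bit y r"
    using s p r by blast+
  then have l: "s < N" "p < N" "r < N" "distinct [p, s, r]" using Suc.prems by (auto simp: less_exp_bit not_less intro: ccontr)
  define x' where "x' = flip_bits s r x"
  have sr: "s \<noteq> r" using l by simp
  have x': "bit x' i = (if i = s \<or> i = r then \<not> bit x i else bit x i)" for i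
    unfolding x'_def using bit_flip_bits[OF sr] .
  have "{i. bit x' i \<and> \<not> bit y i} = B'"
  proof -
    have "{i. bit x' i \<and> \<not> bit y i} = ?D - {r}" using b by (auto simp: x')
    then show ?thesis using r by simp
  qed
  moreover have "{i. bit y i \<and> \<not> bit x' i} = B"
  proof -
    have "{i. bit y i \<and> \<not> bit x' i} = ?E - {s}" using b by (auto simp: x')
    then show ?thesis using s by simp
  qed
  moreover have "x' < 2 ^ N" using Suc.prems l by (simp add: x'_def flip_bits_less)
  ultimately have IH: "two_level_op x' y w \<in> words (su2_gates N) (96 * N ^ 2 + 8 * d)"
    using Suc s r by simp
  \<comment> \<open>Position \<open>p\<close> is 1 in \<open>y\<close> and 0 in \<open>x\<close> and
    \<open>x'\<close>. The control on 0 there protects \<open>y\<close>, which has different bits at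
    \<open>s\<close> and \<open>r\<close> and would be moved by the bare swap.\<close>
  let ?P = "\<lambda>i. i < 2 ^ N \<and> \<not> bit i p"
  let ?K = "\<lambda>t. exchange s r ?P (yrot t)"
  have P: "?P (flip_bits s r i) = ?P i" for i using l by (simp add: flip_bits_less bit_flip_bits)
  have Px: "?P x" "?P x'" "\<not> ?P y" using Suc.prems b l \<open>x' < 2 ^ N\<close> by (auto simp: x')
  have Kf: "?K t f x = complex_of_real (cos t) * f x + complex_of_real (sin t) * f x'"
    "?K t f x' = complex_of_real (cos t) * f x' - complex_of_real (sin t) * f x" "?K t f y = f y" for t f
    using b Px x' sr by (simp_all add: exchange_def yrot_def) (simp_all add: x'_def)
  have xx: "x \<noteq> x'" "x \<noteq> y" "x' \<noteq> y" using b x' Px by metis+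
  have "two_level_op x y w = ?K (pi / 2) \<circ> two_level_op x' y w \<circ> ?K (- (pi / 2))"
  proof (intro ext)
    fix f i
    consider "i = x" | "i = x'" | "i = y" | "i \<noteq> x" "i \<noteq> x'" "i \<noteq> y" by blast
    then show "two_level_op x y w f i = (?K (pi / 2) \<circ> two_level_op x' y w \<circ> ?K (- (pi / 2))) f i"
    proof cases
      case 1
      then show ?thesis using xx by (simp add: Kf two_level_op_def)
    next
      case 2
      then show ?thesis using xx by (simp add: Kf two_level_op_def)
    next
      case 3
      then show ?thesis using xx by (simp add: Kf two_level_op_def)
    next
      case 4
      show ?thesis
      proof (cases "?P i")
        case True
        \<comment> \<open>Any other state moved by the swap is moved back, since neither it nor its
          image is touched in between.\<close>
        then have ny: "flip_bits s r i \<noteq> y" using P Px by metis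
        have nx: "flip_bits s r i \<noteq> x'" using 4 flip_bits_flip_bits x'_def by metis
        let ?g = "?K (- (pi / 2)) f"
        have "?K (pi / 2) (two_level_op x' y w ?g) i = ?K (pi / 2) ?g i"
          unfolding exchange_def[of s r ?P "yrot (pi / 2)"] using 4 nx ny by (simp add: two_level_op_def)
        also have "\<dots> = f i" using exchange_mult[OF sr, of ?P, OF P] by (simp add: yrot_mult)
        finally show ?thesis using 4 by (simp add: two_level_op_def)
      next
        case False
        then have "?K t g i = g i" for t g by (simp only: exchange_def False simp_thms if_False)
        then show ?thesis using 4 by (simp only: o_apply two_level_op_def if_False)
      qed
    qed
  qed
  also have "\<dots> \<in> words (su2_gates N) (4 + (96 * N ^ 2 + 8 * d) + 4)"
    using l one_control_yrot[of p s r N False] by (intro words_comp IH) auto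
  finally show ?case by (simp add: algebra_simps)
qed

lemma two_level_words:
  assumes "x < 2 ^ N" "y < 2 ^ N" "x \<noteq> y" "hamming_weight x = hamming_weight y" "w \<in> SU2"
  shows "two_level_op x y w \<in> words (su2_gates N) (104 * N ^ 2)"
proof -
  let ?D = "{i. bit x i \<and> \<not> bit y i}" and ?E = "{i. bit y i \<and> \<not> bit x i}"
  let ?I = "{i. bit x i \<and> bit y i}"
  have fin: "finite ?D" "finite ?E" "finite ?I"
    using finite_bits[of x] finite_bits[of y] by (auto elim!: rev_finite_subset)
  have "{i. bit x i} = ?D \<union> ?I" "{i. bit y i} = ?E \<union> ?I" "?D \<inter> ?I = {}" "?E \<inter> ?I = {}" by auto
  then have "hamming_weight x = card ?D + card ?I" "hamming_weight y = card ?E + card ?I"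
    unfolding hamming_weight_def by (simp_all only: card_Un_disjoint fin not_False_eq_True)
  then have eq: "card ?D = card ?E" using assms by simp
  have "\<exists>i. bit x i \<noteq> bit y i" using assms(3) bit_eqI by blast
  then have "?D \<noteq> {} \<or> ?E \<noteq> {}" by blast
  then have "card ?D \<noteq> 0" using eq fin card_0_eq by metis
  then obtain d where d: "card ?D = Suc d" using not0_implies_Suc by blast
  have "?D \<subseteq> {..<N}" using assms by (auto simp: less_exp_bit) (meson not_less)
  then have "card ?D \<le> N" using card_mono[of "{..<N}" ?D] by simp
  \<comment> \<open>The linear cost of the swaps is absorbed into the quadratic term: 96 + 8 =
    104.\<close>
  then have "8 * d \<le> 8 * N ^ 2" using d by (simp add: power2_eq_square) (metis Suc_leD le_square le_trans)
  then show ?thesis using two_level_op_general[OF assms(1,2) d _ assms(5)] d eq by (auto intro: words_mono)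
qed

section \<open>Synthesis of energy-conserving unitaries on state functions\<close>

lemma words_induct:
  assumes "F \<in> words G m" "P id" "\<And>g F. g \<in> G \<Longrightarrow> P F \<Longrightarrow> P (g \<circ> F)"
  shows "P F"
proof -
  obtain gs where gs: "set gs \<subseteq> G" "F = foldr (\<circ>) gs id"
    using assms(1) unfolding words_def by blast
  have "set gs \<subseteq> G \<Longrightarrow> P (foldr (\<circ>) gs id)"
  proof (induction gs)
    case Nil
    then show ?case using assms(2) by (simp add: id_def)
  next
    case (Cons g gs)
    have "foldr (\<circ>) (g # gs) id = g \<circ> foldr (\<circ>) gs id" by simp
    moreover have "g \<in> G" "set gs \<subseteq> G" using Cons.prems by auto
    ultimately show ?case using assms(3)[OF \<open>g \<in> G\<close> Cons.IH[OF \<open>set gs \<subseteq> G\<close>]] by argo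
  qed
  then show ?thesis using gs by blast
qed

text \<open>\<open>e\<close> is an encoding, in both uses the insertion of an ancilla in |0>.
  Replacement gates need to agree only on encoded states; every step leaves an encoded state, so the
  next one applies again.\<close>

lemma words_simulate:
  assumes "F \<in> words G m"
    and sim: "\<And>g. g \<in> G \<Longrightarrow> \<exists>g' \<in> words G' k. \<forall>\<psi>. g' (e \<psi>) = e (g \<psi>)"
  shows "\<exists>F' \<in> words G' (k * m). \<forall>\<psi>. F' (e \<psi>) = e (F \<psi>)"
proof -
  obtain gs where gs: "set gs \<subseteq> G" "length gs \<le> m" "F = foldr (\<circ>) gs id"
    using assms(1) unfolding words_def by blast
  have "set gs \<subseteq> G \<Longrightarrow> \<exists>F' \<in> words G' (k * length gs). \<forall>\<psi>. F' (e \<psi>) = e (foldr (\<circ>) gs id \<psi>)"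
  proof (induction gs)
    case Nil
    then show ?case using words_id[of G' 0] by (intro bexI[of _ id]) auto
  next
    case (Cons g gs)
    have "g \<in> G" "set gs \<subseteq> G" using Cons.prems by simp_all
    obtain F' where F': "F' \<in> words G' (k * length gs)" "\<forall>\<psi>. F' (e \<psi>) = e (foldr (\<circ>) gs id \<psi>)"
      using Cons.IH[OF \<open>set gs \<subseteq> G\<close>] by blast
    obtain g' where g': "g' \<in> words G' k" "\<forall>\<psi>. g' (e \<psi>) = e (g \<psi>)"
      using sim[OF \<open>g \<in> G\<close>] by blast
    have "k + k * length gs = k * length (g # gs)" by simp
    then have "g' \<circ> F' \<in> words G' (k * length (g # gs))" using words_comp[OF g'(1) F'(1)] by argo
    moreover have "\<forall>\<psi>. (g' \<circ> F') (e \<psi>) = e (foldr (\<circ>) (g # gs) id \<psi>)" using g' F' by simp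
    ultimately show ?case by blast
  qed
  then obtain F' where "F' \<in> words G' (k * length gs)" "\<forall>\<psi>. F' (e \<psi>) = e (F \<psi>)" using gs by blast
  then show ?thesis using gs(2) words_mono by (metis mult_le_mono2)
qed

section \<open>Gaussian elimination by two-level rotations\<close>

definition two_level :: "nat \<Rightarrow> ((nat \<Rightarrow> complex) \<Rightarrow> nat \<Rightarrow> complex) set" where
  "two_level d = {two_level_op x y u | x y u. x < d \<and> y < d \<and> x \<noteq> y \<and> hamming_weight x = hamming_weight y \<and> u \<in> SU2}"

lemma two_level_op_words:
  "x < d \<Longrightarrow> y < d \<Longrightarrow> x \<noteq> y \<Longrightarrow> hamming_weight x = hamming_weight y \<Longrightarrow> u \<in> SU2 \<Longrightarrow> two_level_op x y u \<in> words (two_level d) 1"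
  unfolding two_level_def by (rule words_gen) blast+

text \<open>By their type, words are arbitrary maps on amplitude functions. Linearity is recovered
  gate by gate, in the form in which the synthesis expands a state over columns.\<close>

lemma two_level_linear:
  fixes k :: nat and g :: "nat \<Rightarrow> nat \<Rightarrow> complex"
  assumes "F \<in> words (two_level d) m"
  shows "F (\<lambda>r. \<Sum>c<k. a c * g c r) r = (\<Sum>c<k. a c * F (g c) r)"
proof -
  have "\<forall>r. F (\<lambda>r. \<Sum>c<k. a c * g c r) r = (\<Sum>c<(k::nat). a c * F (g c) r)"
    using assms
  proof (rule words_induct[where P = "\<lambda>F. \<forall>r. F (\<lambda>r. \<Sum>c<k. a c * g c r) r = (\<Sum>c<(k::nat). a c * F (g c) r)"])
    fix t F :: "(nat \<Rightarrow> complex) \<Rightarrow> nat \<Rightarrow> complex"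
    assume t: "t \<in> two_level d" and IH: "\<forall>r. F (\<lambda>r. \<Sum>c<k. a c * g c r) r = (\<Sum>c<k. a c * F (g c) r)"
    then have eq: "F (\<lambda>r. \<Sum>c<k. a c * g c r) = (\<lambda>r. \<Sum>c<k. a c * F (g c) r)" by auto
    show "\<forall>r. (t \<circ> F) (\<lambda>r. \<Sum>c<k. a c * g c r) r = (\<Sum>c<k. a c * (t \<circ> F) (g c) r)"
      using t by (auto simp: eq two_level_def two_level_op_def sum_distrib_left sum.distrib sum_subtractf algebra_simps)
  qed simp
  then show ?thesis by blast
qed

lemma two_level_op_inner:
  assumes "x < d" "y < d" "x \<noteq> y" "u \<in> SU2"
  shows "(\<Sum>r<d. cnj (two_level_op x y u f r) * two_level_op x y u g r) = (\<Sum>r<d. cnj (f r) * g r)"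
proof -
  let ?S = "{..<d} - {x} - {y}"
  have split: "(\<Sum>r<d. h r) = h x + (h y + sum h ?S)" for h :: "nat \<Rightarrow> complex"
    using assms by (simp add: sum.remove[of "{..<d}" x] sum.remove[of "{..<d} - {x}" y])
  have S: "(\<Sum>r\<in>?S. cnj (two_level_op x y u f r) * two_level_op x y u g r) = (\<Sum>r\<in>?S. cnj (f r) * g r)"
    by (intro sum.cong) (auto simp: two_level_op_def)
  obtain a b where u: "u = (a, b)" by fastforce
  have 1: "a * cnj a = 1 - b * cnj b" using assms(4) by (simp add: SU2_def u eq_diff_eq)
  have "cnj (a * f x + b * f y) * (a * g x + b * g y) + cnj (cnj a * f y - cnj b * f x) * (cnj a * g y - cnj b * g x)
    = (a * cnj a + b * cnj b) * (cnj (f x) * g x + cnj (f y) * g y)"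
    by (simp add: algebra_simps)
  also have "\<dots> = cnj (f x) * g x + cnj (f y) * g y" using 1 by simp
  finally show ?thesis
    unfolding split S using assms(3) by (simp add: two_level_op_def u add.assoc[symmetric])
qed

lemma two_level_inner:
  assumes "F \<in> words (two_level d) m"
  shows "(\<Sum>r<d. cnj (F f r) * F g r) = (\<Sum>r<d. cnj (f r) * g r)"
  using assms
  by (rule words_induct) (auto simp: two_level_def two_level_op_inner)

lemma two_level_weight:
  assumes "F \<in> words (two_level d) m" "\<forall>r<d. hamming_weight r \<noteq> k \<longrightarrow> f r = 0"
  shows "\<forall>r<d. hamming_weight r \<noteq> k \<longrightarrow> F f r = 0"
  using assms
  by (elim words_induct) (auto simp: two_level_def two_level_op_def)

text \<open>Each entry is rotated into the pivot \<open>m\<close>. The two locality clauses protect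
  earlier work: a column that vanishes at the pivot and on \<open>R\<close> stays as it is.\<close>

lemma clear_entries:
  assumes "finite R" "R \<subseteq> {..<d} - {m}" "m < d" "\<forall>r\<in>R. hamming_weight r = hamming_weight m"
  shows "\<exists>F \<in> words (two_level d) (card R). (\<forall>r\<in>R. F u r = 0)
    \<and> (\<forall>f r. r \<notin> insert m R \<longrightarrow> F f r = f r) \<and> (\<forall>f. (\<forall>r\<in>insert m R. f r = 0) \<longrightarrow> F f = f)"
  using assms
proof (induction R rule: finite_induct)
  case empty
  show ?case using words_id by (intro bexI[of _ id]) auto
next
  case (insert x R)
  then obtain F where F: "F \<in> words (two_level d) (card R)" "\<forall>r\<in>R. F u r = 0"
    "\<forall>f r. r \<notin> insert m R \<longrightarrow> F f r = f r" "\<forall>f. (\<forall>r\<in>insert m R. f r = 0) \<longrightarrow> F f = f"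
    by auto
  define \<alpha> \<beta> where "\<alpha> = F u m" and "\<beta> = F u x"
  define \<rho> where "\<rho> = sqrt (cmod \<alpha> ^ 2 + cmod \<beta> ^ 2)"
  \<comment> \<open>Givens rotation: the first row is the normalized conjugate of the vector to be
    cleared, so the second row annihilates it. If both entries vanish, the identity serves.\<close>
  define w where "w = (if \<rho> = 0 then (1, 0) else (cnj \<alpha> / of_real \<rho>, cnj \<beta> / of_real \<rho>))"
  have w: "w \<in> SU2"
  proof (cases "\<rho> = 0")
    case False
    have "(cmod \<alpha> / \<rho>) ^ 2 + (cmod \<beta> / \<rho>) ^ 2 = (cmod \<alpha> ^ 2 + cmod \<beta> ^ 2) / \<rho> ^ 2"
      by (simp add: power_divide add_divide_distrib)
    also have "\<rho> ^ 2 = cmod \<alpha> ^ 2 + cmod \<beta> ^ 2" by (simp add: \<rho>_def)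
    also have "\<dots> / \<dots> = 1" using False by (simp add: \<rho>_def)
    finally show ?thesis using False by (simp add: SU2_norm w_def norm_divide power_divide)
  qed (simp add: w_def SU2_def)
  have zero: "cnj (fst w) * \<beta> - cnj (snd w) * \<alpha> = 0"
  proof (cases "\<rho> = 0")
    case True
    then have "cmod \<alpha> ^ 2 + cmod \<beta> ^ 2 = 0" by (simp add: \<rho>_def)
    then have "\<beta> = 0" by (simp add: sum_power2_eq_zero_iff)
    then show ?thesis using True by (simp add: w_def)
  qed (simp add: w_def)
  have mx: "m \<noteq> x" using insert by auto
  have "two_level_op m x w \<in> words (two_level d) 1"
    using insert w mx by (intro two_level_op_words) auto
  from words_comp[OF this F(1)] have "two_level_op m x w \<circ> F \<in> words (two_level d) (card (insert x R))"
    using insert by simp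
  moreover have "\<forall>r\<in>insert x R. (two_level_op m x w \<circ> F) u r = 0"
    using F(2) insert zero mx by (auto simp: two_level_op_def \<alpha>_def \<beta>_def)
  moreover have "\<forall>f r. r \<notin> insert m (insert x R) \<longrightarrow> (two_level_op m x w \<circ> F) f r = f r"
    using F(3) by (auto simp: two_level_op_def)
  moreover have "\<forall>f. (\<forall>r\<in>insert m (insert x R). f r = 0) \<longrightarrow> (two_level_op m x w \<circ> F) f = f"
    using F(4) by (auto simp: two_level_op_def fun_eq_iff)
  ultimately show ?case by blast
qed

text \<open>Rotations are spent only below the diagonal and inside the weight class, one for each
  pair c < r of equal weight. The entries above the diagonal vanish by orthogonality to the finished
  columns, those in other classes by energy conservation.\<close>

lemma eliminate_columns:
  fixes v :: "nat \<Rightarrow> nat \<Rightarrow> complex"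
  assumes orth: "\<And>c c'. c < d \<Longrightarrow> c' < d \<Longrightarrow> (\<Sum>r<d. cnj (v c r) * v c' r) = (if c = c' then 1 else 0)"
    and weight: "\<And>c r. c < d \<Longrightarrow> r < d \<Longrightarrow> hamming_weight r \<noteq> hamming_weight c \<Longrightarrow> v c r = 0"
  shows "k \<le> d \<Longrightarrow> \<exists>F \<in> words (two_level d) (\<Sum>c<k. card {r. c < r \<and> r < d \<and> hamming_weight r = hamming_weight c}). \<exists>l.
    (\<forall>c<k. \<forall>r<d. F (v c) r = (if r = c then l c else 0)) \<and> (\<forall>c<k. l c * cnj (l c) = 1)"
proof (induction k)
  case 0
  show ?case using words_id by (intro bexI[of _ id]) auto
next
  case (Suc k)
  then obtain F l where F: "F \<in> words (two_level d) (\<Sum>c<k. card {r. c < r \<and> r < d \<and> hamming_weight r = hamming_weight c})"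
    and l: "\<And>c r. c < k \<Longrightarrow> r < d \<Longrightarrow> F (v c) r = (if r = c then l c else 0)" "\<And>c. c < k \<Longrightarrow> l c * cnj (l c) = 1"
    by auto
  define R where "R = {r. k < r \<and> r < d \<and> hamming_weight r = hamming_weight k}"
  have R: "finite R" "R \<subseteq> {..<d} - {k}" "k < d" "\<forall>r\<in>R. hamming_weight r = hamming_weight k" using Suc by (auto simp: R_def)
  obtain F' where F': "F' \<in> words (two_level d) (card R)" "\<forall>r\<in>R. F' (F (v k)) r = 0"
    "\<And>f r. r \<notin> insert k R \<Longrightarrow> F' f r = f r" "\<And>f. (\<forall>r\<in>insert k R. f r = 0) \<Longrightarrow> F' f = f"
    using clear_entries[OF R, of "F (v k)"] by blast
  have below: "F (v k) c = 0" if c: "c < k" for c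
  proof -
    have "(\<Sum>r<d. cnj (F (v c) r) * F (v k) r) = (\<Sum>r<d. if r = c then cnj (l c) * F (v k) c else 0)"
      using l(1)[OF c] by (intro sum.cong refl) simp
    also have "\<dots> = cnj (l c) * F (v k) c" using c R(3) by simp
    finally have "cnj (l c) * F (v k) c = 0"
      using orth[of c k] c R(3) by (simp add: two_level_inner[OF F])
    then show ?thesis using l(2)[OF c] by auto
  qed
  have wk: "\<forall>r<d. hamming_weight r \<noteq> hamming_weight k \<longrightarrow> F (v k) r = 0"
    using weight R(3) by (intro two_level_weight[OF F]) auto
  have col: "(F' \<circ> F) (v k) r = (if r = k then F' (F (v k)) k else 0)" if "r < d" for r
  proof (cases "r = k \<or> r \<in> R")
    case False
    then have "F (v k) r = 0" using that below wk by (cases "r < k") (auto simp: R_def)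
    then show ?thesis using False F'(3) by simp
  qed (use F'(2) in auto)
  let ?G = "F' \<circ> F"
  have G: "?G \<in> words (two_level d) (\<Sum>c<Suc k. card {r. c < r \<and> r < d \<and> hamming_weight r = hamming_weight c})"
    using words_comp[OF F'(1) F] by (simp add: R_def add.commute)
  have "(\<Sum>r<d. cnj (?G (v k) r) * ?G (v k) r) = 1"
    unfolding two_level_inner[OF G] using orth R(3) by simp
  also have "(\<Sum>r<d. cnj (?G (v k) r) * ?G (v k) r)
      = (\<Sum>r<d. if r = k then F' (F (v k)) k * cnj (F' (F (v k)) k) else 0)"
  proof (rule sum.cong[OF refl])
    fix r assume "r \<in> {..<d}"
    then have "?G (v k) r = (if r = k then F' (F (v k)) k else 0)" by (intro col) simp
    then show "cnj (?G (v k) r) * ?G (v k) r = (if r = k then F' (F (v k)) k * cnj (F' (F (v k)) k) else 0)"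
      by (simp only: mult.commute if_distrib[of cnj] complex_cnj_zero mult_zero_left refl split: if_split) blast
  qed
  also have "\<dots> = F' (F (v k)) k * cnj (F' (F (v k)) k)" using R(3) by simp
  finally have one: "F' (F (v k)) k * cnj (F' (F (v k)) k) = 1" .
  have old: "?G (v c) r = (if r = c then l c else 0)" if "c < k" "r < d" for c r
  proof -
    have "F (v c) r = 0" if "r \<in> insert k R" for r
      using l(1)[OF \<open>c < k\<close>, of r] that R(3) \<open>c < k\<close> by (auto simp: R_def)
    then have "F' (F (v c)) = F (v c)" by (intro F'(4)) blast
    then show ?thesis using l(1)[OF that] by (simp only: o_apply)
  qed
  define l' where "l' = l(k := F' (F (v k)) k)"
  have "?G (v c) r = (if r = c then l' c else 0)" if "c < Suc k" "r < d" for c r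
  proof (cases "c = k")
    case True
    then show ?thesis using col[OF that(2)] by (simp only: l'_def fun_upd_same)
  next
    case False
    then have "c < k" using that by simp
    then show ?thesis using old[of c r] False that(2) unfolding l'_def by simp
  qed
  moreover have "l' c * cnj (l' c) = 1" if "c < Suc k" for c
    using that one l(2)[of c] by (cases "c = k") (simp_all only: l'_def fun_upd_same fun_upd_other less_Suc_eq simp_thms)
  ultimately show ?case using G by blast
qed

section \<open>Counting pairs of equal weight\<close>

lemma card_weight_class: "card {r. r < 2 ^ n \<and> hamming_weight r = k} \<le> n choose k"
proof -
  have "card {r. r < 2 ^ n \<and> hamming_weight r = k} \<le> card {A. A \<subseteq> {..<n} \<and> card A = k}"
  proof (rule card_inj_on_le[of "\<lambda>r. {i. bit r i}"])
    show "inj_on (\<lambda>r. {i. bit r i}) {r. r < 2 ^ n \<and> hamming_weight r = k}"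
      by (rule inj_onI, rule bit_eqI) blast
    show "(\<lambda>r. {i. bit r i}) ` {r. r < 2 ^ n \<and> hamming_weight r = k} \<subseteq> {A. A \<subseteq> {..<n} \<and> card A = k}"
      by (auto simp: hamming_weight_def less_exp_bit) (meson not_less)
    show "finite {A. A \<subseteq> {..<n} \<and> card A = k}"
      by (rule finite_subset[of _ "Pow {..<n}"]) auto
  qed
  also have "\<dots> = n choose k" using n_subsets[of "{..<n}" k] by simp
  finally show ?thesis .
qed

lemma hamming_weight_le: "r < 2 ^ n \<Longrightarrow> hamming_weight r \<le> n"
proof -
  assume "r < 2 ^ n"
  then have "{i. bit r i} \<subseteq> {..<n}" by (auto simp: less_exp_bit) (meson not_less)
  then show ?thesis unfolding hamming_weight_def using card_mono[of "{..<n}" "{i. bit r i}"] by simp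
qed

text \<open>Replacing the pairs c < r by all pairs inside a weight class loses a factor of about 2
  and yields a sum of squared binomial coefficients, a case of Vandermonde's identity.\<close>

lemma pair_count:
  "(\<Sum>c<2 ^ n. card {r. c < r \<and> r < 2 ^ n \<and> hamming_weight r = hamming_weight c}) \<le> (2 * n) choose n"
proof -
  let ?S = "\<lambda>k. {r. r < 2 ^ n \<and> hamming_weight r = k}"
  have "(\<Sum>c<2 ^ n. card {r. c < r \<and> r < 2 ^ n \<and> hamming_weight r = hamming_weight c}) \<le> (\<Sum>c<2 ^ n. card (?S (hamming_weight c)))"
    by (intro sum_mono card_mono) auto
  also have "\<dots> = (\<Sum>k\<in>{..n}. \<Sum>c\<in>{c\<in>{..<2 ^ n}. hamming_weight c = k}. card (?S (hamming_weight c)))"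
    by (rule sum.group[symmetric]) (auto intro: hamming_weight_le)
  also have "\<dots> = (\<Sum>k\<in>{..n}. card (?S k) * card (?S k))"
    by (intro sum.cong refl) simp
  also have "\<dots> \<le> (\<Sum>k\<in>{..n}. (n choose k) * (n choose k))"
    by (intro sum_mono mult_mono card_weight_class) auto
  also have "\<dots> = (2 * n) choose n"
    using choose_square_sum[of n] by (simp add: power2_eq_square)
  finally show ?thesis .
qed

text \<open>Appends an ancilla in state \<open>|0\<rangle>\<close>, which becomes the least significant bit of the index.\<close>

definition add_ancilla :: "(nat \<Rightarrow> complex) \<Rightarrow> nat \<Rightarrow> complex" where
  "add_ancilla \<psi> r = (if even r then \<psi> (r div 2) else 0)"

lemma two_level_op_add_ancilla: "two_level_op (2 * x) (2 * y) u (add_ancilla \<psi>) = add_ancilla (two_level_op x y u \<psi>)"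
  by (auto simp: two_level_op_def add_ancilla_def fun_eq_iff elim!: evenE)

section \<open>Diagonal phases with an ancilla\<close>

lemma hamming_weight_double: "hamming_weight (2 * x) = hamming_weight x"
proof -
  have "{i. bit (2 * x) i} = Suc ` {i. bit x i}"
    by (auto simp: bit_double_iff image_iff gr0_conv_Suc intro: exI[of _ "_ - 1"])
  then show ?thesis by (simp add: hamming_weight_def card_image)
qed

lemma hamming_weight_double_Suc: "hamming_weight (Suc (2 * x)) = Suc (hamming_weight x)"
proof -
  have "{i. bit (Suc (2 * x)) i} = insert 0 (Suc ` {i. bit x i})"
  proof (rule Set.set_eqI)
    fix i show "i \<in> {i. bit (Suc (2 * x)) i} \<longleftrightarrow> i \<in> insert 0 (Suc ` {i. bit x i})"
      by (cases i) (auto simp: bit_Suc bit_0)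
  qed
  then show ?thesis using finite_bits by (simp add: hamming_weight_def card_image)
qed

text \<open>Supplies the partner for a phase correction: |c, 0> and |c', 1> have equal weight. Only
  the index 0 has none.\<close>

lemma remove_bit:
  assumes "0 < c" "c < 2 ^ n"
  obtains c' where "c' < 2 ^ n" "Suc (hamming_weight c') = hamming_weight c"
proof -
  obtain i where i: "bit c i" using assms(1) bit_eqI[of c 0] by auto
  define c' where "c' = flip_bit i c"
  have b: "bit c' j = (if j = i then False else bit c j)" for j
    using i by (auto simp: c'_def bit_flip_bit_iff)
  have "{j. bit c j} = insert i {j. bit c' j}" using i by (auto simp: b)
  moreover have "i \<notin> {j. bit c' j}" by (simp add: b)
  ultimately have "hamming_weight c = Suc (hamming_weight c')" using finite_bits by (simp add: hamming_weight_def)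
  moreover have "c' < 2 ^ n" using assms by (auto simp: less_exp_bit b)
  ultimately show ?thesis using that by metis
qed

text \<open>A diagonal element of SU(2) must give the partner state the opposite phase, but the
  partner has the ancilla in |1>, where the amplitude is zero. Each index from 1 to \<open>k\<close>
  costs one rotation; index 0 keeps its phase.\<close>

lemma diagonal_words:
  assumes mu: "\<And>c. \<mu> c * cnj (\<mu> c) = 1"
  shows "k < 2 ^ n \<Longrightarrow> \<exists>F \<in> words (two_level (2 ^ Suc n)) k.
    \<forall>\<psi>. F (add_ancilla \<psi>) = add_ancilla (\<lambda>r. if 0 < r \<and> r \<le> k then \<mu> r * \<psi> r else \<psi> r)"
proof (induction k)
  case 0
  have "(\<lambda>r. if 0 < r \<and> r \<le> 0 then \<mu> r * \<psi> r else \<psi> r) = \<psi>" for \<psi> :: "nat \<Rightarrow> complex"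
    by (auto simp: fun_eq_iff)
  then show ?case using words_id by (intro bexI[of _ id]) auto
next
  case (Suc k)
  then obtain F where F: "F \<in> words (two_level (2 ^ Suc n)) k"
    "\<And>\<psi>. F (add_ancilla \<psi>) = add_ancilla (\<lambda>r. if 0 < r \<and> r \<le> k then \<mu> r * \<psi> r else \<psi> r)" by auto
  obtain c' where c': "c' < 2 ^ n" "Suc (hamming_weight c') = hamming_weight (Suc k)" using remove_bit[of "Suc k" n] Suc.prems by auto
  let ?t = "two_level_op (2 * Suc k) (Suc (2 * c')) (\<mu> (Suc k), 0)"
  have "(\<mu> (Suc k), 0) \<in> SU2" using mu by (simp add: SU2_def)
  moreover have "2 * Suc k \<noteq> Suc (2 * c')" by presburger
  moreover have "2 * Suc k < 2 ^ Suc n" "Suc (2 * c') < 2 ^ Suc n" using Suc.prems c' by auto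
  moreover have "hamming_weight (2 * Suc k) = hamming_weight (Suc (2 * c'))" using c' by (simp only: hamming_weight_double hamming_weight_double_Suc)
  ultimately have "?t \<in> words (two_level (2 ^ Suc n)) 1"
    by (intro two_level_op_words)
  from words_comp[OF this F(1)] have "?t \<circ> F \<in> words (two_level (2 ^ Suc n)) (Suc k)" by simp
  moreover have "(?t \<circ> F) (add_ancilla \<psi>) = add_ancilla (\<lambda>r. if 0 < r \<and> r \<le> Suc k then \<mu> r * \<psi> r else \<psi> r)" for \<psi>
  proof (rule ext)
    fix r
    show "(?t \<circ> F) (add_ancilla \<psi>) r = add_ancilla (\<lambda>r. if 0 < r \<and> r \<le> Suc k then \<mu> r * \<psi> r else \<psi> r) r"
    proof (cases "even r")
      case True
      then obtain s where s: "r = 2 * s" by blast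
      then have "r \<noteq> Suc (2 * c')" "(r = 2 * Suc k) = (s = Suc k)" by presburger+
      then show ?thesis using F(2) s by (auto simp: two_level_op_def add_ancilla_def)
    next
      case False
      then show ?thesis using F(2) by (auto simp: two_level_op_def add_ancilla_def)
    qed
  qed
  ultimately show ?case by blast
qed

theorem functional_synthesis:
  fixes V :: "nat \<Rightarrow> nat \<Rightarrow> complex"
  assumes un: "\<And>c c'. c < 2 ^ n \<Longrightarrow> c' < 2 ^ n \<Longrightarrow> (\<Sum>r<2 ^ n. V c r * cnj (V c' r)) = (if c = c' then 1 else 0)"
    and un': "\<And>c c'. c < 2 ^ n \<Longrightarrow> c' < 2 ^ n \<Longrightarrow> (\<Sum>r<2 ^ n. cnj (V r c) * V r c') = (if c = c' then 1 else 0)"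
    and weight: "\<And>c r. c < 2 ^ n \<Longrightarrow> r < 2 ^ n \<Longrightarrow> hamming_weight r \<noteq> hamming_weight c \<Longrightarrow> V c r = 0"
  shows "\<exists>F \<in> words (su2_gates (Suc n)) (104 * (Suc n) ^ 2 * (((2 * n) choose n) + 2 ^ n)). \<exists>\<phi>::real.
    \<forall>\<psi>. \<forall>r<2 ^ Suc n. F (add_ancilla \<psi>) r = cis \<phi> * add_ancilla (\<lambda>r. \<Sum>c<2 ^ n. V r c * \<psi> c) r"
proof -
  let ?d = "2 ^ n :: nat"
  \<comment> \<open>Elimination runs on the columns of the adjoint of \<open>V\<close>. If
    \<open>F\<close> takes the adjoint to diag \<open>l\<close>, then \<open>F\<close> itself is
    diag \<open>l\<close> times \<open>V\<close>, and no inverse of the word has to be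
    formed.\<close>
  define v where "v c r = cnj (V c r)" for c r
  have "\<exists>F \<in> words (two_level ?d) (\<Sum>c<?d. card {r. c < r \<and> r < ?d \<and> hamming_weight r = hamming_weight c}). \<exists>l.
    (\<forall>c<?d. \<forall>r<?d. F (v c) r = (if r = c then l c else 0)) \<and> (\<forall>c<?d. l c * cnj (l c) = 1)"
    using un weight by (intro eliminate_columns) (auto simp: v_def)
  then obtain F l where "F \<in> words (two_level ?d) (\<Sum>c<?d. card {r. c < r \<and> r < ?d \<and> hamming_weight r = hamming_weight c})"
    and l: "\<And>c r. c < ?d \<Longrightarrow> r < ?d \<Longrightarrow> F (v c) r = (if r = c then l c else 0)" "\<And>c. c < ?d \<Longrightarrow> l c * cnj (l c) = 1"
    by blast
  then have F: "F \<in> words (two_level ?d) ((2 * n) choose n)" using pair_count words_mono by blast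
  have app: "V\<psi> r = cnj (l r) * F \<psi> r" if r: "r < ?d" and V\<psi>: "V\<psi> = (\<lambda>r. \<Sum>c<?d. V r c * \<psi> c)" for \<psi> V\<psi> r
  proof -
    have eq: "(\<Sum>c<?d. V\<psi> c * v c s) = \<psi> s" if s: "s < ?d" for s
    proof -
      have "(\<Sum>c<?d. V\<psi> c * v c s) = (\<Sum>c<?d. \<Sum>b<?d. V c b * \<psi> b * v c s)"
        by (simp add: V\<psi> sum_distrib_right)
      also have "\<dots> = (\<Sum>b<?d. \<Sum>c<?d. V c b * \<psi> b * v c s)" by (rule sum.swap)
      also have "\<dots> = (\<Sum>b<?d. \<psi> b * (\<Sum>c<?d. cnj (V c s) * V c b))"
        by (simp add: v_def sum_distrib_left mult_ac)
      also have "\<dots> = (\<Sum>b<?d. if b = s then \<psi> b else 0)"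
        using un'[OF s] by (intro sum.cong) auto
      finally show ?thesis using s by simp
    qed
    \<comment> \<open>The expansion over the columns reproduces \<open>\<psi>\<close> only below the
      dimension; the values of a word there do not depend on larger indices.\<close>
    have outside: "F f s = F g s" if "\<forall>r<?d. f r = g r" "s < ?d" for f g s
    proof -
      have "\<forall>s<?d. F f s = F g s"
        using F that(1) by (elim words_induct) (auto simp: two_level_def two_level_op_def)
      then show ?thesis using that by blast
    qed
    have "F \<psi> r = F (\<lambda>s. \<Sum>c<?d. V\<psi> c * v c s) r"
      using eq r by (intro outside) auto
    also have "\<dots> = (\<Sum>c<?d. V\<psi> c * F (v c) r)" by (rule two_level_linear[OF F])
    also have "\<dots> = (\<Sum>c<?d. if c = r then V\<psi> r * l r else 0)"
      using l(1) r by (intro sum.cong) auto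
    also have "\<dots> = V\<psi> r * l r" using r by simp
    finally show ?thesis using l(2)[OF r] by (simp add: mult_ac)
  qed
  \<comment> \<open>\<open>F\<close> leaves the phase \<open>l c\<close> on basis state
    \<open>c\<close>; this factor turns it into the common phase \<open>l 0\<close>. The default 1
    keeps the modulus condition true at every index.\<close>
  define \<mu> where "\<mu> c = (if c < ?d then cnj (l c) * l 0 else 1)" for c
  have mu: "\<mu> c * cnj (\<mu> c) = 1" for c
  proof (cases "c < ?d")
    case True
    then have "\<mu> c * cnj (\<mu> c) = (l c * cnj (l c)) * (l 0 * cnj (l 0))" by (simp add: \<mu>_def mult_ac)
    then show ?thesis using l(2) True by simp
  qed (simp add: \<mu>_def)
  have "\<exists>F' \<in> words (two_level (2 ^ Suc n)) (1 * ((2 * n) choose n)). \<forall>\<psi>. F' (add_ancilla \<psi>) = add_ancilla (F \<psi>)"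
  proof (rule words_simulate[OF F])
    fix g assume "g \<in> two_level ?d"
    then obtain x y u where g: "g = two_level_op x y u" "x < ?d" "y < ?d" "x \<noteq> y" "hamming_weight x = hamming_weight y" "u \<in> SU2"
      by (auto simp only: two_level_def)
    then have "two_level_op (2 * x) (2 * y) u \<in> words (two_level (2 ^ Suc n)) 1"
      by (intro two_level_op_words) (auto simp: hamming_weight_double)
    then show "\<exists>g'\<in>words (two_level (2 ^ Suc n)) 1. \<forall>\<psi>. g' (add_ancilla \<psi>) = add_ancilla (g \<psi>)"
      using two_level_op_add_ancilla g by blast
  qed
  then obtain F' where F': "F' \<in> words (two_level (2 ^ Suc n)) ((2 * n) choose n)" "\<And>\<psi>. F' (add_ancilla \<psi>) = add_ancilla (F \<psi>)"
    by auto
  obtain D where D: "D \<in> words (two_level (2 ^ Suc n)) (?d - 1)"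
    "\<And>\<psi>. D (add_ancilla \<psi>) = add_ancilla (\<lambda>r. if 0 < r \<and> r \<le> ?d - 1 then \<mu> r * \<psi> r else \<psi> r)"
    using diagonal_words[of \<mu> "?d - 1" n, OF mu] by auto
  have "D \<circ> F' \<in> words (two_level (2 ^ Suc n)) (((2 * n) choose n) + 2 ^ n)"
    by (rule words_mono[OF words_comp[OF D(1) F'(1)]]) simp
  then have W: "D \<circ> F' \<in> words (su2_gates (Suc n)) (104 * (Suc n) ^ 2 * (((2 * n) choose n) + 2 ^ n))"
    by (rule words_subst) (auto simp only: two_level_def intro: two_level_words)
  have l0: "l 0 = cis (Arg (l 0))"
  proof -
    have "cmod (l 0) = 1" using l(2)[of 0] by (metis complex_mod_sqrt_Re_mult_cnj one_complex.sel(1) real_sqrt_one zero_less_power zero_less_numeral)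
    then show ?thesis by (metis rcis_cmod_Arg rcis_def mult_1 of_real_1)
  qed
  have "(D \<circ> F') (add_ancilla \<psi>) r = l 0 * add_ancilla (\<lambda>r. \<Sum>c<?d. V r c * \<psi> c) r" if r: "r < 2 ^ Suc n" for \<psi> r
  proof (cases "even r")
    case True
    then obtain s where s: "r = 2 * s" "s < ?d" using r by auto
    let ?S = "\<Sum>c<?d. V s c * \<psi> c"
    have "?S = cnj (l s) * F \<psi> s" using app[OF s(2) refl] by simp
    then have "l s * ?S = (l s * cnj (l s)) * F \<psi> s" by simp
    then have "F \<psi> s = l s * ?S" using l(2)[OF s(2)] by simp
    moreover have "\<mu> s * (l s * z) = l 0 * z" for z
    proof -
      have "\<mu> s * (l s * z) = (l s * cnj (l s)) * (l 0 * z)" using s(2) by (simp add: \<mu>_def)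
      then show ?thesis using l(2)[OF s(2)] by simp
    qed
    moreover have "s \<le> ?d - 1" using s by simp
    ultimately show ?thesis using s(1) by (cases "s = 0") (simp_all add: F' D add_ancilla_def)
  next
    case False
    then show ?thesis by (simp add: F' D add_ancilla_def)
  qed
  then have "\<forall>\<psi>. \<forall>r<2 ^ Suc n. (D \<circ> F') (add_ancilla \<psi>) r
      = cis (Arg (l 0)) * add_ancilla (\<lambda>r. \<Sum>c<2 ^ n. V r c * \<psi> c) r"
    unfolding l0[symmetric] by blast
  then show ?thesis using W by blast
qed

section \<open>Matrices, circuits and exponentials\<close>

text \<open>Indices beyond the dimension are left untouched, so that \<open>mat_op\<close> turns products into compositions.\<close>

definition mat_op :: "complex mat \<Rightarrow> (nat \<Rightarrow> complex) \<Rightarrow> nat \<Rightarrow> complex" where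
  "mat_op M f r = (if r < dim_row M then \<Sum>c<dim_col M. M $$ (r, c) * f c else f r)"

lemma mat_op_one: "mat_op (1\<^sub>m d) = id"
proof (intro ext)
  fix f :: "nat \<Rightarrow> complex" and r
  have "(\<Sum>c<d. 1\<^sub>m d $$ (r, c) * f c) = (\<Sum>c<d. if c = r then f r else 0)" if "r < d"
    using that by (intro sum.cong) auto
  then show "mat_op (1\<^sub>m d) f r = id f r" by (simp add: mat_op_def)
qed

lemma mat_op_mult:
  assumes "A \<in> carrier_mat d d" "B \<in> carrier_mat d d"
  shows "mat_op (A * B) = mat_op A \<circ> mat_op B"
proof (intro ext)
  fix f r
  show "mat_op (A * B) f r = (mat_op A \<circ> mat_op B) f r"
  proof (cases "r < d")
    case True
    have "mat_op (A * B) f r = (\<Sum>c<d. (\<Sum>k<d. A $$ (r, k) * B $$ (k, c)) * f c)"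
      using assms True by (simp add: mat_op_def scalar_prod_def atLeast0LessThan)
    also have "\<dots> = (\<Sum>c<d. \<Sum>k<d. A $$ (r, k) * B $$ (k, c) * f c)" by (simp add: sum_distrib_right)
    also have "\<dots> = (\<Sum>k<d. \<Sum>c<d. A $$ (r, k) * B $$ (k, c) * f c)" by (rule sum.swap)
    also have "\<dots> = (mat_op A \<circ> mat_op B) f r"
      using assms True by (simp add: mat_op_def sum_distrib_left mult.assoc)
    finally show ?thesis .
  next
    case False
    then show ?thesis using assms by (simp add: mat_op_def)
  qed
qed

lemma gate_ops_carrier: "g \<in> gate_ops N G1 G2 \<Longrightarrow> g \<in> carrier_mat (2 ^ N) (2 ^ N)"
  by (auto simp: gate_ops_def on_qubits_def)

lemma circuit_carrier:
  "set gs \<subseteq> carrier_mat (2 ^ N) (2 ^ N) \<Longrightarrow> circuit_mat N gs \<in> carrier_mat (2 ^ N) (2 ^ N)"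
  by (induction gs) (auto simp: circuit_mat_def)

lemma mat_op_circuit:
  "set gs \<subseteq> carrier_mat (2 ^ N) (2 ^ N) \<Longrightarrow> mat_op (circuit_mat N gs) = foldr (\<circ>) (map mat_op gs) id"
proof (induction gs)
  case Nil
  then show ?case using mat_op_one[of "2 ^ N"] by (simp add: circuit_mat_def id_def)
next
  case (Cons g gs)
  then have gs: "set gs \<subseteq> carrier_mat (2 ^ N) (2 ^ N)" "g \<in> carrier_mat (2 ^ N) (2 ^ N)" by auto
  have "circuit_mat N (g # gs) = g * circuit_mat N gs" by (simp add: circuit_mat_def)
  moreover have "foldr (\<circ>) (map mat_op (g # gs)) id = mat_op g \<circ> foldr (\<circ>) (map mat_op gs) id" by simp
  ultimately show ?case
    using mat_op_mult[OF gs(2) circuit_carrier[OF gs(1)]] Cons.IH[OF gs(1)] by argo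
qed

lemma words_circuit:
  assumes "F \<in> words (mat_op ` gate_ops N G1 G2) m"
  obtains gs where "set gs \<subseteq> gate_ops N G1 G2" "length gs \<le> m" "mat_op (circuit_mat N gs) = F"
proof -
  obtain fs where fs: "set fs \<subseteq> mat_op ` gate_ops N G1 G2" "length fs \<le> m" "F = foldr (\<circ>) fs id"
    using assms unfolding words_def by blast
  have "set fs \<subseteq> mat_op ` gate_ops N G1 G2 \<Longrightarrow> \<exists>gs. set gs \<subseteq> gate_ops N G1 G2 \<and> map mat_op gs = fs"
  proof (induction fs)
    case (Cons f fs)
    then obtain g gs where "g \<in> gate_ops N G1 G2" "f = mat_op g" "set gs \<subseteq> gate_ops N G1 G2" "map mat_op gs = fs"
      by auto
    then show ?case by (intro exI[of _ "g # gs"]) auto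
  qed simp
  then obtain gs where gs: "set gs \<subseteq> gate_ops N G1 G2" "map mat_op gs = fs" using fs by blast
  have "set gs \<subseteq> carrier_mat (2 ^ N) (2 ^ N)" using gs gate_ops_carrier by blast
  from mat_op_circuit[OF this] have "mat_op (circuit_mat N gs) = F" using fs gs by simp
  moreover have "length gs \<le> m" using fs gs by auto
  ultimately show ?thesis using that gs by blast
qed

text \<open>The ancilla is the last tensor factor and therefore the lowest bit of the index, so
  \<open>add_ancilla\<close> on amplitude functions is tensoring with |0> on vectors.\<close>

lemma realizable_one:
  assumes "F \<in> words (mat_op ` gate_ops (n + 1) G1 G2) m" and V: "V \<in> carrier_mat (2 ^ n) (2 ^ n)"
    and F: "\<And>\<psi> r. r < 2 ^ Suc n \<Longrightarrow> F (add_ancilla \<psi>) r = cis \<phi> * add_ancilla (\<lambda>r. \<Sum>c<2 ^ n. V $$ (r, c) * \<psi> c) r"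
  shows "\<exists>m'\<le>m. realizable_with n 1 G1 G2 V m'"
proof -
  obtain gs where gs: "set gs \<subseteq> gate_ops (n + 1) G1 G2" "length gs \<le> m" "mat_op (circuit_mat (n + 1) gs) = F"
    using assms(1) by (rule words_circuit)
  let ?W = "circuit_mat (n + 1) gs"
  have W: "?W \<in> carrier_mat (2 ^ (n + 1)) (2 ^ (n + 1))"
    using gs gate_ops_carrier by (intro circuit_carrier) blast
  have "?W *\<^sub>v (\<psi> \<otimes>\<^sub>v unit_vec (2 ^ 1) 0) = exp (\<i> * \<phi>) \<cdot>\<^sub>v ((V *\<^sub>v \<psi>) \<otimes>\<^sub>v unit_vec (2 ^ 1) 0)"
    if \<psi>: "\<psi> \<in> carrier_vec (2 ^ n)" for \<psi>
  proof (rule eq_vecI)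
    show "dim_vec (?W *\<^sub>v (\<psi> \<otimes>\<^sub>v unit_vec (2 ^ 1) 0)) = dim_vec (exp (\<i> * \<phi>) \<cdot>\<^sub>v ((V *\<^sub>v \<psi>) \<otimes>\<^sub>v unit_vec (2 ^ 1) 0))"
      using W V by (simp add: kron_vec_def)
    fix r assume "r < dim_vec (exp (\<i> * \<phi>) \<cdot>\<^sub>v ((V *\<^sub>v \<psi>) \<otimes>\<^sub>v unit_vec (2 ^ 1) 0))"
    then have r: "r < 2 * 2 ^ n" using V by (simp add: kron_vec_def mult.commute)
    have k: "(\<psi>' \<otimes>\<^sub>v unit_vec 2 0) $ c = add_ancilla (vec_index \<psi>') c"
      if "c < 2 * 2 ^ n" "dim_vec \<psi>' = 2 ^ n" for c and \<psi>' :: "complex vec"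
      using that by (auto simp: kron_vec_def add_ancilla_def mult.commute even_iff_mod_2_eq_zero)
    have "(?W *\<^sub>v (\<psi> \<otimes>\<^sub>v unit_vec (2 ^ 1) 0)) $ r = mat_op ?W (add_ancilla (vec_index \<psi>)) r"
      using W r \<psi> by (simp add: mat_op_def scalar_prod_def atLeast0LessThan kron_vec_def[of \<psi>] del: One_nat_def)
        (auto intro!: sum.cong simp: add_ancilla_def mult.commute even_iff_mod_2_eq_zero)
    also have "\<dots> = cis \<phi> * add_ancilla (\<lambda>r. \<Sum>c<2 ^ n. V $$ (r, c) * \<psi> $ c) r"
      using F r gs by simp
    also have "add_ancilla (\<lambda>r. \<Sum>c<2 ^ n. V $$ (r, c) * \<psi> $ c) r = add_ancilla (vec_index (V *\<^sub>v \<psi>)) r"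
      using V \<psi> r by (auto simp: add_ancilla_def scalar_prod_def atLeast0LessThan)
    also have "\<dots> = ((V *\<^sub>v \<psi>) \<otimes>\<^sub>v unit_vec 2 0) $ r"
      using r V by (intro k[symmetric]) auto
    finally show "(?W *\<^sub>v (\<psi> \<otimes>\<^sub>v unit_vec (2 ^ 1) 0)) $ r = (exp (\<i> * \<phi>) \<cdot>\<^sub>v ((V *\<^sub>v \<psi>) \<otimes>\<^sub>v unit_vec (2 ^ 1) 0)) $ r"
      using r V by (simp add: cis_conv_exp kron_vec_def mult.commute)
  qed
  then have "implements n 1 ?W V" unfolding implements_def by blast
  then show ?thesis using gs unfolding realizable_with_def by blast
qed

lemma realizable_two:
  assumes "F \<in> words (mat_op ` gate_ops (n + 2) G1 G2) m" and V: "V \<in> carrier_mat (2 ^ n) (2 ^ n)"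
    and F: "\<And>\<psi> r. r < 2 ^ (n + 2) \<Longrightarrow> F (add_ancilla (add_ancilla \<psi>)) r = cis \<phi> * add_ancilla (add_ancilla (\<lambda>r. \<Sum>c<2 ^ n. V $$ (r, c) * \<psi> c)) r"
  shows "\<exists>m'\<le>m. realizable_with n 2 G1 G2 V m'"
proof -
  obtain gs where gs: "set gs \<subseteq> gate_ops (n + 2) G1 G2" "length gs \<le> m" "mat_op (circuit_mat (n + 2) gs) = F"
    using assms(1) by (rule words_circuit)
  let ?W = "circuit_mat (n + 2) gs"
  have W: "?W \<in> carrier_mat (2 ^ (n + 2)) (2 ^ (n + 2))"
    using gs gate_ops_carrier by (intro circuit_carrier) blast
  have k: "(\<psi>' \<otimes>\<^sub>v unit_vec (2 ^ 2) 0) $ c = add_ancilla (add_ancilla (vec_index \<psi>')) c"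
    if "c < 4 * 2 ^ n" "dim_vec \<psi>' = 2 ^ n" for c and \<psi>' :: "complex vec"
  proof -
    \<comment> \<open>Two ancillas in |0> mean that the two lowest bits vanish, so a nested
      \<open>add_ancilla\<close> agrees with a single tensor factor of dimension 4.\<close>
    have "c mod 4 = 0 \<longleftrightarrow> even c \<and> even (c div 2)" by presburger
    moreover have "c div 4 = c div 2 div 2" by simp
    moreover have "c mod 4 < 4" by simp
    ultimately show ?thesis using that
      by (auto simp: kron_vec_def add_ancilla_def mult.commute less_mult_imp_div_less)
  qed
  have "?W *\<^sub>v (\<psi> \<otimes>\<^sub>v unit_vec (2 ^ 2) 0) = exp (\<i> * \<phi>) \<cdot>\<^sub>v ((V *\<^sub>v \<psi>) \<otimes>\<^sub>v unit_vec (2 ^ 2) 0)"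
    if \<psi>: "\<psi> \<in> carrier_vec (2 ^ n)" for \<psi>
  proof (rule eq_vecI)
    show "dim_vec (?W *\<^sub>v (\<psi> \<otimes>\<^sub>v unit_vec (2 ^ 2) 0)) = dim_vec (exp (\<i> * \<phi>) \<cdot>\<^sub>v ((V *\<^sub>v \<psi>) \<otimes>\<^sub>v unit_vec (2 ^ 2) 0))"
      using W V by (simp add: kron_vec_def)
    fix r assume "r < dim_vec (exp (\<i> * \<phi>) \<cdot>\<^sub>v ((V *\<^sub>v \<psi>) \<otimes>\<^sub>v unit_vec (2 ^ 2) 0))"
    then have r: "r < 4 * 2 ^ n" using V by (simp add: kron_vec_def mult.commute)
    have d: "dim_vec (\<psi> \<otimes>\<^sub>v unit_vec (2 ^ 2) 0) = 4 * 2 ^ n" using \<psi> by (simp add: kron_vec_def)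
    have "(?W *\<^sub>v (\<psi> \<otimes>\<^sub>v unit_vec (2 ^ 2) 0)) $ r = (\<Sum>c<4 * 2 ^ n. ?W $$ (r, c) * (\<psi> \<otimes>\<^sub>v unit_vec (2 ^ 2) 0) $ c)"
      using W r d by (simp add: scalar_prod_def atLeast0LessThan)
    also have "\<dots> = (\<Sum>c<4 * 2 ^ n. ?W $$ (r, c) * add_ancilla (add_ancilla (vec_index \<psi>)) c)"
      using \<psi> k by (intro sum.cong refl) simp
    also have "\<dots> = mat_op ?W (add_ancilla (add_ancilla (vec_index \<psi>))) r"
      using W r by (simp add: mat_op_def)
    also have "\<dots> = cis \<phi> * add_ancilla (add_ancilla (\<lambda>r. \<Sum>c<2 ^ n. V $$ (r, c) * \<psi> $ c)) r"
      using F r gs by simp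
    also have "add_ancilla (add_ancilla (\<lambda>r. \<Sum>c<2 ^ n. V $$ (r, c) * \<psi> $ c)) r = add_ancilla (add_ancilla (vec_index (V *\<^sub>v \<psi>))) r"
      using V \<psi> r by (auto simp: add_ancilla_def scalar_prod_def atLeast0LessThan)
    also have "\<dots> = ((V *\<^sub>v \<psi>) \<otimes>\<^sub>v unit_vec (2 ^ 2) 0) $ r"
      using r V by (intro k[symmetric]) auto
    finally show "(?W *\<^sub>v (\<psi> \<otimes>\<^sub>v unit_vec (2 ^ 2) 0)) $ r = (exp (\<i> * \<phi>) \<cdot>\<^sub>v ((V *\<^sub>v \<psi>) \<otimes>\<^sub>v unit_vec (2 ^ 2) 0)) $ r"
      using r V by (simp add: cis_conv_exp kron_vec_def mult.commute)
  qed
  then have "implements n 2 ?W V" unfolding implements_def by blast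
  then show ?thesis using gs unfolding realizable_with_def by blast
qed

section \<open>Embedded gates in terms of bit positions\<close>

lemma qubit_bit_eq: "qubit_bit N i j = of_bool (bit i (N - 1 - j))"
  by (simp add: qubit_bit_def bit_iff_odd mod_2_eq_odd)

lemma sub_index_1: "sub_index N [j] i = of_bool (bit i (N - 1 - j))"
  by (simp add: sub_index_def qubit_bit_eq)

lemma sub_index_2: "sub_index N [j, k] i = 2 * of_bool (bit i (N - 1 - j)) + of_bool (bit i (N - 1 - k))"
  by (simp add: sub_index_def qubit_bit_eq)

lemma other_bits_equal:
  assumes "\<forall>l<N. l \<notin> set qs \<longrightarrow> qubit_bit N r l = qubit_bit N c l" "r < 2 ^ N" "c < 2 ^ N"
    "i \<notin> (\<lambda>j. N - 1 - j) ` set qs"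
  shows "bit r i = bit c i"
proof (cases "i < N")
  case True
  then have "N - 1 - i < N" "N - 1 - (N - 1 - i) = i" by auto
  moreover have "N - 1 - i \<notin> set qs" using assms(4) calculation(2) by (metis image_eqI)
  ultimately show ?thesis using assms(1)[rule_format, of "N - 1 - i"] by (simp add: qubit_bit_eq of_bool_eq_iff)
qed (use assms in \<open>auto simp: less_exp_bit\<close>)

lemma mat_op_on_qubit:
  assumes "j < N" and g: "g $$ (0, 1) = 0" "g $$ (1, 0) = 0"
  shows "mat_op (on_qubits N [j] g) f r =
    (if r < 2 ^ N then (if bit r (N - 1 - j) then g $$ (1, 1) else g $$ (0, 0)) * f r else f r)"
proof (cases "r < 2 ^ N")
  case True
  let ?e = "\<lambda>c. (if \<forall>l<N. l \<notin> set [j] \<longrightarrow> qubit_bit N r l = qubit_bit N c l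
     then g $$ (sub_index N [j] r, sub_index N [j] c) else 0) * f c"
  have "mat_op (on_qubits N [j] g) f r = (\<Sum>c<2 ^ N. ?e c)"
    using True by (simp add: mat_op_def on_qubits_def)
  also have "\<dots> = (\<Sum>c\<in>{r}. ?e c)"
  proof (rule sum.mono_neutral_right)
    show "\<forall>c\<in>{..<2 ^ N} - {r}. ?e c = 0"
    proof
      fix c assume c: "c \<in> {..<2 ^ N} - {r}"
      show "?e c = 0"
      proof (cases "\<forall>l<N. l \<notin> set [j] \<longrightarrow> qubit_bit N r l = qubit_bit N c l")
        case t: True
        have "bit r i = bit c i" if "i \<noteq> N - 1 - j" for i
          using other_bits_equal[OF t True] c that by auto
        moreover have "r \<noteq> c" using c by auto
        ultimately have "bit r (N - 1 - j) \<noteq> bit c (N - 1 - j)" by (metis bit_eqI)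
        then show ?thesis using g by (auto simp: sub_index_1)
      next
        case False
        then show ?thesis by (simp only: if_False mult_zero_left)
      qed
    qed
  qed (use True in auto)
  finally show ?thesis using True by (auto simp: sub_index_1)
qed (simp add: mat_op_def on_qubits_def)

text \<open>The phases \<open>x\<close>, \<open>u\<close>, \<open>y\<close> belong to \<open>|00\<rangle>\<close>, to the span of \<open>|01\<rangle>\<close>, \<open>|10\<rangle>\<close>, and to \<open>|11\<rangle>\<close>.\<close>

definition phased_exchange :: "nat \<Rightarrow> nat \<Rightarrow> nat \<Rightarrow> complex \<Rightarrow> complex \<Rightarrow> complex \<Rightarrow> complex \<times> complex
    \<Rightarrow> (nat \<Rightarrow> complex) \<Rightarrow> nat \<Rightarrow> complex" where
  "phased_exchange N p q x u y w f r =
    (if r < 2 ^ N then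
       (if bit r p = bit r q then (if bit r p then y else x) * f r
        else u * exchange p q (\<lambda>_. True) w f r)
     else f r)"

lemma phased_exchange_mult:
  assumes "p < N" "q < N" "p \<noteq> q"
  shows "phased_exchange N p q x u y w \<circ> phased_exchange N p q x' u' y' w' = phased_exchange N p q (x * x') (u * u') (y * y') (w \<odot> w')"
  using assms by (auto simp: fun_eq_iff phased_exchange_def exchange_def flip_bits_less bit_flip_bits su2_mult_def algebra_simps)

lemma exchange_phased_exchange: "exchange p q (\<lambda>r. r < 2 ^ N) w = phased_exchange N p q 1 1 1 w"
  by (auto simp: fun_eq_iff phased_exchange_def exchange_def)

text \<open>Serves to show that a column agreeing with the row on exactly one of the two qubits
  meets a zero entry. Indices differing in both bits form {1, 2} or {0, 3}; the latter pair is
  treated where the flipped index is evaluated.\<close>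

lemma one_bit_differs:
  fixes a b c d :: bool
  defines "i \<equiv> 2 * of_bool a + of_bool b :: nat" and "l \<equiv> 2 * of_bool c + of_bool d :: nat"
  shows "i < 4" "l < 4"
    "\<not> (a = c \<and> b = d) \<Longrightarrow> i \<noteq> l"
    "\<not> (a \<noteq> c \<and> b \<noteq> d) \<Longrightarrow> {i, l} \<noteq> {1, 2}"
  unfolding i_def l_def
  by (cases a; cases b; cases c; cases d; simp add: doubleton_eq_iff)+

lemma mat_op_on_qubits:
  assumes jk: "j < N" "k < N" "j \<noteq> k"
    and M: "\<And>i l. i < 4 \<Longrightarrow> l < 4 \<Longrightarrow> i \<noteq> l \<Longrightarrow> {i, l} \<noteq> {1, 2} \<Longrightarrow> M $$ (i, l) = 0"
      "M $$ (0, 0) = x" "M $$ (3, 3) = y"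
      "M $$ (1, 1) = u * a" "M $$ (1, 2) = u * b" "M $$ (2, 1) = - u * cnj b" "M $$ (2, 2) = u * cnj a"
  shows "mat_op (on_qubits N [j, k] M) = phased_exchange N (N - 1 - j) (N - 1 - k) x u y (a, b)"
proof (intro ext)
  fix f r
  let ?p = "N - 1 - j" and ?q = "N - 1 - k"
  have pq: "?p < N" "?q < N" "?p \<noteq> ?q" using jk by auto
  show "mat_op (on_qubits N [j, k] M) f r = phased_exchange N ?p ?q x u y (a, b) f r"
  proof (cases "r < 2 ^ N")
    case True
    define C where "C c \<longleftrightarrow> (\<forall>l<N. l \<notin> set [j, k] \<longrightarrow> qubit_bit N r l = qubit_bit N c l)" for c
    let ?e = "\<lambda>c. (if C c then M $$ (sub_index N [j, k] r, sub_index N [j, k] c) else 0) * f c"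
    let ?r = "flip_bits ?p ?q r"
    have "mat_op (on_qubits N [j, k] M) f r = (\<Sum>c<2 ^ N. ?e c)"
      using True by (simp add: mat_op_def on_qubits_def C_def)
    \<comment> \<open>Row \<open>r\<close> meets only two columns: \<open>c\<close> must agree with
      \<open>r\<close> away from the two qubits, and the entry of \<open>M\<close> vanishes if
      exactly one of the two bits differs.\<close>
    also have "\<dots> = (\<Sum>c\<in>{r, ?r}. ?e c)"
    proof (rule sum.mono_neutral_right)
      show "{r, ?r} \<subseteq> {..<2 ^ N}" using True pq by (auto simp: flip_bits_less)
      show "\<forall>c\<in>{..<2 ^ N} - {r, ?r}. ?e c = 0"
      proof
        fix c assume c: "c \<in> {..<2 ^ N} - {r, ?r}"
        show "?e c = 0"
        proof (cases "C c")
          case t: True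
          have eq: "bit r i = bit c i" if "i \<noteq> ?p" "i \<noteq> ?q" for i
            using other_bits_equal[OF t[unfolded C_def] True] c that by auto
          have "\<not> (bit r ?p = bit c ?p \<and> bit r ?q = bit c ?q)"
          proof
            assume "bit r ?p = bit c ?p \<and> bit r ?q = bit c ?q"
            then have "r = c" using eq by (intro bit_eqI) metis
            then show False using c by simp
          qed
          moreover have "\<not> (bit r ?p \<noteq> bit c ?p \<and> bit r ?q \<noteq> bit c ?q)"
          proof
            assume *: "bit r ?p \<noteq> bit c ?p \<and> bit r ?q \<noteq> bit c ?q"
            have "c = ?r"
            proof (rule bit_eqI)
              fix i show "bit c i = bit ?r i"
                unfolding bit_flip_bits[OF pq(3)] using eq[of i] * by auto
            qed
            then show False using c by simp
          qed
          ultimately have "M $$ (sub_index N [j, k] r, sub_index N [j, k] c) = 0"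
            unfolding sub_index_2
            by (intro M(1) one_bit_differs)
          then show ?thesis by simp
        next
          case False
          then show ?thesis by (simp only: if_False mult_zero_left)
        qed
      qed
    qed simp
    also have "\<dots> = ?e r + ?e ?r" using flip_bits_neq[OF pq(3), of r] by simp
    also have "\<dots> = M $$ (sub_index N [j, k] r, sub_index N [j, k] r) * f r
       + M $$ (sub_index N [j, k] r, sub_index N [j, k] ?r) * f ?r"
    proof -
      have "C ?r"
        unfolding C_def
      proof (intro allI impI)
        fix l assume "l < N" "l \<notin> set [j, k]"
        then have "N - 1 - l \<noteq> ?p" "N - 1 - l \<noteq> ?q" using jk by auto
        then show "qubit_bit N r l = qubit_bit N ?r l" unfolding qubit_bit_eq bit_flip_bits[OF pq(3)] by simp
      qed
      moreover have "C r" by (simp add: C_def)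
      ultimately show ?thesis by simp
    qed
    also have "\<dots> = phased_exchange N ?p ?q x u y (a, b) f r"
    proof -
      have z: "M $$ (0, 3) = 0" "M $$ (3, 0) = 0" using M(1)[of 0 3] M(1)[of 3 0] by (auto simp: doubleton_eq_iff)
      show ?thesis
        unfolding sub_index_2 bit_flip_bits[OF pq(3)] phased_exchange_def exchange_def
        using True M(2-) z pq by (cases "bit r ?p"; cases "bit r ?q") (simp_all add: algebra_simps numeral_2_eq_2 numeral_3_eq_3)
    qed
    finally show ?thesis .
  next
    case False
    then show ?thesis by (simp add: mat_op_def on_qubits_def phased_exchange_def)
  qed
qed

section \<open>Exponential of an energy-conserving two-qubit Hamiltonian\<close>

lemma exp_combination_suminf:
  fixes a b x y :: complex
  shows "(\<Sum>k. (ca * a ^ k + cb * b ^ k + cx * x ^ k + cy * y ^ k) / fact k)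
    = ca * exp a + cb * exp b + cx * exp x + cy * exp y"
proof -
  have e: "(\<lambda>k. z ^ k / fact k) sums exp z" for z :: complex
    using exp_converges[of z] by (simp add: scaleR_conv_of_real field_simps)
  have "(\<lambda>k. ca * (a ^ k / fact k) + cb * (b ^ k / fact k) + cx * (x ^ k / fact k) + cy * (y ^ k / fact k))
    sums (ca * exp a + cb * exp b + cx * exp x + cy * exp y)"
    by (intro sums_add sums_mult e)
  then show ?thesis by (simp add: add_divide_distrib sums_iff)
qed

text \<open>For z^2 + |\<nu>|^2 = 1 this is the first row of exp(i t N) = cos t + i N sin t with N =
  [[z, \<nu>], [cnj \<nu>, - z]], a rotation about an arbitrary axis.\<close>

definition axis_rotation :: "real \<Rightarrow> complex \<Rightarrow> real \<Rightarrow> complex \<times> complex" where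
  "axis_rotation z \<nu> t =
    (complex_of_real (cos t) + \<i> * z * complex_of_real (sin t), \<i> * \<nu> * complex_of_real (sin t))"

text \<open>Spectral decomposition of the two-dimensional block: its eigenvalues are \<open>t + s\<close> and \<open>t - s\<close>,
  with projections \<open>(1 \<plusminus> N) / 2\<close> where \<open>N = [[z, \<nu>], [cnj \<nu>, - z]]\<close> is an involution.\<close>

lemma mat_exp_block:
  fixes z t s h0 h3 \<alpha> :: real and \<nu> :: complex
  assumes H: "H \<in> carrier_mat 4 4"
    and block: "\<And>i l. i < 4 \<Longrightarrow> l < 4 \<Longrightarrow> i \<noteq> l \<Longrightarrow> {i, l} \<noteq> {1, 2} \<Longrightarrow> H $$ (i, l) = 0"
    and e: "H $$ (0, 0) = h0" "H $$ (3, 3) = h3" "H $$ (1, 1) = t + s * z" "H $$ (2, 2) = t - s * z"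
      "H $$ (1, 2) = s * \<nu>" "H $$ (2, 1) = s * cnj \<nu>"
    and n: "complex_of_real z ^ 2 + \<nu> * cnj \<nu> = 1"
    and jk: "j < N" "k < N" "j \<noteq> k"
  shows "mat_op (on_qubits N [j, k] (mat_exp ((\<i> * complex_of_real \<alpha>) \<cdot>\<^sub>m H)))
    = phased_exchange N (N - 1 - j) (N - 1 - k) (cis (\<alpha> * h0)) (cis (\<alpha> * t)) (cis (\<alpha> * h3)) (axis_rotation z \<nu> (\<alpha> * s))"
proof -
  let ?A = "(\<i> * complex_of_real \<alpha>) \<cdot>\<^sub>m H"
  define x where "x = \<i> * complex_of_real \<alpha> * (t + s)"
  define y where "y = \<i> * complex_of_real \<alpha> * (t - s)"
  define a where "a = \<i> * complex_of_real \<alpha> * h0"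
  define b where "b = \<i> * complex_of_real \<alpha> * h3"
  \<comment> \<open>Functional calculus: the four arguments are the values taken on the eigenspaces
    of \<open>H\<close>. \<open>E\<close> is multiplicative because the spectral projections are
    orthogonal, so powers and then the exponential series are computed on eigenvalues.\<close>
  define E where "E = (\<lambda>(f0::complex, f3::complex, fx::complex, fy::complex). mat 4 4 (\<lambda>(i, l).
     if i = 0 \<and> l = 0 then f0 else if i = 3 \<and> l = 3 then f3
     else if i = 1 \<and> l = 1 then (1 + z) / 2 * fx + (1 - z) / 2 * fy
     else if i = 2 \<and> l = 2 then (1 - z) / 2 * fx + (1 + z) / 2 * fy
     else if i = 1 \<and> l = 2 then \<nu> / 2 * fx + (- \<nu> / 2) * fy
     else if i = 2 \<and> l = 1 then cnj \<nu> / 2 * fx + (- cnj \<nu> / 2) * fy else 0))"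
  have E_mult: "E (f0, f3, fx, fy) * E (g0, g3, gx, gy) = E (f0 * g0, f3 * g3, fx * gx, fy * gy)"
    for f0 f3 fx fy g0 g3 gx gy
  proof (rule eq_matI)
    have n': "complex_of_real z * z = 1 - \<nu> * cnj \<nu>" using n by (simp add: power2_eq_square eq_diff_eq)
    have n'': "complex_of_real z * (complex_of_real z * w) = (1 - \<nu> * cnj \<nu>) * w" for w :: complex
      unfolding n'[symmetric] by (rule mult.assoc[symmetric])
    fix i l assume "i < dim_row (E (f0 * g0, f3 * g3, fx * gx, fy * gy))" "l < dim_col (E (f0 * g0, f3 * g3, fx * gx, fy * gy))"
    then have il: "i < 4" "l < 4" by (simp_all add: E_def)
    then have "(E (f0, f3, fx, fy) * E (g0, g3, gx, gy)) $$ (i, l)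
      = (\<Sum>m<4. E (f0, f3, fx, fy) $$ (i, m) * E (g0, g3, gx, gy) $$ (m, l))"
      by (simp add: E_def scalar_prod_def atLeast0LessThan)
    also have "\<dots> = E (f0 * g0, f3 * g3, fx * gx, fy * gy) $$ (i, l)"
      using il unfolding less_4_cases
      by (elim disjE) (simp_all add: E_def lessThan_nat_numeral field_simps n' n'' numeral_eq_Suc lessThan_Suc)
    finally show "(E (f0, f3, fx, fy) * E (g0, g3, gx, gy)) $$ (i, l) = E (f0 * g0, f3 * g3, fx * gx, fy * gy) $$ (i, l)" .
  qed (simp_all add: E_def)
  have E1: "1\<^sub>m 4 = E (1, 1, 1, 1)"
    by (rule eq_matI) (auto simp: E_def less_4_cases field_simps)
  have EA: "?A = E (a, b, x, y)"
  proof (rule eq_matI)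
    fix i l assume "i < dim_row (E (a, b, x, y))" "l < dim_col (E (a, b, x, y))"
    then have il: "i < 4" "l < 4" by (simp_all add: E_def)
    show "?A $$ (i, l) = E (a, b, x, y) $$ (i, l)"
    proof (cases "i \<noteq> l \<and> {i, l} \<noteq> {1, 2}")
      case True
      then have "H $$ (i, l) = 0" using block il by blast
      then show ?thesis using True il H by (auto simp: E_def doubleton_eq_iff)
    next
      case False
      then have "(i, l) \<in> {(0, 0), (1, 1), (2, 2), (3, 3), (1, 2), (2, 1)}"
        using il by (auto simp: less_4_cases doubleton_eq_iff)
      then show ?thesis using H
        by (auto simp: e e[simplified] E_def a_def b_def x_def y_def field_simps)
    qed
  qed (use H in \<open>simp_all add: E_def\<close>)
  have pow: "?A ^\<^sub>m k = E (a ^ k, b ^ k, x ^ k, y ^ k)" for k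
  proof (induction k)
    case 0
    then show ?case using H E1 by simp
  next
    case (Suc k)
    then show ?case by (simp add: EA E_mult mult.commute)
  qed
  have ex: "mat_exp ?A $$ (i, l) = E (exp a, exp b, exp x, exp y) $$ (i, l)" if "i < 4" "l < 4" for i l
  proof -
    have d: "dim_row ?A = 4" using H by simp
    have "mat_exp ?A $$ (i, l) = (\<Sum>k. E (a ^ k, b ^ k, x ^ k, y ^ k) $$ (i, l) / fact k)"
      unfolding mat_exp_def d pow using that by simp
    also have "\<dots> = E (exp a, exp b, exp x, exp y) $$ (i, l)"
    proof -
      have lin: "E (f0, f3, fx, fy) $$ (i, l) = E (1, 0, 0, 0) $$ (i, l) * f0 + E (0, 1, 0, 0) $$ (i, l) * f3
        + E (0, 0, 1, 0) $$ (i, l) * fx + E (0, 0, 0, 1) $$ (i, l) * fy" for f0 f3 fx fy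
        using that by (auto simp: E_def)
      show ?thesis by (subst (1 2) lin) (rule exp_combination_suminf)
    qed
    finally show ?thesis .
  qed
  \<comment> \<open>Splitting off the phase of the mean eigenvalue leaves a block of determinant
    1.\<close>
  define u where "u = cis (\<alpha> * t)"
  have xy: "exp x = u * cis (\<alpha> * s)" "exp y = u * cis (- (\<alpha> * s))"
    by (simp_all add: x_def y_def u_def cis_conv_exp exp_add[symmetric] algebra_simps)
  have ab: "exp a = cis (\<alpha> * h0)" "exp b = cis (\<alpha> * h3)"
    by (simp_all add: a_def b_def cis_conv_exp algebra_simps)
  have cs: "cis (\<alpha> * s) = cos (\<alpha> * s) + \<i> * sin (\<alpha> * s)" "cis (- (\<alpha> * s)) = cos (\<alpha> * s) - \<i> * sin (\<alpha> * s)"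
    by (simp_all add: complex_eq_iff)
  have off: "mat_exp ?A $$ (i, l) = 0" if "i < 4" "l < 4" "i \<noteq> l" "{i, l} \<noteq> {1, 2}" for i l
    using that by (subst ex) (auto simp: E_def doubleton_eq_iff)
  show ?thesis
    unfolding axis_rotation_def u_def[symmetric]
    by (rule mat_op_on_qubits[OF jk], erule (3) off)
      (subst ex; simp add: E_def xy cs ab field_simps)+
qed

section \<open>Energy-conserving matrices and the gate count\<close>

lemma mat_adjoint_index:
  "i < dim_col A \<Longrightarrow> j < dim_row A \<Longrightarrow> mat_adjoint A $$ (i, j) = cnj (A $$ (j, i))"
  unfolding mat_adjoint_def by (simp add: mat_of_rows_def)

lemma mat_adjoint_carrier: "A \<in> carrier_mat n m \<Longrightarrow> mat_adjoint A \<in> carrier_mat m n"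
  unfolding mat_adjoint_def by auto

lemma on_qubits_pauli_Z:
  assumes "j < n" "r < 2 ^ n" "c < 2 ^ n"
  shows "on_qubits n [j] pauli_Z $$ (r, c) = (if r = c then if bit r (n - 1 - j) then -1 else 1 else 0)"
proof (cases "r = c")
  case True
  then show ?thesis using assms by (simp add: on_qubits_def sub_index_1 pauli_Z_def mat_of_rows_list_def)
next
  case False
  have "pauli_Z $$ (sub_index n [j] r, sub_index n [j] c) = 0"
    if t: "\<forall>l<n. l \<notin> set [j] \<longrightarrow> qubit_bit n r l = qubit_bit n c l"
  proof -
    have "bit r i = bit c i" if "i \<noteq> n - 1 - j" for i
      using other_bits_equal[OF t assms(2,3)] that by auto
    then have "bit r (n - 1 - j) \<noteq> bit c (n - 1 - j)" using False by (metis bit_eqI)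
    then show ?thesis by (auto simp: sub_index_1 pauli_Z_def mat_of_rows_list_def)
  qed
  then show ?thesis using False assms by (simp add: on_qubits_def)
qed

text \<open>Clear bits contribute 1 and set bits -1. The reversal between qubit numbers and bit
  positions disappears on reindexing the sum.\<close>

lemma total_Z_index:
  assumes "r < 2 ^ n" "c < 2 ^ n"
  shows "total_Z n $$ (r, c) = (if r = c then of_nat n - 2 * of_nat (hamming_weight r) else 0)"
proof -
  let ?F = "\<lambda>j. on_qubits n [j] pauli_Z"
  have dim: "foldr (+) (map ?F js) (0\<^sub>m (2 ^ n) (2 ^ n)) \<in> carrier_mat (2 ^ n) (2 ^ n)" for js
    by (induction js) (auto simp: on_qubits_def)
  have "foldr (+) (map ?F js) (0\<^sub>m (2 ^ n) (2 ^ n)) $$ (r, c) = (\<Sum>j\<leftarrow>js. ?F j $$ (r, c))" for js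
  proof (induction js)
    case (Cons j js)
    then show ?case using assms dim[of js] by (simp add: carrier_matD)
  qed (use assms in simp)
  then have "total_Z n $$ (r, c) = (\<Sum>j\<leftarrow>[0..<n]. ?F j $$ (r, c))" by (simp add: total_Z_def)
  also have "\<dots> = (\<Sum>j<n. ?F j $$ (r, c))"
    by (simp add: interv_sum_list_conv_sum_set_nat atLeast0LessThan)
  also have "\<dots> = (\<Sum>j<n. if r = c then if bit r (n - Suc j) then -1 else 1 else 0)"
    using assms on_qubits_pauli_Z by (intro sum.cong) auto
  also have "\<dots> = (if r = c then \<Sum>j<n. if bit r (n - Suc j) then -1 else 1 else 0)" by simp
  also have "(\<Sum>j<n. if bit r (n - Suc j) then -1 else 1 :: complex) = (\<Sum>j<n. if bit r j then -1 else 1)"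
    by (rule sum.nat_diff_reindex)
  also have "(\<Sum>j<n. if bit r j then -1 else 1 :: complex) = of_nat n - 2 * of_nat (hamming_weight r)"
  proof -
    have "{j \<in> {..<n}. bit r j} = {i. bit r i}" using assms(1) by (auto simp: less_exp_bit) (meson not_less)
    then have "(\<Sum>j<n. if bit r j then 1 else 0 :: complex) = of_nat (hamming_weight r)"
      by (simp add: sum.If_cases hamming_weight_def Int_def)
    moreover have "(\<Sum>j<n. if bit r j then -1 else 1 :: complex) = (\<Sum>j<n. 1 - 2 * (if bit r j then 1 else 0))"
      by (intro sum.cong) auto
    ultimately show ?thesis by (simp add: sum_subtractf sum_distrib_left[symmetric])
  qed
  finally show ?thesis .
qed

lemma total_Z_carrier: "total_Z n \<in> carrier_mat (2 ^ n) (2 ^ n)"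
proof -
  have "foldr (+) (map (\<lambda>j. on_qubits n [j] pauli_Z) js) (0\<^sub>m (2 ^ n) (2 ^ n)) \<in> carrier_mat (2 ^ n) (2 ^ n)" for js
    by (induction js) (auto simp: on_qubits_def)
  then show ?thesis by (simp add: total_Z_def)
qed

text \<open>Commuting with a diagonal matrix annihilates all entries between distinct eigenvalues,
  and n - 2 w determines the weight w.\<close>

lemma energy_conserving_entries:
  assumes V: "V \<in> carrier_mat (2 ^ n) (2 ^ n)" "energy_conserving n V"
    and rc: "r < 2 ^ n" "c < 2 ^ n" "hamming_weight r \<noteq> hamming_weight c"
  shows "V $$ (r, c) = 0"
proof -
  let ?Z = "total_Z n" and ?z = "\<lambda>r. of_nat n - 2 * of_nat (hamming_weight r) :: complex"
  note Z = total_Z_carrier[of n]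
  have "(V * ?Z - ?Z * V) $$ (r, c) = 0"
    using V(2) rc by (simp add: energy_conserving_def commutator_def)
  then have "(\<Sum>k<2 ^ n. V $$ (r, k) * ?Z $$ (k, c)) - (\<Sum>k<2 ^ n. ?Z $$ (r, k) * V $$ (k, c)) = 0"
    using V Z rc by (simp add: scalar_prod_def atLeast0LessThan)
  moreover have "(\<Sum>k<2 ^ n. V $$ (r, k) * ?Z $$ (k, c)) = (\<Sum>k<2 ^ n. if k = c then V $$ (r, c) * ?z c else 0)"
    using rc by (intro sum.cong) (auto simp: total_Z_index)
  moreover have "(\<Sum>k<2 ^ n. ?Z $$ (r, k) * V $$ (k, c)) = (\<Sum>k<2 ^ n. if k = r then ?z r * V $$ (r, c) else 0)"
    using rc by (intro sum.cong) (auto simp: total_Z_index)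
  ultimately have "V $$ (r, c) * (?z c - ?z r) = 0" using rc by (simp add: algebra_simps)
  moreover have "?z c - ?z r \<noteq> 0" using rc(3) by simp
  ultimately show ?thesis by simp
qed

lemma unitary_mat_synthesis:
  assumes V: "V \<in> carrier_mat (2 ^ n) (2 ^ n)" "unitary_mat V" "energy_conserving n V"
  shows "\<exists>F \<in> words (su2_gates (Suc n)) (104 * (Suc n) ^ 2 * (((2 * n) choose n) + 2 ^ n)). \<exists>\<phi>::real.
    \<forall>\<psi>. \<forall>r<2 ^ Suc n. F (add_ancilla \<psi>) r = cis \<phi> * add_ancilla (\<lambda>r. \<Sum>c<2 ^ n. V $$ (r, c) * \<psi> c) r"
proof (rule functional_synthesis)
  note A = mat_adjoint_carrier[OF V(1)]
  have d: "dim_row V = 2 ^ n" "dim_col V = 2 ^ n" using V by auto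
  have 1: "V * mat_adjoint V = 1\<^sub>m (2 ^ n)" "mat_adjoint V * V = 1\<^sub>m (2 ^ n)"
    using V by (auto simp: unitary_mat_def)
  fix c c' :: nat assume c: "c < 2 ^ n" "c' < 2 ^ n"
  have "(V * mat_adjoint V) $$ (c, c') = (\<Sum>r<2 ^ n. V $$ (c, r) * cnj (V $$ (c', r)))"
    using V A c by (auto simp: scalar_prod_def atLeast0LessThan mat_adjoint_index d intro!: sum.cong)
  then show "(\<Sum>r<2 ^ n. V $$ (c, r) * cnj (V $$ (c', r))) = (if c = c' then 1 else 0)"
    using c by (simp add: 1)
  have "(mat_adjoint V * V) $$ (c, c') = (\<Sum>r<2 ^ n. cnj (V $$ (r, c)) * V $$ (r, c'))"
    using V A c by (auto simp: scalar_prod_def atLeast0LessThan mat_adjoint_index d intro!: sum.cong)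
  then show "(\<Sum>r<2 ^ n. cnj (V $$ (r, c)) * V $$ (r, c')) = (if c = c' then 1 else 0)"
    using c by (simp add: 1)
  show "hamming_weight c' \<noteq> hamming_weight c \<Longrightarrow> V $$ (c, c') = 0"
    using energy_conserving_entries[OF V(1,3) c] by metis
qed

text \<open>The factor 2 n + 1 makes the induction close: passing to n + 1 multiplies the
  coefficient by 2 (2 n + 1) / (n + 1), and (2 n + 3) (2 n + 1) is below (2 n + 2)^2. This gives the
  bound 4^n / sqrt n without Stirling's formula.\<close>

lemma central_binomial_bound: "(2 * n + 1) * ((2 * n) choose n) ^ 2 \<le> 16 ^ n"
proof (induction n)
  case (Suc n)
  let ?c = "(2 * n) choose n" and ?c' = "(2 * Suc n) choose Suc n"
  have e: "(n + 1) * ?c' = 2 * (2 * n + 1) * ?c"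
  proof -
    have "Suc n * ((2 * n + 2) choose Suc n) = (2 * n + 2) * ((2 * n + 1) choose n)"
      using Suc_times_binomial_eq[of "2 * n + 1" n] by (simp add: mult.commute)
    moreover have "Suc n * ((2 * n + 1) choose Suc n) = (2 * n + 1) * ?c"
      using Suc_times_binomial_eq[of "2 * n" n] by (simp add: mult.commute)
    moreover have "(2 * n + 1) choose n = (2 * n + 1) choose Suc n"
      using binomial_symmetric[of n "2 * n + 1"] by simp
    ultimately have "Suc n * (Suc n * ((2 * n + 2) choose Suc n)) = (2 * n + 2) * ((2 * n + 1) * ?c)"
      by (metis mult.left_commute)
    also have "\<dots> = Suc n * (2 * (2 * n + 1) * ?c)" by (simp add: algebra_simps)
    finally have "Suc n * ((2 * n + 2) choose Suc n) = 2 * (2 * n + 1) * ?c"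
      by (simp only: mult_cancel1 nat.distinct simp_thms)
    then show ?thesis by (simp del: binomial_Suc_Suc mult_Suc)
  qed
  have "(n + 1) ^ 2 * ((2 * Suc n + 1) * x ^ 2) = (2 * n + 3) * ((n + 1) * x) ^ 2" for x
    by (simp add: power2_eq_square algebra_simps)
  then have "(n + 1) ^ 2 * ((2 * Suc n + 1) * ?c' ^ 2) = (2 * n + 3) * ((n + 1) * ?c') ^ 2" .
  also have "\<dots> = ((2 * n + 3) * (2 * n + 1)) * (4 * ((2 * n + 1) * ?c ^ 2))"
    unfolding e by (simp add: power_mult_distrib power2_eq_square algebra_simps del: binomial_Suc_Suc)
  also have "\<dots> \<le> (4 * (n + 1) ^ 2) * (4 * 16 ^ n)"
  proof (rule mult_le_mono)
    show "(2 * n + 3) * (2 * n + 1) \<le> 4 * (n + 1) ^ 2" by (simp add: power2_eq_square algebra_simps)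
    show "4 * ((2 * n + 1) * ?c ^ 2) \<le> 4 * 16 ^ n" using Suc by (rule mult_le_mono2)
  qed
  also have "\<dots> = (n + 1) ^ 2 * 16 ^ Suc n" by simp
  finally show ?case by (subst (asm) mult_le_cancel1) simp
qed simp

text \<open>832 = 104 * 4 * 2: the 4 bounds (n + 1)^2 by 4 n^2, and the 2 arises because both
  summands, the central binomial coefficient and 2^n, are at most 4^n / sqrt n.\<close>

lemma gate_count_bound:
  assumes "1 \<le> n"
  shows "real (M * (104 * (Suc n) ^ 2 * (((2 * n) choose n) + 2 ^ n))) \<le> 832 * real M * 4 ^ n * real n powr (3 / 2)"
proof -
  have n: "0 < real n" using assms by simp
  let ?c = "real ((2 * n) choose n)"
  have "real ((2 * n + 1) * ((2 * n) choose n) ^ 2) \<le> real (16 ^ n)"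
    using central_binomial_bound by (rule of_nat_mono)
  moreover have "real n * ?c ^ 2 \<le> real ((2 * n + 1) * ((2 * n) choose n) ^ 2)"
    by (simp add: mult_right_mono)
  moreover have "real (16 ^ n) = (4 ^ n) ^ 2" by (simp add: power2_eq_square flip: power_mult_distrib)
  ultimately have "real n * ?c ^ 2 \<le> (4 ^ n) ^ 2" by linarith
  then have "(sqrt n * ?c) ^ 2 \<le> (4 ^ n) ^ 2" using n by (simp add: power_mult_distrib)
  then have c: "sqrt n * ?c \<le> 4 ^ n" by (rule power2_le_imp_le) simp
  have "real n \<le> 2 ^ n" using less_exp[of n] by (metis less_imp_le of_nat_le_iff of_nat_numeral of_nat_power)
  moreover have "sqrt n \<le> real n" using assms by (intro real_le_lsqrt) (auto simp: power2_eq_square)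
  ultimately have "sqrt n \<le> 2 ^ n" by linarith
  then have "sqrt n * 2 ^ n \<le> 2 ^ n * 2 ^ n" by (intro mult_right_mono) auto
  also have "\<dots> = (4::real) ^ n" by (simp flip: power_mult_distrib)
  finally have d: "sqrt n * (?c + 2 ^ n) \<le> 2 * 4 ^ n" using c by (simp add: distrib_left)
  have p: "real n powr (3 / 2) = real n * sqrt n"
    using n powr_add[of "real n" 1 "1 / 2"] by (simp add: powr_half_sqrt)
  have "(real n + 1) ^ 2 \<le> (2 * real n) ^ 2" using assms by (intro power_mono) auto
  then have s: "(1 + real n) ^ 2 \<le> 4 * real n ^ 2" by (simp add: power_mult_distrib add.commute)
  have "(1 + real n) ^ 2 * (?c + 2 ^ n) \<le> (4 * real n ^ 2) * (?c + 2 ^ n)"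
    using s by (intro mult_right_mono) auto
  also have "\<dots> = 4 * real n * sqrt n * (sqrt n * (?c + 2 ^ n))"
    using n by (simp add: power2_eq_square mult_ac)
  also have "\<dots> \<le> 4 * real n * sqrt n * (2 * 4 ^ n)" using d n by (intro mult_left_mono) auto
  finally have "104 * real M * ((1 + real n) ^ 2 * (?c + 2 ^ n)) \<le> 104 * real M * (4 * real n * sqrt n * (2 * 4 ^ n))"
    by (intro mult_left_mono) auto
  then show ?thesis unfolding p by (simp add: mult_ac add.commute)
qed

text \<open>\<open>M\<close> is the same for every \<open>N\<close>, since it becomes part of the
  constant, which is chosen before \<open>n\<close>.\<close>

lemma realizable_from_su2_gates:
  assumes M: "\<And>N. su2_gates N \<subseteq> words (mat_op ` gate_ops N G1 G2) M"
  shows "\<exists>C::real. \<forall>n \<ge> 1. \<forall>V \<in> carrier_mat (2 ^ n) (2 ^ n).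
    unitary_mat V \<and> energy_conserving n V \<longrightarrow>
    (\<exists>m. realizable_with n 1 G1 G2 V m \<and> real m \<le> C * 4 ^ n * real n powr (3 / 2))"
proof (intro exI[of _ "832 * real M"] allI impI ballI)
  fix n V assume n: "1 \<le> (n::nat)" and V: "V \<in> carrier_mat (2 ^ n) (2 ^ n)" and uV: "unitary_mat V \<and> energy_conserving n V"
  obtain F \<phi> where F: "F \<in> words (su2_gates (Suc n)) (104 * (Suc n) ^ 2 * (((2 * n) choose n) + 2 ^ n))"
    and F\<phi>: "\<forall>\<psi>. \<forall>r<2 ^ Suc n. F (add_ancilla \<psi>) r = cis \<phi> * add_ancilla (\<lambda>r. \<Sum>c<2 ^ n. V $$ (r, c) * \<psi> c) r"
    using unitary_mat_synthesis[OF V] uV by blast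
  have "F \<in> words (mat_op ` gate_ops (n + 1) G1 G2) (M * (104 * (Suc n) ^ 2 * (((2 * n) choose n) + 2 ^ n)))"
    using M[of "n + 1"] by (intro words_subst[OF F]) auto
  then obtain m where m: "m \<le> M * (104 * (Suc n) ^ 2 * (((2 * n) choose n) + 2 ^ n))" "realizable_with n 1 G1 G2 V m"
    using realizable_one[OF _ V] F\<phi> by blast
  have "real m \<le> real (M * (104 * (Suc n) ^ 2 * (((2 * n) choose n) + 2 ^ n)))" using m(1) by (rule of_nat_mono)
  also have "\<dots> \<le> 832 * real M * 4 ^ n * real n powr (3 / 2)" by (rule gate_count_bound[OF n])
  finally show "\<exists>m. realizable_with n 1 G1 G2 V m \<and> real m \<le> 832 * real M * 4 ^ n * real n powr (3 / 2)"
    using m by blast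
qed

text \<open>For gates that are exact only while one further qubit is in |0>. The inner ancilla
  serves the phase correction; the outer one, at the lowest bit, is the helper.\<close>

lemma realizable_with_helper:
  assumes M: "\<And>N g. g \<in> su2_gates N \<Longrightarrow> \<exists>g' \<in> words (mat_op ` gate_ops (Suc N) G1 G2) M. \<forall>\<psi>. g' (add_ancilla \<psi>) = add_ancilla (g \<psi>)"
  shows "\<exists>C::real. \<forall>n \<ge> 1. \<forall>V \<in> carrier_mat (2 ^ n) (2 ^ n).
    unitary_mat V \<and> energy_conserving n V \<longrightarrow>
    (\<exists>m. realizable_with n 2 G1 G2 V m \<and> real m \<le> C * 4 ^ n * real n powr (3 / 2))"
proof (intro exI[of _ "832 * real M"] allI impI ballI)
  fix n V assume n: "1 \<le> (n::nat)" and V: "V \<in> carrier_mat (2 ^ n) (2 ^ n)" and uV: "unitary_mat V \<and> energy_conserving n V"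
  obtain F \<phi> where F: "F \<in> words (su2_gates (Suc n)) (104 * (Suc n) ^ 2 * (((2 * n) choose n) + 2 ^ n))"
    and F\<phi>: "\<forall>\<psi>. \<forall>r<2 ^ Suc n. F (add_ancilla \<psi>) r = cis \<phi> * add_ancilla (\<lambda>r. \<Sum>c<2 ^ n. V $$ (r, c) * \<psi> c) r"
    using unitary_mat_synthesis[OF V] uV by blast
  have "\<exists>F' \<in> words (mat_op ` gate_ops (Suc (Suc n)) G1 G2) (M * (104 * (Suc n) ^ 2 * (((2 * n) choose n) + 2 ^ n))).
      \<forall>\<psi>. F' (add_ancilla \<psi>) = add_ancilla (F \<psi>)"
    using M by (intro words_simulate[OF F])
  then obtain F' where F': "F' \<in> words (mat_op ` gate_ops (n + 2) G1 G2) (M * (104 * (Suc n) ^ 2 * (((2 * n) choose n) + 2 ^ n)))"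
    "\<And>\<psi>. F' (add_ancilla \<psi>) = add_ancilla (F \<psi>)" by auto
  have "F' (add_ancilla (add_ancilla \<psi>)) r = cis \<phi> * add_ancilla (add_ancilla (\<lambda>r. \<Sum>c<2 ^ n. V $$ (r, c) * \<psi> c)) r" if "r < 2 ^ (n + 2)" for \<psi> r
  proof -
    have "r div 2 < 2 ^ Suc n" using that by (simp add: less_mult_imp_div_less mult.commute)
    then have "F (add_ancilla \<psi>) (r div 2) = cis \<phi> * add_ancilla (\<lambda>r. \<Sum>c<2 ^ n. V $$ (r, c) * \<psi> c) (r div 2)" using F\<phi> by blast
    then show ?thesis unfolding F'(2) by (simp add: add_ancilla_def[of "F (add_ancilla \<psi>)"] add_ancilla_def[of "add_ancilla _"])
  qed
  then obtain m where m: "m \<le> M * (104 * (Suc n) ^ 2 * (((2 * n) choose n) + 2 ^ n))" "realizable_with n 2 G1 G2 V m"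
    using realizable_two[OF F'(1) V] by blast
  have "real m \<le> real (M * (104 * (Suc n) ^ 2 * (((2 * n) choose n) + 2 ^ n)))" using m(1) by (rule of_nat_mono)
  also have "\<dots> \<le> 832 * real M * 4 ^ n * real n powr (3 / 2)" by (rule gate_count_bound[OF n])
  finally show "\<exists>m. realizable_with n 2 G1 G2 V m \<and> real m \<le> 832 * real M * 4 ^ n * real n powr (3 / 2)"
    using m by blast
qed

section \<open>Gates of the three gate sets\<close>

lemma gate1_word:
  assumes "p < N" "g \<in> G1"
  shows "mat_op (on_qubits N [N - 1 - p] g) \<in> words (mat_op ` gate_ops N G1 G2) 1"
proof (rule words_gen)
  have "N - 1 - p < N" using assms by simp
  then show "mat_op (on_qubits N [N - 1 - p] g) \<in> mat_op ` gate_ops N G1 G2"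
    using assms unfolding gate_ops_def by blast
qed simp

lemma gate2_word:
  assumes "p < N" "q < N" "p \<noteq> q" "g \<in> G2"
  shows "mat_op (on_qubits N [N - 1 - p, N - 1 - q] g) \<in> words (mat_op ` gate_ops N G1 G2) 1"
proof (rule words_gen)
  have "N - 1 - p < N" "N - 1 - q < N" "N - 1 - p \<noteq> N - 1 - q" using assms by auto
  then show "mat_op (on_qubits N [N - 1 - p, N - 1 - q] g) \<in> mat_op ` gate_ops N G1 G2"
    using assms unfolding gate_ops_def by blast
qed simp

lemma block_gate_word:
  fixes z t s h0 h3 \<alpha> :: real and \<nu> :: complex
  assumes H: "H \<in> carrier_mat 4 4"
    and block: "\<And>i l. i < 4 \<Longrightarrow> l < 4 \<Longrightarrow> i \<noteq> l \<Longrightarrow> {i, l} \<noteq> {1, 2} \<Longrightarrow> H $$ (i, l) = 0"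
    and e: "H $$ (0, 0) = h0" "H $$ (3, 3) = h3" "H $$ (1, 1) = t + s * z" "H $$ (2, 2) = t - s * z"
      "H $$ (1, 2) = s * \<nu>" "H $$ (2, 1) = s * cnj \<nu>"
    and n: "complex_of_real z ^ 2 + \<nu> * cnj \<nu> = 1"
    and pq: "p < N" "q < N" "p \<noteq> q"
    and G: "mat_exp ((\<i> * complex_of_real \<alpha>) \<cdot>\<^sub>m H) \<in> G2"
  shows "phased_exchange N p q (cis (\<alpha> * h0)) (cis (\<alpha> * t)) (cis (\<alpha> * h3)) (axis_rotation z \<nu> (\<alpha> * s))
    \<in> words (mat_op ` gate_ops N G1 G2) 1"
proof -
  have jk: "N - 1 - p < N" "N - 1 - q < N" "N - 1 - p \<noteq> N - 1 - q"
    "N - 1 - (N - 1 - p) = p" "N - 1 - (N - 1 - q) = q" using pq by auto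
  show ?thesis
    using gate2_word[OF pq G] mat_exp_block[OF H block e n jk(1-3)] unfolding jk by simp
qed

lemma pauli_X_eq: "pauli_X = mat 2 2 (\<lambda>(i, l). if i = l then 0 else 1)"
  by (rule eq_matI) (auto simp: pauli_X_def mat_of_rows_list_def less_2_cases_iff)

lemma pauli_Y_eq: "pauli_Y = mat 2 2 (\<lambda>(i, l). if i = l then 0 else if i = 0 then - \<i> else \<i>)"
  by (rule eq_matI) (auto simp: pauli_Y_def mat_of_rows_list_def less_2_cases_iff)

lemma pauli_Z_eq: "pauli_Z = mat 2 2 (\<lambda>(i, l). if i \<noteq> l then 0 else if i = 0 then 1 else - 1)"
  by (rule eq_matI) (auto simp: pauli_Z_def mat_of_rows_list_def less_2_cases_iff)

lemma R_mat_carrier: "R_mat \<in> carrier_mat 4 4"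
  by (simp add: R_mat_def kron_def pauli_X_eq pauli_Y_eq)

lemma R_mat_index: "i < 4 \<Longrightarrow> l < 4 \<Longrightarrow> R_mat $$ (i, l) = (if i \<noteq> l \<and> {i, l} = {1, 2} then 1 else 0)"
  unfolding less_4_cases
  by (elim disjE) (simp_all add: R_mat_def kron_def pauli_X_eq pauli_Y_eq doubleton_eq_iff)

lemma R_gate_word:
  assumes pq: "p < N" "q < N" "p \<noteq> q" and G: "mat_exp ((\<i> * complex_of_real \<alpha>) \<cdot>\<^sub>m R_mat) \<in> G2"
  shows "exchange p q (\<lambda>r. r < 2 ^ N) (axis_rotation 0 1 \<alpha>) \<in> words (mat_op ` gate_ops N G1 G2) 1"
  using block_gate_word[OF R_mat_carrier _ _ _ _ _ _ _ _ pq G, of 0 0 0 1 0 1]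
  by (simp add: R_mat_index doubleton_eq_iff exchange_phased_exchange cis_zero)

lemma mat_exp_pauli_Z:
  "mat_exp (c \<cdot>\<^sub>m pauli_Z) = mat 2 2 (\<lambda>(i, l). if i \<noteq> l then 0 else if i = 0 then exp c else exp (- c))"
proof -
  define D where "D = (\<lambda>(x::complex, y). mat 2 2 (\<lambda>(i::nat, l). if i \<noteq> l then 0 else if i = 0 then x else y))"
  have A: "c \<cdot>\<^sub>m pauli_Z = D (c, - c)"
    by (rule eq_matI) (auto simp: D_def pauli_Z_def mat_of_rows_list_def less_2_cases_iff)
  have D_mult: "D (x, y) * D (x', y') = D (x * x', y * y')" for x y x' y'
    by (rule eq_matI) (auto simp: D_def scalar_prod_def numeral_2_eq_2 less_Suc_eq)
  have pow: "D (c, - c) ^\<^sub>m k = D (c ^ k, (- c) ^ k)" for k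
  proof (induction k)
    case 0
    have "1\<^sub>m 2 = D (1, 1)" by (rule eq_matI) (auto simp: D_def)
    then show ?case by (simp add: D_def)
  next
    case (Suc k)
    then show ?case by (simp add: D_mult mult.commute)
  qed
  have sx: "(\<Sum>k. x ^ k / fact k) = exp x" for x :: complex
    using exp_combination_suminf[of 1 x 0 0 0 0 0 0] by simp
  have "dim_row (D (c, - c)) = 2" by (simp add: D_def)
  then have "mat_exp (D (c, - c)) = D (exp c, exp (- c))"
    unfolding mat_exp_def pow by (intro eq_matI) (auto simp: D_def sx)
  then show ?thesis by (simp add: A D_def)
qed

text \<open>One gate read in two ways, with its qubit first or second in the pair. Opposite angles
  on the two qubits then cancel the phases on |00> and |11>, while the angles on the block add
  up.\<close>

lemma Z_gate_word:
  assumes "p < N" "mat_exp ((\<i> * complex_of_real \<phi>) \<cdot>\<^sub>m pauli_Z) \<in> G1"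
  shows "phased_exchange N p q (cis \<phi>) 1 (cis (- \<phi>)) (zrot \<phi>) \<in> words (mat_op ` gate_ops N G1 G2) 1"
    and "phased_exchange N q p (cis \<phi>) 1 (cis (- \<phi>)) (zrot (- \<phi>)) \<in> words (mat_op ` gate_ops N G1 G2) 1"
proof -
  let ?g = "mat_exp ((\<i> * complex_of_real \<phi>) \<cdot>\<^sub>m pauli_Z)"
  have j: "N - 1 - p < N" "N - 1 - (N - 1 - p) = p" using assms(1) by auto
  have "mat_op (on_qubits N [N - 1 - p] ?g) f r
    = (if r < 2 ^ N then (if bit r p then cis (- \<phi>) else cis \<phi>) * f r else f r)" for f r
    using mat_op_on_qubit[OF j(1), of ?g] j(2) by (simp add: mat_exp_pauli_Z cis_conv_exp)
  then have "mat_op (on_qubits N [N - 1 - p] ?g) = phased_exchange N p q (cis \<phi>) 1 (cis (- \<phi>)) (zrot \<phi>)"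
    "mat_op (on_qubits N [N - 1 - p] ?g) = phased_exchange N q p (cis \<phi>) 1 (cis (- \<phi>)) (zrot (- \<phi>))"
    by (auto simp: fun_eq_iff phased_exchange_def exchange_def zrot_def cis_cnj)
  then show "phased_exchange N p q (cis \<phi>) 1 (cis (- \<phi>)) (zrot \<phi>) \<in> words (mat_op ` gate_ops N G1 G2) 1"
    "phased_exchange N q p (cis \<phi>) 1 (cis (- \<phi>)) (zrot (- \<phi>)) \<in> words (mat_op ` gate_ops N G1 G2) 1"
    using gate1_word[OF assms, of G2] by auto
qed

text \<open>S = diag(1, i) has determinant i on the block, hence the splitting into the phase
  \<open>cis (pi / 4)\<close> and a z rotation.\<close>

lemma S_gate_word:
  assumes "p < N"
  shows "phased_exchange N p q 1 (cis (pi / 4)) \<i> (zrot (- pi / 4)) \<in> words (mat_op ` gate_ops N {S_gate} G2) 1"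
proof -
  have j: "N - 1 - p < N" "N - 1 - (N - 1 - p) = p" using assms(1) by auto
  have e: "exp (\<i> * pi / 4) = cis (pi / 4)" "exp (- (\<i> * pi / 4)) = cis (- pi / 4)"
    by (simp_all add: cis_conv_exp)
  have c: "cis (pi / 4) * cis (- pi / 4) = 1" "cis (pi / 4) * cis (pi / 4) = \<i>"
    by (simp_all add: cis_mult)
  have S: "S_gate $$ (0, 0) = 1" "S_gate $$ (1, 1) = \<i>" "S_gate $$ (0, 1) = 0" "S_gate $$ (1, 0) = 0"
    using e c by (simp_all add: S_gate_def mat_exp_pauli_Z)
  have "mat_op (on_qubits N [N - 1 - p] S_gate) = phased_exchange N p q 1 (cis (pi / 4)) \<i> (zrot (- pi / 4))"
    unfolding fun_eq_iff mat_op_on_qubit[OF j(1) S(3,4)] j(2) S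
    using c by (auto simp: phased_exchange_def exchange_def zrot_def cis_cnj mult.assoc[symmetric])
  then show ?thesis using gate1_word[OF assms, of S_gate "{S_gate}" G2] by simp
qed

text \<open>\<open>U\<close> and \<open>U'\<close> carry the z axis to the two given axes. These
  coincide if \<open>su2_inv U \<odot> U'\<close> is diagonal and are opposite if it is
  antidiagonal; two nonzero entries mean that they are not parallel.\<close>

lemma two_axes_generate:
  fixes B :: "nat \<Rightarrow> (complex \<times> complex) set"
  assumes mul: "\<And>k k' w w'. w \<in> B k \<Longrightarrow> w' \<in> B k' \<Longrightarrow> w \<odot> w' \<in> B (k + k')"
    and U: "U \<in> SU2" "U' \<in> SU2" "fst (su2_inv U \<odot> U') \<noteq> 0" "snd (su2_inv U \<odot> U') \<noteq> 0"
    and r: "\<And>t. U \<odot> zrot t \<odot> su2_inv U \<in> B m" "\<And>t. U' \<odot> zrot t \<odot> su2_inv U' \<in> B m"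
  shows "\<exists>M. SU2 \<subseteq> B M"
proof (rule su2_bounded_generation[where B = B and U = U and Q = "su2_inv U \<odot> U'" and m = m])
  show "U \<odot> (su2_inv U \<odot> U' \<odot> zrot t \<odot> su2_inv (su2_inv U \<odot> U')) \<odot> su2_inv U \<in> B m" for t
  proof -
    have "U \<odot> (su2_inv U \<odot> U' \<odot> zrot t \<odot> su2_inv (su2_inv U \<odot> U')) \<odot> su2_inv U
      = (U \<odot> su2_inv U) \<odot> (U' \<odot> zrot t \<odot> su2_inv U') \<odot> (U \<odot> su2_inv U)"
      by (simp only: su2_inv_mult su2_inv_su2_inv su2_mult_assoc)
    then show ?thesis using r(2) U(1) by (simp add: su2_mult_su2_inv)
  qed
qed (use U r mul in \<open>auto intro: SU2_su2_mult SU2_su2_inv\<close>)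

text \<open>The first column is the normalized eigenvector of \<open>[[z, \<nu>], [cnj \<nu>, - z]]\<close> for the eigenvalue 1.\<close>

definition axis :: "real \<Rightarrow> complex \<Rightarrow> complex \<times> complex" where
  "axis z \<nu> = (\<nu> / sqrt (2 * (1 - z)), - (1 - z) / sqrt (2 * (1 - z)))"

text \<open>Nonzero \<open>\<nu>\<close> forces z < 1, so the normalization divides by a positive
  number. The conjugation formula comes down to the products \<open>a * cnj a\<close>,
  \<open>b * b\<close> and \<open>a * b\<close> of the entries.\<close>

lemma axis:
  fixes z :: real and \<nu> :: complex
  assumes n: "z ^ 2 + cmod \<nu> ^ 2 = 1" and \<nu>: "\<nu> \<noteq> 0"
  shows "axis z \<nu> \<in> SU2" "fst (axis z \<nu>) \<noteq> 0" "snd (axis z \<nu>) \<noteq> 0"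
    "axis z \<nu> \<odot> zrot t \<odot> su2_inv (axis z \<nu>) = axis_rotation z \<nu> t"
proof -
  have "z ^ 2 < 1" using n \<nu> by (smt (verit) zero_less_norm_iff zero_less_power)
  then have z: "z < 1" by (smt (verit) one_le_power)
  define \<rho> where "\<rho> = sqrt (2 * (1 - z))"
  have \<rho>: "\<rho> > 0" "\<rho> ^ 2 = 2 * (1 - z)" using z by (auto simp: \<rho>_def)
  have ax: "axis z \<nu> = (\<nu> / \<rho>, - (1 - z) / \<rho>)" by (simp add: axis_def \<rho>_def)
  show "fst (axis z \<nu>) \<noteq> 0" "snd (axis z \<nu>) \<noteq> 0"
    using z \<rho> \<nu> by (auto simp: ax complex_eq_iff)
  define a b where "a = \<nu> / complex_of_real \<rho>" and "b = complex_of_real (- (1 - z) / \<rho>)"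
  have ax: "axis z \<nu> = (a, b)" by (simp add: ax a_def b_def)
  have \<rho>2: "complex_of_real \<rho> * complex_of_real \<rho> = 2 * (1 - complex_of_real z)"
  proof -
    have "complex_of_real (\<rho> * \<rho>) = complex_of_real (2 * (1 - z))" using \<rho>(2) by (simp only: power2_eq_square)
    then show ?thesis by simp
  qed
  have "\<nu> * cnj \<nu> = complex_of_real (cmod \<nu> ^ 2)" by (rule complex_norm_square[symmetric])
  also have "cmod \<nu> ^ 2 = (1 - z) * (1 + z)" using n by (simp add: power2_eq_square algebra_simps)
  finally have nn: "\<nu> * cnj \<nu> = (1 - complex_of_real z) * (1 + complex_of_real z)" by simp
  define x where "x = 1 - complex_of_real z"
  have x: "x \<noteq> 0" using z by (simp add: x_def complex_eq_iff)
  have bx: "b = - (x / complex_of_real \<rho>)" by (simp add: b_def x_def minus_divide_left)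
  have cancel: "x * y / (2 * x) = y / 2" for y using x by simp
  have "a * cnj a = (\<nu> * cnj \<nu>) / (complex_of_real \<rho> * complex_of_real \<rho>)" by (simp add: a_def)
  then have aa: "a * cnj a = (1 + complex_of_real z) / 2" unfolding nn \<rho>2 x_def[symmetric] cancel .
  have "b * b = x * x / (complex_of_real \<rho> * complex_of_real \<rho>)" by (simp add: bx)
  then have bb: "b * b = (1 - complex_of_real z) / 2" unfolding \<rho>2 x_def[symmetric] cancel .
  have "a * b = x * (- \<nu>) / (complex_of_real \<rho> * complex_of_real \<rho>)" by (simp add: a_def bx mult.commute)
  then have ab: "a * b = - \<nu> / 2" unfolding \<rho>2 x_def[symmetric] cancel .
  have cb: "cnj b = b" by (simp add: b_def)
  show "axis z \<nu> \<in> SU2" by (simp add: ax SU2_def cb aa bb add_divide_distrib[symmetric])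
  have "axis z \<nu> \<odot> zrot t \<odot> su2_inv (axis z \<nu>)
    = ((a * cnj a) * cis t + (b * b) * cis (- t), (a * b) * (cis (- t) - cis t))"
    by (simp add: ax su2_mult_def su2_inv_def zrot_def cis_cnj cb algebra_simps)
  also have "\<dots> = axis_rotation z \<nu> t"
    unfolding aa bb ab by (simp add: axis_rotation_def complex_eq_iff field_simps)
  finally show "axis z \<nu> \<odot> zrot t \<odot> su2_inv (axis z \<nu>) = axis_rotation z \<nu> t" .
qed

lemma y_to_z_axis_rotation: "y_to_z = axis_rotation 0 1 (pi / 4)" "su2_inv y_to_z = axis_rotation 0 1 (- pi / 4)"
proof -
  have "1 / sqrt 2 = sqrt 2 / (2::real)" by (simp add: field_simps)
  then show "y_to_z = axis_rotation 0 1 (pi / 4)" "su2_inv y_to_z = axis_rotation 0 1 (- pi / 4)"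
    by (simp_all add: y_to_z_def su2_inv_def axis_rotation_def cos_45 sin_45 del: of_real_divide)
qed

lemma axis_rotation_0_mult: "axis_rotation 0 1 a \<odot> axis_rotation 0 1 b = axis_rotation 0 1 (a + b)"
  by (simp add: axis_rotation_def su2_mult_def cos_add sin_add algebra_simps)

section \<open>Exchange gates from the three gate sets\<close>

text \<open>Brings arbitrary angles into the range (-pi, pi] of the gate sets; the gates in question
  depend on the angle only through its cosine and sine.\<close>

lemma cis_Arg_cis: "cis (Arg (cis t)) = cis t"
  by (metis cis_Arg cis_neq_zero norm_cis sgn_eq scaleR_one inverse_1 sgn_div_norm)

lemma Arg_cis_mem: "Arg (cis t) \<in> {- pi <.. pi}"
  using Arg_bounded[of "cis t"] by auto

text \<open>Quantifying over \<open>N\<close>, \<open>p\<close> and \<open>q\<close> inside the set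
  makes every cost bound uniform in the number of qubits.\<close>

definition su2_words :: "(nat \<Rightarrow> complex mat set) \<Rightarrow> nat \<Rightarrow> (complex \<times> complex) set" where
  "su2_words G k = {w. \<forall>N p q. p < N \<and> q < N \<and> p \<noteq> q \<longrightarrow> exchange p q (\<lambda>r. r < 2 ^ N) w \<in> words (mat_op ` G N) k}"

lemma su2_words_mult:
  assumes "w \<in> su2_words G k" "w' \<in> su2_words G k'"
  shows "w \<odot> w' \<in> su2_words G (k + k')"
  unfolding su2_words_def
proof (intro CollectI allI impI)
  fix N p q :: nat assume pq: "p < N \<and> q < N \<and> p \<noteq> q"
  then have "exchange p q (\<lambda>r. r < 2 ^ N) w \<circ> exchange p q (\<lambda>r. r < 2 ^ N) w' \<in> words (mat_op ` G N) (k + k')"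
    using assms by (intro words_comp) (auto simp: su2_words_def)
  then show "exchange p q (\<lambda>r. r < 2 ^ N) (w \<odot> w') \<in> words (mat_op ` G N) (k + k')"
    using pq by (simp add: exchange_phased_exchange phased_exchange_mult)
qed

lemma su2_words_mono: "w \<in> su2_words G k \<Longrightarrow> k \<le> k' \<Longrightarrow> w \<in> su2_words G k'"
  unfolding su2_words_def using words_mono by blast

lemma su2_gates_subset: "SU2 \<subseteq> su2_words G M \<Longrightarrow> su2_gates N \<subseteq> words (mat_op ` G N) M"
  unfolding su2_words_def su2_gates_def by blast

lemma sqrt_iSWAP_su2:
  fixes G1 :: "complex mat set"
  defines "G1 \<equiv> {mat_exp ((\<i> * complex_of_real \<phi>) \<cdot>\<^sub>m pauli_Z) | \<phi>. \<phi> \<in> {- pi <.. pi}}"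
  shows "\<exists>M. \<forall>N. su2_gates N \<subseteq> words (mat_op ` gate_ops N G1 {sqrt_iSWAP}) M"
proof -
  let ?G = "\<lambda>N. gate_ops N G1 {sqrt_iSWAP}"
  let ?B = "su2_words ?G"
  have Zg: "mat_exp ((\<i> * complex_of_real \<phi>) \<cdot>\<^sub>m pauli_Z) \<in> G1" for \<phi>
  proof -
    have "exp (\<i> * complex_of_real (Arg (cis \<phi>))) = exp (\<i> * complex_of_real \<phi>)" for \<phi>
      using cis_Arg_cis[of \<phi>] by (simp only: cis_conv_exp)
    moreover have "exp (- (\<i> * complex_of_real (Arg (cis \<phi>)))) = exp (- (\<i> * complex_of_real \<phi>))"
      using calculation[of \<phi>] by (simp only: exp_minus)
    ultimately have "mat_exp ((\<i> * complex_of_real \<phi>) \<cdot>\<^sub>m pauli_Z)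
        = mat_exp ((\<i> * complex_of_real (Arg (cis \<phi>))) \<cdot>\<^sub>m pauli_Z)"
      by (simp only: mat_exp_pauli_Z)
    then show ?thesis unfolding G1_def using Arg_cis_mem by blast
  qed
  have z: "zrot t \<in> ?B 2" for t
    unfolding su2_words_def
  proof (intro CollectI allI impI)
    fix N p q :: nat assume pq: "p < N \<and> q < N \<and> p \<noteq> q"
    have "phased_exchange N p q (cis (t / 2)) 1 (cis (- (t / 2))) (zrot (t / 2))
      \<circ> phased_exchange N p q (cis (- (t / 2))) 1 (cis (- (- (t / 2)))) (zrot (- (- (t / 2)))) \<in> words (mat_op ` ?G N) (1 + 1)"
      using pq by (intro words_comp Z_gate_word Zg) auto
    then show "exchange p q (\<lambda>r. r < 2 ^ N) (zrot t) \<in> words (mat_op ` ?G N) 2"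
      using pq unfolding one_add_one by (simp add: phased_exchange_mult exchange_phased_exchange cis_mult zrot_mult)
  qed
  have h: "y_to_z \<in> ?B 1"
    unfolding su2_words_def
  proof (intro CollectI allI impI)
    fix N p q :: nat assume pq: "p < N \<and> q < N \<and> p \<noteq> q"
    have "sqrt_iSWAP = mat_exp ((\<i> * complex_of_real (pi / 4)) \<cdot>\<^sub>m R_mat)" by (simp add: sqrt_iSWAP_def)
    then show "exchange p q (\<lambda>r. r < 2 ^ N) y_to_z \<in> words (mat_op ` ?G N) 1"
      unfolding y_to_z_axis_rotation using pq by (intro R_gate_word) auto
  qed
  \<comment> \<open>The gate set does not list the inverse of sqrt(iSWAP). The fourth power of exp(i
    pi X / 4) is -1, so the cube is minus the inverse, and \<open>zrot pi\<close> supplies the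
    sign.\<close>
  have "su2_inv y_to_z = zrot pi \<odot> (y_to_z \<odot> (y_to_z \<odot> y_to_z))"
  proof -
    have "y_to_z \<odot> (y_to_z \<odot> y_to_z) = axis_rotation 0 1 (pi / 4 + (pi / 4 + pi / 4))" unfolding y_to_z_axis_rotation axis_rotation_0_mult ..
    moreover have "zrot pi \<odot> w = (- fst w, - snd w)" for w by (simp add: su2_mult_def zrot_def)
    moreover have "cos (- pi / 4) = - cos (pi / 4 + (pi / 4 + pi / 4))" "sin (- pi / 4) = - sin (pi / 4 + (pi / 4 + pi / 4))"
    proof -
      have "pi / 4 + (pi / 4 + pi / 4) = pi - pi / 4" by simp
      then show "cos (- pi / 4) = - cos (pi / 4 + (pi / 4 + pi / 4))" "sin (- pi / 4) = - sin (pi / 4 + (pi / 4 + pi / 4))"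
        by (simp_all only: cos_pi_minus sin_pi_minus) simp_all
    qed
    ultimately show ?thesis unfolding y_to_z_axis_rotation(2) by (simp add: axis_rotation_def)
  qed
  moreover have "zrot pi \<odot> (y_to_z \<odot> (y_to_z \<odot> y_to_z)) \<in> ?B (2 + (1 + (1 + 1)))" by (intro su2_words_mult z h)
  ultimately have "su2_inv y_to_z \<in> ?B (2 + (1 + (1 + 1)))" by argo
  then have r2: "y_to_z \<odot> zrot t \<odot> su2_inv y_to_z \<in> ?B (1 + 2 + (2 + (1 + (1 + 1))))" for t
    using z h by (intro su2_words_mult)
  have "\<exists>M. SU2 \<subseteq> ?B M"
  proof (rule two_axes_generate[where B = ?B and U = "(1, 0)" and U' = y_to_z and m = 8])
    show "(1, 0) \<odot> zrot t \<odot> su2_inv (1, 0) \<in> ?B 8" for t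
      using z[of t] su2_words_mono by (simp add: su2_inv_def)
    show "y_to_z \<odot> zrot t \<odot> su2_inv y_to_z \<in> ?B 8" for t
      using r2[of t] by simp
    show "(1, 0) \<in> SU2" "fst (su2_inv (1, 0) \<odot> y_to_z) \<noteq> 0" "snd (su2_inv (1, 0) \<odot> y_to_z) \<noteq> 0"
      by (simp_all add: SU2_def su2_inv_def y_to_z_def)
  qed (auto intro: su2_words_mult y_to_z_SU2)
  then show ?thesis using su2_gates_subset by blast
qed

section \<open>Cancelling phases by commutators\<close>

definition conj2 :: "complex \<times> complex \<Rightarrow> complex \<times> complex \<Rightarrow> complex \<times> complex" where
  "conj2 u w = u \<odot> w \<odot> su2_inv u"

definition comm2 :: "complex \<times> complex \<Rightarrow> complex \<times> complex \<Rightarrow> complex \<times> complex" where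
  "comm2 v w = v \<odot> w \<odot> su2_inv v \<odot> su2_inv w"

lemma conj2_mult: "u \<in> SU2 \<Longrightarrow> conj2 u v \<odot> conj2 u w = conj2 u (v \<odot> w)"
proof -
  assume u: "u \<in> SU2"
  have "conj2 u v \<odot> conj2 u w = u \<odot> v \<odot> (su2_inv u \<odot> u) \<odot> w \<odot> su2_inv u" by (simp only: conj2_def su2_mult_assoc)
  then show ?thesis using u by (simp add: su2_inv_su2_mult conj2_def) (simp add: su2_mult_assoc)
qed

lemma su2_inv_conj2: "su2_inv (conj2 u w) = conj2 u (su2_inv w)"
  by (simp add: conj2_def su2_inv_mult su2_mult_assoc)

lemma comm2_conj2: "u \<in> SU2 \<Longrightarrow> comm2 (conj2 u v) (conj2 u w) = conj2 u (comm2 v w)"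
  by (simp add: comm2_def su2_inv_conj2 conj2_mult)

lemma comm2_zrot: "comm2 (zrot (t / 2)) (0, 1) = zrot t"
  by (simp add: comm2_def zrot_def su2_mult_def su2_inv_def cis_cnj cis_mult)

text \<open>Words in the gates of the second gate set carry uncontrolled phases on the three eigenspaces of
  \<open>Z\<^sub>p + Z\<^sub>q\<close>. They cancel in commutators, and every element of SU(2) is a product of three commutators.\<close>

definition phased_words :: "(nat \<Rightarrow> complex mat set) \<Rightarrow> nat \<Rightarrow> (complex \<times> complex) set" where
  "phased_words G k = {w. \<forall>N p q. p < N \<and> q < N \<and> p \<noteq> q \<longrightarrow>
     (\<exists>x u y. x * cnj x = 1 \<and> u * cnj u = 1 \<and> y * cnj y = 1 \<and>
        phased_exchange N p q x u y w \<in> words (mat_op ` G N) k \<and>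
        phased_exchange N p q (cnj x) (cnj u) (cnj y) (su2_inv w) \<in> words (mat_op ` G N) k)}"

lemma phased_words_mult:
  assumes "w \<in> phased_words G k" "w' \<in> phased_words G k'"
  shows "w \<odot> w' \<in> phased_words G (k + k')"
  unfolding phased_words_def
proof (intro CollectI allI impI)
  fix N p q :: nat assume pq: "p < N \<and> q < N \<and> p \<noteq> q"
  obtain x u y where 1: "x * cnj x = 1" "u * cnj u = 1" "y * cnj y = 1"
    "phased_exchange N p q x u y w \<in> words (mat_op ` G N) k" "phased_exchange N p q (cnj x) (cnj u) (cnj y) (su2_inv w) \<in> words (mat_op ` G N) k"
    using assms(1) pq unfolding phased_words_def by blast
  obtain x' u' y' where 2: "x' * cnj x' = 1" "u' * cnj u' = 1" "y' * cnj y' = 1"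
    "phased_exchange N p q x' u' y' w' \<in> words (mat_op ` G N) k'" "phased_exchange N p q (cnj x') (cnj u') (cnj y') (su2_inv w') \<in> words (mat_op ` G N) k'"
    using assms(2) pq unfolding phased_words_def by blast
  have "x * x' * cnj (x * x') = (x * cnj x) * (x' * cnj x')" "u * u' * cnj (u * u') = (u * cnj u) * (u' * cnj u')"
    "y * y' * cnj (y * y') = (y * cnj y) * (y' * cnj y')" by (simp_all add: mult_ac)
  moreover have "phased_exchange N p q (x * x') (u * u') (y * y') (w \<odot> w') \<in> words (mat_op ` G N) (k + k')"
    using words_comp[OF 1(4) 2(4)] pq by (simp add: phased_exchange_mult)
  moreover have "phased_exchange N p q (cnj (x * x')) (cnj (u * u')) (cnj (y * y')) (su2_inv (w \<odot> w')) \<in> words (mat_op ` G N) (k + k')"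
    using words_comp[OF 2(5) 1(5)] pq by (simp add: phased_exchange_mult su2_inv_mult mult.commute add.commute)
  ultimately show "\<exists>x u y. x * cnj x = 1 \<and> u * cnj u = 1 \<and> y * cnj y = 1 \<and>
        phased_exchange N p q x u y (w \<odot> w') \<in> words (mat_op ` G N) (k + k') \<and>
        phased_exchange N p q (cnj x) (cnj u) (cnj y) (su2_inv (w \<odot> w')) \<in> words (mat_op ` G N) (k + k')"
    using 1(1-3) 2(1-3) by (intro exI[of _ "x * x'"] exI[of _ "u * u'"] exI[of _ "y * y'"]) simp
qed

lemma phased_words_su2_inv:
  assumes "w \<in> phased_words G k"
  shows "su2_inv w \<in> phased_words G k"
  unfolding phased_words_def
proof (intro CollectI allI impI)
  fix N p q :: nat assume pq: "p < N \<and> q < N \<and> p \<noteq> q"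
  obtain x u y where 1: "x * cnj x = 1" "u * cnj u = 1" "y * cnj y = 1"
    "phased_exchange N p q x u y w \<in> words (mat_op ` G N) k" "phased_exchange N p q (cnj x) (cnj u) (cnj y) (su2_inv w) \<in> words (mat_op ` G N) k"
    using assms(1) pq unfolding phased_words_def by blast
  then show "\<exists>x u y. x * cnj x = 1 \<and> u * cnj u = 1 \<and> y * cnj y = 1 \<and>
        phased_exchange N p q x u y (su2_inv w) \<in> words (mat_op ` G N) k \<and>
        phased_exchange N p q (cnj x) (cnj u) (cnj y) (su2_inv (su2_inv w)) \<in> words (mat_op ` G N) k"
    by (intro exI[of _ "cnj x"] exI[of _ "cnj u"] exI[of _ "cnj y"]) (simp add: mult.commute)
qed

lemma phased_words_mono:
  assumes "w \<in> phased_words G k" "k \<le> k'"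
  shows "w \<in> phased_words G k'"
  unfolding phased_words_def
proof (intro CollectI allI impI)
  fix N p q :: nat assume pq: "p < N \<and> q < N \<and> p \<noteq> q"
  obtain x u y where 1: "x * cnj x = 1" "u * cnj u = 1" "y * cnj y = 1"
    "phased_exchange N p q x u y w \<in> words (mat_op ` G N) k" "phased_exchange N p q (cnj x) (cnj u) (cnj y) (su2_inv w) \<in> words (mat_op ` G N) k"
    using assms(1) pq unfolding phased_words_def by blast
  note 2 = words_mono[OF 1(4) assms(2)] words_mono[OF 1(5) assms(2)]
  show "\<exists>x u y. x * cnj x = 1 \<and> u * cnj u = 1 \<and> y * cnj y = 1 \<and>
        phased_exchange N p q x u y w \<in> words (mat_op ` G N) k' \<and>
        phased_exchange N p q (cnj x) (cnj u) (cnj y) (su2_inv w) \<in> words (mat_op ` G N) k'"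
    by (intro exI[of _ x] exI[of _ u] exI[of _ y] conjI 1 2)
qed

text \<open>The phases are scalars on each eigenspace, so in a commutator each one meets its
  conjugate. This is why \<open>phased_words\<close> asks for the inverse with conjugate phases
  instead of arbitrary ones.\<close>

lemma phased_words_comm2:
  assumes "v \<in> phased_words G k" "w \<in> phased_words G k"
  shows "comm2 v w \<in> su2_words G (k + k + k + k)"
  unfolding su2_words_def
proof (intro CollectI allI impI)
  fix N p q :: nat assume pq: "p < N \<and> q < N \<and> p \<noteq> q"
  obtain x u y where 1: "x * cnj x = 1" "u * cnj u = 1" "y * cnj y = 1"
    "phased_exchange N p q x u y v \<in> words (mat_op ` G N) k" "phased_exchange N p q (cnj x) (cnj u) (cnj y) (su2_inv v) \<in> words (mat_op ` G N) k"
    using assms(1) pq unfolding phased_words_def by blast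
  obtain x' u' y' where 2: "x' * cnj x' = 1" "u' * cnj u' = 1" "y' * cnj y' = 1"
    "phased_exchange N p q x' u' y' w \<in> words (mat_op ` G N) k" "phased_exchange N p q (cnj x') (cnj u') (cnj y') (su2_inv w) \<in> words (mat_op ` G N) k"
    using assms(2) pq unfolding phased_words_def by blast
  have phase: "a * a' * cnj a * cnj a' = (a * cnj a) * (a' * cnj a')" for a a' :: complex by (simp add: mult_ac)
  have 3: "x * x' * cnj x * cnj x' = 1" "u * u' * cnj u * cnj u' = 1" "y * y' * cnj y * cnj y' = 1"
    by (simp_all only: phase 1 2 mult_1)
  have "phased_exchange N p q x u y v \<circ> phased_exchange N p q x' u' y' w \<circ> phased_exchange N p q (cnj x) (cnj u) (cnj y) (su2_inv v)
      \<circ> phased_exchange N p q (cnj x') (cnj u') (cnj y') (su2_inv w) \<in> words (mat_op ` G N) (k + k + k + k)"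
    by (intro words_comp 1 2)
  then show "exchange p q (\<lambda>r. r < 2 ^ N) (comm2 v w) \<in> words (mat_op ` G N) (k + k + k + k)"
    using pq by (simp add: phased_exchange_mult exchange_phased_exchange comm2_def 3)
qed

text \<open>The three Euler factors are conjugates of z rotations, and every z rotation is a
  commutator with \<open>(0, 1)\<close>, which inverts z rotations. A commutator uses four words of
  cost \<open>k\<close>, hence 12 k.\<close>

lemma phased_to_su2_words:
  assumes "SU2 \<subseteq> phased_words G k"
  shows "SU2 \<subseteq> su2_words G (12 * k)"
proof
  fix w assume w: "w \<in> SU2"
  have j: "(0, 1) \<in> SU2" by (simp add: SU2_def)
  have c: "conj2 u (zrot t) \<in> su2_words G (k + k + k + k)" if u: "u \<in> SU2" for u t
  proof -
    have cu: "conj2 u v \<in> SU2" if "v \<in> SU2" for v unfolding conj2_def using u that by (intro SU2_su2_mult SU2_su2_inv)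
    have "comm2 (conj2 u (zrot (t / 2))) (conj2 u (0, 1)) \<in> su2_words G (k + k + k + k)"
      by (intro phased_words_comm2 subsetD[OF assms] cu zrot_SU2 j)
    then show ?thesis by (simp add: comm2_conj2 u comm2_zrot)
  qed
  have one: "(1, 0) \<in> SU2" by (simp add: SU2_def)
  have z: "zrot t \<in> su2_words G (k + k + k + k)" for t
    using c[OF one, of t] by (simp add: conj2_def su2_inv_def)
  have y: "yrot t \<in> su2_words G (k + k + k + k)" for t
    using c[OF SU2_su2_inv[OF y_to_z_SU2], of "- t"] by (simp add: conj2_def y_to_z_conj')
  obtain u t v where "w = zrot u \<odot> yrot t \<odot> zrot v" using euler[OF w] by blast
  then have "w \<in> su2_words G ((k + k + k + k) + (k + k + k + k) + (k + k + k + k))"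
    using z y by (auto intro!: su2_words_mult)
  then show "w \<in> su2_words G (12 * k)" by (rule su2_words_mono) simp
qed

text \<open>\<open>t\<close> is the mean and \<open>s\<close> half the gap of the eigenvalues of the
  block, and \<open>z\<close>, \<open>\<nu>\<close> are the coordinates of its axis. Nonzero
  \<open>\<nu>\<close> expresses that \<open>H\<close> is not diagonal.\<close>

lemma hamiltonian_block_form:
  assumes H: "H \<in> carrier_mat 4 4" "hermitian_mat H"
    and comm: "commutator H (pauli_Z \<otimes>\<^sub>m 1\<^sub>m 2) = - commutator H (1\<^sub>m 2 \<otimes>\<^sub>m pauli_Z)"
      "commutator H (pauli_Z \<otimes>\<^sub>m 1\<^sub>m 2) \<noteq> 0\<^sub>m 4 4"
  obtains h0 h3 t s z :: real and \<nu> :: complex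
  where "\<And>i l. i < 4 \<Longrightarrow> l < 4 \<Longrightarrow> i \<noteq> l \<Longrightarrow> {i, l} \<noteq> {1, 2} \<Longrightarrow> H $$ (i, l) = 0"
    "H $$ (0, 0) = h0" "H $$ (3, 3) = h3" "H $$ (1, 1) = t + s * z" "H $$ (2, 2) = t - s * z"
    "H $$ (1, 2) = s * \<nu>" "H $$ (2, 1) = s * cnj \<nu>"
    "z ^ 2 + cmod \<nu> ^ 2 = 1" "\<nu> \<noteq> 0" "0 < s"
proof -
  let ?Z1 = "pauli_Z \<otimes>\<^sub>m 1\<^sub>m 2" and ?Z2 = "1\<^sub>m 2 \<otimes>\<^sub>m pauli_Z"
  define z1 z2 :: "nat \<Rightarrow> complex" where "z1 i = (if i < 2 then 1 else - 1)" and "z2 i = (if even i then 1 else - 1)" for i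
  have Z1: "?Z1 \<in> carrier_mat 4 4" "?Z2 \<in> carrier_mat 4 4" by (simp_all add: kron_def pauli_Z_eq)
  have Z1i: "?Z1 $$ (i, l) = (if i = l then z1 i else 0)" if "i < 4" "l < 4" for i l
    using that unfolding less_4_cases by (elim disjE) (simp_all add: kron_def pauli_Z_eq z1_def)
  have Z2i: "?Z2 $$ (i, l) = (if i = l then z2 i else 0)" if "i < 4" "l < 4" for i l
    using that unfolding less_4_cases by (elim disjE) (simp_all add: kron_def pauli_Z_eq z2_def)
  have comm_index: "commutator H Z $$ (i, l) = H $$ (i, l) * (\<zeta> l - \<zeta> i)"
    if Z: "Z \<in> carrier_mat 4 4" "\<And>i l. i < 4 \<Longrightarrow> l < 4 \<Longrightarrow> Z $$ (i, l) = (if i = l then \<zeta> i else 0)"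
      and il: "i < 4" "l < 4" for Z i l and \<zeta> :: "nat \<Rightarrow> complex"
  proof -
    have "commutator H Z $$ (i, l) = (\<Sum>k<4. H $$ (i, k) * Z $$ (k, l)) - (\<Sum>k<4. Z $$ (i, k) * H $$ (k, l))"
      using H Z(1) il by (simp add: commutator_def scalar_prod_def atLeast0LessThan)
    also have "(\<Sum>k<4. H $$ (i, k) * Z $$ (k, l)) = (\<Sum>k<4. if k = l then H $$ (i, l) * \<zeta> l else 0)"
      using Z(2) il by (intro sum.cong) auto
    also have "(\<Sum>k<4. Z $$ (i, k) * H $$ (k, l)) = (\<Sum>k<4. if k = i then \<zeta> i * H $$ (i, l) else 0)"
      using Z(2) il by (intro sum.cong) auto
    finally show ?thesis using il by (simp add: algebra_simps)
  qed
  note c1 = comm_index[OF Z1(1) Z1i] and c2 = comm_index[OF Z1(2) Z2i]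
  have cdim: "commutator H ?Z2 \<in> carrier_mat 4 4" "commutator H ?Z1 \<in> carrier_mat 4 4"
    using H Z1 by (auto simp: commutator_def)
  have block: "H $$ (i, l) = 0" if il: "i < 4" "l < 4" "i \<noteq> l" "{i, l} \<noteq> {1, 2}" for i l
  proof -
    have "commutator H ?Z1 $$ (i, l) = - (commutator H ?Z2 $$ (i, l))"
      using comm(1) cdim il by simp
    then have "H $$ (i, l) * (z1 l - z1 i) = - (H $$ (i, l) * (z2 l - z2 i))"
      using c1 c2 il by simp
    \<comment> \<open>\<open>H\<close> commutes with the sum of the two Z operators, whose
      eigenvalues 2, 0, 0, -2 coincide only at the indices 1 and 2.\<close>
    then have "H $$ (i, l) * ((z1 l + z2 l) - (z1 i + z2 i)) = 0" by (simp add: algebra_simps)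
    moreover have "(z1 l + z2 l) - (z1 i + z2 i) \<noteq> 0"
      using il unfolding less_4_cases by (elim disjE) (simp_all add: z1_def z2_def doubleton_eq_iff)
    ultimately show ?thesis by simp
  qed
  have herm: "H $$ (i, l) = cnj (H $$ (l, i))" if "i < 4" "l < 4" for i l
    using mat_adjoint_index[of i H l] H that by (auto simp: hermitian_mat_def)
  have c: "H $$ (1, 2) \<noteq> 0"
  proof
    assume 0: "H $$ (1, 2) = 0"
    then have 1: "H $$ (2, 1) = 0" using herm[of 2 1] by simp
    have "commutator H ?Z1 $$ (i, l) = 0" if il: "i < 4" "l < 4" for i l
    proof (cases "i = l")
      case False
      then have "H $$ (i, l) = 0" using block[OF il False] 0 1 by (auto simp: doubleton_eq_iff)
      then show ?thesis using c1[OF _ _ il] by simp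
    qed (use c1[OF _ _ il] in simp)
    then have "commutator H ?Z1 = 0\<^sub>m 4 4" using cdim by (intro eq_matI) auto
    then show False using comm by blast
  qed
  define b d where "b = Re (H $$ (1, 1))" and "d = Re (H $$ (2, 2))"
  have re: "H $$ (i, i) = complex_of_real (Re (H $$ (i, i)))" if "i < 4" for i
    using herm[OF that that] by (simp add: complex_eq_iff)
  define s where "s = sqrt (((b - d) / 2) ^ 2 + cmod (H $$ (1, 2)) ^ 2)"
  have s2: "s ^ 2 = ((b - d) / 2) ^ 2 + cmod (H $$ (1, 2)) ^ 2" by (simp add: s_def)
  have s: "0 < s" using c by (simp add: s_def add_nonneg_pos)
  define z where "z = (b - d) / 2 / s"
  define \<nu> where "\<nu> = H $$ (1, 2) / s"
  show ?thesis
  proof (rule that[of "Re (H $$ (0, 0))" "Re (H $$ (3, 3))" "(b + d) / 2" s z \<nu>])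
    have sz: "s * z = (b - d) / 2" using s by (simp add: z_def)
    show "H $$ (0, 0) = complex_of_real (Re (H $$ (0, 0)))" "H $$ (3, 3) = complex_of_real (Re (H $$ (3, 3)))"
      by (intro re; simp)+
    have "(b + d) / 2 + s * z = b" "(b + d) / 2 - s * z = d" unfolding sz by (simp_all add: field_simps)
    then have bd: "H $$ (1, 1) = complex_of_real ((b + d) / 2 + s * z)" "H $$ (2, 2) = complex_of_real ((b + d) / 2 - s * z)"
      using re[of 1] re[of 2] by (simp_all only: b_def[symmetric] d_def[symmetric])
    show "H $$ (1, 1) = (b + d) / 2 + s * z" "H $$ (2, 2) = (b + d) / 2 - s * z"
      unfolding bd by simp_all
    show "H $$ (1, 2) = complex_of_real s * \<nu>" using s by (simp add: \<nu>_def)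
    then show "H $$ (2, 1) = complex_of_real s * cnj \<nu>" using herm[of 2 1] by simp
    show "\<nu> \<noteq> 0" using c s by (simp add: \<nu>_def)
    have "z ^ 2 + cmod \<nu> ^ 2 = (((b - d) / 2) ^ 2 + cmod (H $$ (1, 2)) ^ 2) / s ^ 2"
      using s by (simp only: z_def \<nu>_def norm_divide norm_of_real power_divide add_divide_distrib abs_of_pos)
    then show "z ^ 2 + cmod \<nu> ^ 2 = 1" unfolding s2[symmetric] using s by simp
  qed (use block s in auto)
qed

lemma hamiltonian_su2:
  assumes H: "H \<in> carrier_mat 4 4" "hermitian_mat H"
    and comm: "commutator H (pauli_Z \<otimes>\<^sub>m 1\<^sub>m 2) = - commutator H (1\<^sub>m 2 \<otimes>\<^sub>m pauli_Z)"
      "commutator H (pauli_Z \<otimes>\<^sub>m 1\<^sub>m 2) \<noteq> 0\<^sub>m 4 4"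
  shows "\<exists>M. \<forall>N. su2_gates N \<subseteq> words (mat_op ` gate_ops N {S_gate} {mat_exp ((\<i> * complex_of_real \<alpha>) \<cdot>\<^sub>m H) | \<alpha>. \<alpha> \<in> UNIV}) M"
proof -
  let ?G2 = "{mat_exp ((\<i> * complex_of_real \<alpha>) \<cdot>\<^sub>m H) | \<alpha>. \<alpha> \<in> UNIV}"
  let ?G = "\<lambda>N. gate_ops N {S_gate} ?G2"
  let ?A = "phased_words ?G"
  obtain h0 h3 t s z :: real and \<nu> :: complex where
    block: "\<And>i l. i < 4 \<Longrightarrow> l < 4 \<Longrightarrow> i \<noteq> l \<Longrightarrow> {i, l} \<noteq> {1, 2} \<Longrightarrow> H $$ (i, l) = 0"
    and e: "H $$ (0, 0) = h0" "H $$ (3, 3) = h3" "H $$ (1, 1) = t + s * z" "H $$ (2, 2) = t - s * z"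
      "H $$ (1, 2) = s * \<nu>" "H $$ (2, 1) = s * cnj \<nu>"
    and n: "z ^ 2 + cmod \<nu> ^ 2 = 1" and \<nu>: "\<nu> \<noteq> 0" and s: "0 < s"
    by (rule hamiltonian_block_form[OF H comm]) blast
  have n': "complex_of_real z ^ 2 + \<nu> * cnj \<nu> = 1"
    using n by (metis complex_norm_square of_real_1 of_real_add of_real_power)
  have hr: "axis_rotation z \<nu> a \<in> ?A 1" for a
    unfolding phased_words_def
  proof (intro CollectI allI impI)
    fix N p q :: nat assume pq: "p < N \<and> q < N \<and> p \<noteq> q"
    have w: "phased_exchange N p q (cis (\<alpha> * h0)) (cis (\<alpha> * t)) (cis (\<alpha> * h3)) (axis_rotation z \<nu> (\<alpha> * s)) \<in> words (mat_op ` ?G N) 1" for \<alpha>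
      using pq by (intro block_gate_word[OF H(1) block e n']) auto
    have i: "su2_inv (axis_rotation z \<nu> (a / s * s)) = axis_rotation z \<nu> (- (a / s) * s)"
      by (simp add: axis_rotation_def su2_inv_def)
    have "phased_exchange N p q (cnj (cis (a / s * h0))) (cnj (cis (a / s * t))) (cnj (cis (a / s * h3))) (su2_inv (axis_rotation z \<nu> (a / s * s)))
      \<in> words (mat_op ` ?G N) 1"
      using w[of "- (a / s)"] unfolding i by (simp add: cis_cnj)
    moreover have "a / s * s = a" using s by simp
    ultimately show "\<exists>x u y. x * cnj x = 1 \<and> u * cnj u = 1 \<and> y * cnj y = 1 \<and>
        phased_exchange N p q x u y (axis_rotation z \<nu> a) \<in> words (mat_op ` ?G N) 1 \<and>
        phased_exchange N p q (cnj x) (cnj u) (cnj y) (su2_inv (axis_rotation z \<nu> a)) \<in> words (mat_op ` ?G N) 1"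
      using w[of "a / s"]
      by (intro exI[of _ "cis (a / s * h0)"] exI[of _ "cis (a / s * t)"] exI[of _ "cis (a / s * h3)"])
        (simp add: cis_cnj cis_mult)
  qed
  have zr: "zrot (- pi / 4) \<in> ?A 3"
    unfolding phased_words_def
  proof (intro CollectI allI impI)
    fix N p q :: nat assume pq: "p < N \<and> q < N \<and> p \<noteq> q"
    let ?S = "phased_exchange N p q 1 (cis (pi / 4)) \<i> (zrot (- pi / 4))"
    have S: "?S \<in> words (mat_op ` ?G N) 1" using pq by (intro S_gate_word) auto
    then have S3: "?S \<in> words (mat_op ` ?G N) 3" by (rule words_mono) simp
    have pq': "p < N" "q < N" "p \<noteq> q" and i3: "\<i> * \<i> * \<i> = - \<i>" using pq by simp_all
    \<comment> \<open>S has order 4, so three applications give its inverse.\<close>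
    have "?S \<circ> ?S \<circ> ?S \<in> words (mat_op ` ?G N) (1 + 1 + 1)" using S by (intro words_comp)
    moreover have "1 + 1 + 1 = (3::nat)" by simp
    ultimately have "phased_exchange N p q 1 (cis (pi / 4 + pi / 4 + pi / 4)) (- \<i>) (zrot (- pi / 4 + - pi / 4 + - pi / 4)) \<in> words (mat_op ` ?G N) 3"
      by (simp only: phased_exchange_mult[OF pq'] zrot_mult cis_mult mult_1 i3)
    \<comment> \<open>Phase and rotation both differ by a sign from the required ones; only their
      product acts.\<close>
    moreover have "phased_exchange N p q 1 (cis (pi / 4 + pi / 4 + pi / 4)) (- \<i>) (zrot (- pi / 4 + - pi / 4 + - pi / 4))
      = phased_exchange N p q 1 (cnj (cis (pi / 4))) (cnj \<i>) (su2_inv (zrot (- pi / 4)))"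
    proof -
      have cis_uminus_pi: "cis (- pi) = - 1" by (simp add: complex_eq_iff)
      have "3 * pi / 4 = pi + - (pi / 4)" "- (3 * pi / 4) = - pi + pi / 4" by simp_all
      then have c: "cis (3 * pi / 4) = - cis (- (pi / 4))" "cis (- (3 * pi / 4)) = - cis (pi / 4)"
        by (simp_all only: cis_mult[symmetric] cis_pi cis_uminus_pi mult_minus_left mult_1)
      show ?thesis
        unfolding fun_eq_iff by (auto simp: phased_exchange_def exchange_def zrot_def su2_inv_def c cis_cnj)
    qed
    ultimately show "\<exists>x u y. x * cnj x = 1 \<and> u * cnj u = 1 \<and> y * cnj y = 1 \<and>
        phased_exchange N p q x u y (zrot (- pi / 4)) \<in> words (mat_op ` ?G N) 3 \<and>
        phased_exchange N p q (cnj x) (cnj u) (cnj y) (su2_inv (zrot (- pi / 4))) \<in> words (mat_op ` ?G N) 3"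
      using S3 by (intro exI[of _ 1] exI[of _ "cis (pi / 4)"] exI[of _ \<i>]) (simp add: cis_cnj cis_mult)
  qed
  let ?T = "axis z \<nu>" and ?S = "zrot (- pi / 4)"
  note T = axis[OF n \<nu>]
  have "\<exists>M. SU2 \<subseteq> ?A M"
  \<comment> \<open>S turns the axis of \<open>H\<close> by a right angle about the z axis. As
    \<open>\<nu>\<close> is nonzero, that axis is not the z axis itself, so its image is never
    parallel to it.\<close>
  proof (rule two_axes_generate[where B = ?A and U = ?T and U' = "?S \<odot> ?T" and m = 7])
    show "?T \<odot> zrot t \<odot> su2_inv ?T \<in> ?A 7" for t
      unfolding T(4) by (rule phased_words_mono[OF hr]) simp
    show "?S \<odot> ?T \<odot> zrot t \<odot> su2_inv (?S \<odot> ?T) \<in> ?A 7" for t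
    proof -
      have "?S \<odot> ?T \<odot> zrot t \<odot> su2_inv (?S \<odot> ?T) = ?S \<odot> (?T \<odot> zrot t \<odot> su2_inv ?T) \<odot> su2_inv ?S"
        by (simp only: su2_inv_mult su2_mult_assoc)
      also have "\<dots> \<in> ?A (3 + 1 + 3)" unfolding T(4) using zr hr phased_words_su2_inv by (intro phased_words_mult) auto
      finally show ?thesis by simp
    qed
    obtain a b where ab: "?T = (a, b)" by fastforce
    have nz: "a \<noteq> 0" "b \<noteq> 0" using T(2,3) ab by auto
    have one: "a * cnj a + b * cnj b = 1" using T(1) ab by (simp add: SU2_def)
    have ci: "cis (- pi / 4) = (1 - \<i>) / sqrt 2"
      by (simp add: complex_eq_iff cos_45 sin_45 real_div_sqrt field_simps)
    have q: "su2_inv ?T \<odot> (?S \<odot> ?T) = (cnj a * cis (- pi / 4) * a + b * cnj (cis (- pi / 4)) * cnj b,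
        cnj a * b * (cis (- pi / 4) - cnj (cis (- pi / 4))))"
      by (simp add: ab su2_mult_def su2_inv_def zrot_def algebra_simps)
    show "snd (su2_inv ?T \<odot> (?S \<odot> ?T)) \<noteq> 0"
    proof -
      have "Im (cis (- pi / 4) - cnj (cis (- pi / 4))) \<noteq> 0" by (simp add: sin_45)
      then have "cis (- pi / 4) - cnj (cis (- pi / 4)) \<noteq> 0" by (metis zero_complex.sel(2))
      then show ?thesis unfolding q snd_conv using nz by (simp only: mult_eq_0_iff complex_cnj_zero_iff simp_thms)
    qed
    \<comment> \<open>Both summands have real part cos (pi / 4) times a squared modulus, so the
      total is 1 / sqrt 2.\<close>
    have "Re (cnj a * cis (- pi / 4) * a + b * cnj (cis (- pi / 4)) * cnj b) = Re ((a * cnj a + b * cnj b) / sqrt 2)"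
      unfolding ci by (simp add: field_simps)
    then show "fst (su2_inv ?T \<odot> (?S \<odot> ?T)) \<noteq> 0"
      unfolding q one by (auto simp: complex_eq_iff)
  qed (use T in \<open>auto intro: phased_words_mult SU2_su2_mult zrot_SU2\<close>)
  then show ?thesis using phased_to_su2_words su2_gates_subset[of ?G] by blast
qed

section \<open>XY interactions with a helper qubit\<close>

lemma exchange_add_ancilla: "p \<noteq> q \<Longrightarrow> exchange (Suc p) (Suc q) (\<lambda>r. r < 2 ^ Suc N) w (add_ancilla \<psi>) = add_ancilla (exchange p q (\<lambda>r. r < 2 ^ N) w \<psi>)"
proof (rule ext)
  fix r assume pq: "p \<noteq> q"
  then have pq': "Suc p \<noteq> Suc q" by simp
  show "exchange (Suc p) (Suc q) (\<lambda>r. r < 2 ^ Suc N) w (add_ancilla \<psi>) r = add_ancilla (exchange p q (\<lambda>r. r < 2 ^ N) w \<psi>) r"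
  proof (cases "even r")
    case True
    have "even (flip_bits (Suc p) (Suc q) r)" using True bit_flip_bits[OF pq', of r 0] by (simp add: bit_0)
    moreover have "flip_bits (Suc p) (Suc q) r div 2 = flip_bits p q (r div 2)"
      by (rule bit_eqI) (simp add: bit_flip_bits pq bit_Suc[symmetric])
    moreover have "r < 2 ^ Suc N \<longleftrightarrow> r div 2 < 2 ^ N" by (simp add: less_mult_imp_div_less) (use True in presburger)
    ultimately show ?thesis using True by (simp add: exchange_def add_ancilla_def bit_Suc)
  next
    case False
    have "odd (flip_bits (Suc p) (Suc q) r)" using False bit_flip_bits[OF pq', of r 0] by (simp add: bit_0)
    then show ?thesis using False by (simp add: exchange_def add_ancilla_def)
  qed
qed

text \<open>Conjugating an exchange with the helper qubit (bit 0, always in \<open>|0\<rangle>\<close>) by iSWAP turns its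
  rotation axis from \<open>x\<close> into \<open>y\<close>.\<close>

lemma R_su2:
  fixes G2 :: "complex mat set"
  defines "G2 \<equiv> {mat_exp ((\<i> * complex_of_real \<alpha>) \<cdot>\<^sub>m R_mat) | \<alpha>. \<alpha> \<in> {- pi <.. pi}}"
  shows "\<exists>M. \<forall>N. \<forall>g \<in> su2_gates N. \<exists>g' \<in> words (mat_op ` gate_ops (Suc N) {} G2) M. \<forall>\<psi>. g' (add_ancilla \<psi>) = add_ancilla (g \<psi>)"
proof -
  let ?W = "\<lambda>N. words (mat_op ` gate_ops (Suc N) {} G2)"
  have R: "exchange p q (\<lambda>r. r < 2 ^ N) (axis_rotation 0 1 a) \<in> words (mat_op ` gate_ops N {} G2) 1"
    if pq: "p < N" "q < N" "p \<noteq> q" for N p q a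
  proof -
    have "cos (Arg (cis a)) = cos a" "sin (Arg (cis a)) = sin a"
      using cis_Arg_cis[of a] by (simp_all add: complex_eq_iff)
    then have "axis_rotation 0 1 a = axis_rotation 0 1 (Arg (cis a))" by (simp add: axis_rotation_def)
    moreover have "mat_exp ((\<i> * complex_of_real (Arg (cis a))) \<cdot>\<^sub>m R_mat) \<in> G2"
      unfolding G2_def using Arg_cis_mem by blast
    ultimately show ?thesis using R_gate_word[OF pq] by simp
  qed
  \<comment> \<open>Agreement is demanded only on states with the helper in |0>. The image is again
    such a state, so costs still add under composition.\<close>
  define B where "B k = {w. \<forall>N p q. p < N \<and> q < N \<and> p \<noteq> q \<longrightarrow>
    (\<exists>g' \<in> ?W N k. \<forall>\<psi>. g' (add_ancilla \<psi>) = add_ancilla (exchange p q (\<lambda>r. r < 2 ^ N) w \<psi>))}" for k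
  have mult: "w \<odot> w' \<in> B (k + k')" if h: "w \<in> B k" "w' \<in> B k'" for w w' k k'
    unfolding B_def
  proof (intro CollectI allI impI)
    fix N p q :: nat assume pq: "p < N \<and> q < N \<and> p \<noteq> q"
    obtain g where g: "g \<in> ?W N k" "\<forall>\<psi>. g (add_ancilla \<psi>) = add_ancilla (exchange p q (\<lambda>r. r < 2 ^ N) w \<psi>)"
      using h(1) pq unfolding B_def by blast
    obtain g' where g': "g' \<in> ?W N k'" "\<forall>\<psi>. g' (add_ancilla \<psi>) = add_ancilla (exchange p q (\<lambda>r. r < 2 ^ N) w' \<psi>)"
      using h(2) pq unfolding B_def by blast
    have "exchange p q (\<lambda>r. r < 2 ^ N) w (exchange p q (\<lambda>r. r < 2 ^ N) w' \<psi>) = exchange p q (\<lambda>r. r < 2 ^ N) (w \<odot> w') \<psi>" for \<psi>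
      using pq by (intro ext exchange_mult) (auto simp: flip_bits_less)
    then show "\<exists>g' \<in> ?W N (k + k'). \<forall>\<psi>. g' (add_ancilla \<psi>) = add_ancilla (exchange p q (\<lambda>r. r < 2 ^ N) (w \<odot> w') \<psi>)"
      using words_comp[OF g(1) g'(1)] g(2) g'(2) by (intro bexI[of _ "g \<circ> g'"]) simp_all
  qed
  have x: "axis_rotation 0 1 a \<in> B 3" for a
    unfolding B_def
  proof (intro CollectI allI impI)
    fix N p q :: nat assume pq: "p < N \<and> q < N \<and> p \<noteq> q"
    then have "exchange (Suc p) (Suc q) (\<lambda>r. r < 2 ^ Suc N) (axis_rotation 0 1 a) \<in> ?W N 1" by (intro R) auto
    then have "exchange (Suc p) (Suc q) (\<lambda>r. r < 2 ^ Suc N) (axis_rotation 0 1 a) \<in> ?W N 3" by (rule words_mono) simp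
    then show "\<exists>g' \<in> ?W N 3. \<forall>\<psi>. g' (add_ancilla \<psi>) = add_ancilla (exchange p q (\<lambda>r. r < 2 ^ N) (axis_rotation 0 1 a) \<psi>)"
      using exchange_add_ancilla pq by blast
  qed
  have y: "yrot a \<in> B 3" for a
    unfolding B_def
  proof (intro CollectI allI impI)
    fix N p q :: nat assume pq: "p < N \<and> q < N \<and> p \<noteq> q"
    let ?P = "\<lambda>r. r < 2 ^ Suc N"
    \<comment> \<open>\<open>(0, \<i>)\<close> is the block of iSWAP, the rotation by pi / 2. For
      helper bit 0 the gadget multiplies the off-diagonal entry i sin a by the conjugate of i, which
      gives sin a.\<close>
    let ?g = "exchange 0 (Suc p) ?P (0, \<i>) \<circ> exchange 0 (Suc q) ?P (axis_rotation 0 1 a) \<circ> exchange 0 (Suc p) ?P (0, - \<i>)"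
    have "axis_rotation 0 1 (pi / 2) = (0, \<i>)" "axis_rotation 0 1 (- (pi / 2)) = (0, - \<i>)" by (simp_all add: axis_rotation_def)
    then have "?g \<in> ?W N (1 + 1 + 1)"
      using R[of 0 "Suc N" "Suc p" "pi / 2"] R[of 0 "Suc N" "Suc p" "- (pi / 2)"] R[of 0 "Suc N" "Suc q" a] pq
      by (intro words_comp) auto
    moreover have "1 + 1 + 1 = (3::nat)" by simp
    ultimately have "?g \<in> ?W N 3" by argo
    moreover have "?g (add_ancilla \<psi>) = add_ancilla (exchange p q (\<lambda>r. r < 2 ^ N) (yrot a) \<psi>)" for \<psi>
    proof (rule ext)
      fix r
      have d: "distinct [0, Suc p, Suc q]" and pq': "p \<noteq> q" using pq by simp_all
      have gadget: "?g (add_ancilla \<psi>) r = (if bit r 0 then exchange (Suc p) (Suc q) ?P (fst (axis_rotation 0 1 a), - cnj \<i> * snd (axis_rotation 0 1 a)) (add_ancilla \<psi>) r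
         else exchange (Suc p) (Suc q) ?P (fst (axis_rotation 0 1 a), cnj \<i> * snd (axis_rotation 0 1 a)) (add_ancilla \<psi>) r)"
        using exchange_gadget[OF d, of "Suc N" \<i> "fst (axis_rotation 0 1 a)" "snd (axis_rotation 0 1 a)"] pq by simp
      show "?g (add_ancilla \<psi>) r = add_ancilla (exchange p q (\<lambda>r. r < 2 ^ N) (yrot a) \<psi>) r"
        unfolding gadget exchange_add_ancilla[OF pq'] by (simp add: bit_0 axis_rotation_def yrot_def) (simp add: add_ancilla_def)
    qed
    ultimately show "\<exists>g' \<in> ?W N 3. \<forall>\<psi>. g' (add_ancilla \<psi>) = add_ancilla (exchange p q (\<lambda>r. r < 2 ^ N) (yrot a) \<psi>)" by blast
  qed
  have n: "(0::real) ^ 2 + cmod 1 ^ 2 = 1" by simp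
  note T = axis[OF n one_neq_zero]
  have "\<exists>M. SU2 \<subseteq> B M"
  proof (rule two_axes_generate[where B = B and U = "axis 0 1" and U' = "su2_inv y_to_z" and m = 3])
    show "axis 0 1 \<odot> zrot t \<odot> su2_inv (axis 0 1) \<in> B 3" for t unfolding T(4) by (rule x)
    show "su2_inv y_to_z \<odot> zrot t \<odot> su2_inv (su2_inv y_to_z) \<in> B 3" for t
      using y[of "- t"] y_to_z_conj'[of "- t"] by simp
    \<comment> \<open>The x and y axes are orthogonal, so both entries have modulus 1 / sqrt
      2.\<close>
    have "su2_inv (axis 0 1) \<odot> su2_inv y_to_z = ((1 - \<i>) / 2, (1 - \<i>) / 2)"
    proof -
      define h where "h = complex_of_real (1 / sqrt 2)"
      have h: "h * h = 1 / 2" "cnj h = h" using sqrt_half_sq by (simp_all add: h_def del: of_real_divide)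
      have "axis 0 1 = (h, - h)" by (simp add: axis_def h_def)
      then show ?thesis
        by (simp add: y_to_z_def h_def[symmetric] su2_mult_def su2_inv_def h diff_divide_distrib del: of_real_divide)
          (use h(1) in \<open>simp add: field_simps\<close>)
    qed
    then show "fst (su2_inv (axis 0 1) \<odot> su2_inv y_to_z) \<noteq> 0" "snd (su2_inv (axis 0 1) \<odot> su2_inv y_to_z) \<noteq> 0"
      by (simp_all add: complex_eq_iff)
  qed (use mult T(1) y_to_z_SU2 SU2_su2_inv in auto)
  then obtain M where M: "SU2 \<subseteq> B M" by blast
  have "\<exists>g' \<in> ?W N M. \<forall>\<psi>. g' (add_ancilla \<psi>) = add_ancilla (g \<psi>)" if g: "g \<in> su2_gates N" for N g
  proof -
    obtain p q w where "g = exchange p q (\<lambda>r. r < 2 ^ N) w" "p < N" "q < N" "p \<noteq> q" "w \<in> SU2"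
      using g unfolding su2_gates_def by blast
    then show ?thesis using M unfolding B_def by blast
  qed
  then show ?thesis by blast
qed

theorem theorem1:
  shows
    "(\<exists>C::real. \<forall>n \<ge> 1. \<forall>V \<in> carrier_mat (2 ^ n) (2 ^ n).
        unitary_mat V \<and> energy_conserving n V \<longrightarrow>
        (\<exists>m. realizable_with n 1
               {mat_exp ((\<i> * complex_of_real \<phi>) \<cdot>\<^sub>m pauli_Z) | \<phi>. \<phi> \<in> {- pi <.. pi}}
               {sqrt_iSWAP} V m \<and>
             real m \<le> C * 4 ^ n * real n powr (3 / 2)))
     \<and>
     (\<forall>H \<in> carrier_mat 4 4.
        hermitian_mat H \<and>
        commutator H (pauli_Z \<otimes>\<^sub>m 1\<^sub>m 2) = - commutator H (1\<^sub>m 2 \<otimes>\<^sub>m pauli_Z) \<and>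
        commutator H (pauli_Z \<otimes>\<^sub>m 1\<^sub>m 2) \<noteq> 0\<^sub>m 4 4 \<longrightarrow>
        (\<exists>C::real. \<forall>n \<ge> 1. \<forall>V \<in> carrier_mat (2 ^ n) (2 ^ n).
           unitary_mat V \<and> energy_conserving n V \<longrightarrow>
           (\<exists>m. realizable_with n 1
                  {S_gate}
                  {mat_exp ((\<i> * complex_of_real \<alpha>) \<cdot>\<^sub>m H) | \<alpha>. \<alpha> \<in> UNIV} V m \<and>
                real m \<le> C * 4 ^ n * real n powr (3 / 2))))
     \<and>
     (\<exists>C::real. \<forall>n \<ge> 1. \<forall>V \<in> carrier_mat (2 ^ n) (2 ^ n).
        unitary_mat V \<and> energy_conserving n V \<longrightarrow>
        (\<exists>m. realizable_with n 2
               {}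
               {mat_exp ((\<i> * complex_of_real \<alpha>) \<cdot>\<^sub>m R_mat) | \<alpha>. \<alpha> \<in> {- pi <.. pi}} V m \<and>
             real m \<le> C * 4 ^ n * real n powr (3 / 2)))"
  (is "?iSWAP \<and> ?int \<and> ?XY")
proof (intro conjI)
  show ?iSWAP
    using sqrt_iSWAP_su2 by (elim exE, intro realizable_from_su2_gates) blast
  show ?int
  proof (intro ballI impI, elim conjE)
    fix H assume "H \<in> carrier_mat 4 4" "hermitian_mat H"
      "commutator H (pauli_Z \<otimes>\<^sub>m 1\<^sub>m 2) = - commutator H (1\<^sub>m 2 \<otimes>\<^sub>m pauli_Z)"
      "commutator H (pauli_Z \<otimes>\<^sub>m 1\<^sub>m 2) \<noteq> 0\<^sub>m 4 4"
    from hamiltonian_su2[OF this] obtain M where M: "\<And>N. su2_gates N \<subseteq> words (mat_op ` gate_ops N {S_gate}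
        {mat_exp ((\<i> * complex_of_real \<alpha>) \<cdot>\<^sub>m H) | \<alpha>. \<alpha> \<in> UNIV}) M" by blast
    show "\<exists>C::real. \<forall>n \<ge> 1. \<forall>V \<in> carrier_mat (2 ^ n) (2 ^ n).
           unitary_mat V \<and> energy_conserving n V \<longrightarrow>
           (\<exists>m. realizable_with n 1 {S_gate} {mat_exp ((\<i> * complex_of_real \<alpha>) \<cdot>\<^sub>m H) | \<alpha>. \<alpha> \<in> UNIV} V m \<and>
                real m \<le> C * 4 ^ n * real n powr (3 / 2))"
      using M by (rule realizable_from_su2_gates)
  qed
  show ?XY
    using R_su2 by (elim exE, intro realizable_with_helper) blast
qed

end
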